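(* Let $\mathbf{k}$ be a nonzero commutative ring. For each $n\ge 3$, there exist an $(n-1)$-complex $L$ and a non-trivial (i.e. nonzero) element $x\in\mathbf{k}\mathcal{K}_L$ such that $x\cdot x=0$ in $\mathbf{k}\mathcal{K}_L$.
   Context: All CW complexes are finite; an $n$-complex is an $n$-dimensional CW complex. An $(n+1)$-deformation is a finite composition of elementary expansions and elementary collapses (in the sense of simple homotopy theory) involving only cells of dimension at most $n+1$. For $n\ge2$ and an $(n-1)$-complex $L$, $\mathcal{K}_L$ is the set of equivalence classes of $n$-complexes $K$ equipped with an identification of a subcomplex of the $(n-1)$-skeleton of $K$ with $L$, considered up to $(n+1)$-deformations restricting to the identity on $L$. $L$ is called the boundary of $K$. $\mathcal{K}_L$ carries a commutative associative product $K\cdot K'$ given by the union of $K$ and $K'$ glued along the common boundary $L$; the unit is $L$ itself (with no $n$-cells). $\mathbf{k}\mathcal{K}_L$ is the free $\mathbf{k}$-module with basis $\mathcal{K}_L$, with the product extended $\mathbf{k}$-bilinearly. *)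

theory Defs
  imports "HOL-Homology.Homology" "HOL-Library.Poly_Mapping"
begin

section \<open>Finite CW complexes\<close>

definition disk_set :: "nat \<Rightarrow> (nat \<Rightarrow> real) set" where
  "disk_set m = {x \<in> topspace (Euclidean_space m). (\<Sum>i<m. (x i)\<^sup>2) \<le> 1}"

definition disk_interior :: "nat \<Rightarrow> (nat \<Rightarrow> real) set" where
  "disk_interior m = {x \<in> topspace (Euclidean_space m). (\<Sum>i<m. (x i)\<^sup>2) < 1}"

definition disk_boundary :: "nat \<Rightarrow> (nat \<Rightarrow> real) set" where
  "disk_boundary m = {x \<in> topspace (Euclidean_space m). (\<Sum>i<m. (x i)\<^sup>2) = 1}"

definition disk :: "nat \<Rightarrow> (nat \<Rightarrow> real) topology" where
  "disk m = subtopology (Euclidean_space m) (disk_set m)"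

text \<open>The set \<open>cw_cells K m\<close> consists of the open \<open>m\<close>-cells of \<open>K\<close>.\<close>

record 'a cw =
  cw_space :: "'a topology"
  cw_cells :: "nat \<Rightarrow> 'a set set"

definition cw_points :: "'a cw \<Rightarrow> 'a set" where
  "cw_points K = topspace (cw_space K)"

definition skeleton :: "'a cw \<Rightarrow> nat \<Rightarrow> 'a set" where
  "skeleton K m = (\<Union>k\<le>m. \<Union>(cw_cells K k))"

definition characteristic_map :: "'a cw \<Rightarrow> nat \<Rightarrow> 'a set \<Rightarrow> ((nat \<Rightarrow> real) \<Rightarrow> 'a) \<Rightarrow> bool" where
  "characteristic_map K m e \<phi> \<longleftrightarrow>
     continuous_map (disk m) (cw_space K) \<phi> \<and>
     homeomorphic_map (subtopology (disk m) (disk_interior m)) (subtopology (cw_space K) e) \<phi> \<and>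
     \<phi> ` disk_boundary m \<subseteq> (\<Union>k<m. \<Union>(cw_cells K k))"

text \<open>Since there are finitely many cells, closure-finiteness and the weak topology are automatic.\<close>

definition finite_cw :: "'a cw \<Rightarrow> bool" where
  "finite_cw K \<longleftrightarrow>
     Hausdorff_space (cw_space K) \<and>
     finite {(m, e). e \<in> cw_cells K m} \<and>
     (\<Union>m. \<Union>(cw_cells K m)) = cw_points K \<and>
     (\<forall>m e m' e'. e \<in> cw_cells K m \<and> e' \<in> cw_cells K m' \<and> (m, e) \<noteq> (m', e') \<longrightarrow> e \<inter> e' = {}) \<and>
     (\<forall>m. \<forall>e \<in> cw_cells K m. e \<subseteq> cw_points K \<and> (\<exists>\<phi>. characteristic_map K m e \<phi>))"

definition cw_dim_le :: "'a cw \<Rightarrow> nat \<Rightarrow> bool" where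
  "cw_dim_le K d \<longleftrightarrow> (\<forall>m>d. cw_cells K m = {})"

definition cw_dim_eq :: "'a cw \<Rightarrow> nat \<Rightarrow> bool" where
  "cw_dim_eq K d \<longleftrightarrow> cw_dim_le K d \<and> cw_cells K d \<noteq> {}"

definition cw_isomorphism :: "'a cw \<Rightarrow> 'a cw \<Rightarrow> ('a \<Rightarrow> 'a) \<Rightarrow> bool" where
  "cw_isomorphism K K' f \<longleftrightarrow>
     homeomorphic_map (cw_space K) (cw_space K') f \<and>
     (\<forall>m. cw_cells K' m = (\<lambda>e. f ` e) ` cw_cells K m)"

definition subcomplex :: "'a cw \<Rightarrow> 'a cw \<Rightarrow> bool" where
  "subcomplex A K \<longleftrightarrow>
     finite_cw A \<and> finite_cw K \<and>
     cw_points A \<subseteq> cw_points K \<and>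
     cw_space A = subtopology (cw_space K) (cw_points A) \<and>
     (\<forall>m. cw_cells A m \<subseteq> cw_cells K m)"

text \<open>An isomorphism of \<open>A\<close> onto a subcomplex of \<open>K\<close>. It preserves dimensions of cells, so the image
  lies in the \<open>d\<close>-skeleton of \<open>K\<close> if \<open>A\<close> has dimension at most \<open>d\<close>.\<close>

definition cw_embedding :: "'a cw \<Rightarrow> 'a cw \<Rightarrow> ('a \<Rightarrow> 'a) \<Rightarrow> bool" where
  "cw_embedding A K f \<longleftrightarrow> (\<exists>B. subcomplex B K \<and> cw_isomorphism A B f)"


section \<open>Elementary expansions and deformations\<close>

definition upper_hemisphere_map :: "nat \<Rightarrow> (nat \<Rightarrow> real) \<Rightarrow> (nat \<Rightarrow> real)" where
  "upper_hemisphere_map m x = x(m := sqrt (1 - (\<Sum>i<m. (x i)\<^sup>2)))"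

definition lower_hemisphere :: "nat \<Rightarrow> (nat \<Rightarrow> real) set" where
  "lower_hemisphere m = {x \<in> disk_boundary (Suc m). x m \<le> 0}"

text \<open>\<open>Y\<close> is obtained from its subcomplex \<open>X\<close> by adding an \<open>m\<close>-cell \<open>e\<close> and an \<open>(m+1)\<close>-cell \<open>e'\<close>
  with \<open>e\<close> as a free face. This is Cohen's definition; as the ball pair (homeomorphic to
  \<open>(I\<^sup>m\<^sup>+\<^sup>1, I\<^sup>m)\<close>) we use the \<open>(m+1)\<close>-disk with the upper hemisphere of its boundary, the latter
  parametrized by the \<open>m\<close>-disk.\<close>

definition elementary_expansion :: "nat \<Rightarrow> 'a cw \<Rightarrow> 'a cw \<Rightarrow> bool" where
  "elementary_expansion m X Y \<longleftrightarrow>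
     subcomplex X Y \<and>
     (\<exists>e e' \<phi>.
        e \<notin> cw_cells X m \<and> e' \<notin> cw_cells X (Suc m) \<and>
        cw_cells Y = (cw_cells X)(m := insert e (cw_cells X m),
                                  Suc m := insert e' (cw_cells X (Suc m))) \<and>
        characteristic_map Y (Suc m) e' \<phi> \<and>
        characteristic_map Y m e (\<phi> \<circ> upper_hemisphere_map m) \<and>
        \<phi> ` lower_hemisphere m \<subseteq> skeleton X m)"

text \<open>A complex \<open>K\<close> together with an identification \<open>i\<close> of a subcomplex of \<open>K\<close> with \<open>L\<close>
  (only the restriction of \<open>i\<close> to the points of \<open>L\<close> matters).\<close>

type_synonym 'a bounded_cw = "'a cw \<times> ('a \<Rightarrow> 'a)"

text \<open>The bound \<open>d\<close> is an upper bound on the dimension: the unit \<open>L\<close> of the product below is an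
  \<open>n\<close>-complex with boundary \<open>L\<close>, although it has no \<open>n\<close>-cells.\<close>

definition complexes_over :: "nat \<Rightarrow> 'a cw \<Rightarrow> 'a bounded_cw set" where
  "complexes_over d L = {(K, i). finite_cw K \<and> cw_dim_le K d \<and> cw_embedding L K i}"

text \<open>Elementary expansions involving only cells of dimension at most \<open>d\<close>, relative to \<open>L\<close>.\<close>

definition expansion_step :: "nat \<Rightarrow> 'a cw \<Rightarrow> ('a bounded_cw \<times> 'a bounded_cw) set" where
  "expansion_step d L =
     {((X, i), (Y, j)). (X, i) \<in> complexes_over d L \<and> (Y, j) \<in> complexes_over d L \<and>
        (\<exists>m. Suc m \<le> d \<and> elementary_expansion m X Y) \<and>
        (\<forall>x \<in> cw_points L. j x = i x)}"

definition isomorphism_step :: "nat \<Rightarrow> 'a cw \<Rightarrow> ('a bounded_cw \<times> 'a bounded_cw) set" where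
  "isomorphism_step d L =
     {((X, i), (Y, j)). (X, i) \<in> complexes_over d L \<and> (Y, j) \<in> complexes_over d L \<and>
        (\<exists>f. cw_isomorphism X Y f \<and> (\<forall>x \<in> cw_points L. j x = f (i x)))}"

text \<open>Complexes are regarded up to cellular isomorphism rel \<open>L\<close>. This also makes room for
  expansions: a complex can be replaced by a copy of itself that leaves points of the type unused.\<close>

definition deformation :: "nat \<Rightarrow> 'a cw \<Rightarrow> ('a bounded_cw \<times> 'a bounded_cw) set" where
  "deformation d L =
     (expansion_step d L \<union> (expansion_step d L)\<inverse> \<union> isomorphism_step d L)\<^sup>*"


section \<open>The monoid of complexes with boundary \<open>L\<close> and its algebra\<close>

definition deformation_rel :: "nat \<Rightarrow> 'a cw \<Rightarrow> ('a bounded_cw \<times> 'a bounded_cw) set" where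
  "deformation_rel n L =
     deformation (n + 1) L \<inter> (complexes_over n L \<times> complexes_over n L)"

definition KL :: "nat \<Rightarrow> 'a cw \<Rightarrow> 'a bounded_cw set set" where
  "KL n L = complexes_over n L // deformation_rel n L"

text \<open>\<open>M\<close> is a union of copies of \<open>K\<close> and \<open>K'\<close> meeting exactly in their common boundary \<open>L\<close>. Such an
  \<open>M\<close> is unique up to isomorphism rel \<open>L\<close>: it is Hausdorff and the two copies are compact, hence
  closed, so \<open>M\<close> has the topology of the pushout. It exists if the type of points has at
  least the cardinality of the continuum.\<close>

definition is_gluing ::
  "'a cw \<Rightarrow> 'a bounded_cw \<Rightarrow> 'a bounded_cw \<Rightarrow> 'a bounded_cw \<Rightarrow> bool" where
  "is_gluing L = (\<lambda>(K, i) (K', i') (M, j).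
     finite_cw M \<and>
     (\<exists>f f'. cw_embedding K M f \<and> cw_embedding K' M f' \<and>
        (\<forall>x \<in> cw_points L. f (i x) = j x \<and> f' (i' x) = j x) \<and>
        f ` cw_points K \<union> f' ` cw_points K' = cw_points M \<and>
        f ` cw_points K \<inter> f' ` cw_points K' = j ` cw_points L))"

text \<open>The class of the gluing of representatives.\<close>

definition KL_mult ::
  "nat \<Rightarrow> 'a cw \<Rightarrow> 'a bounded_cw set \<Rightarrow> 'a bounded_cw set \<Rightarrow> 'a bounded_cw set" where
  "KL_mult n L a b = deformation_rel n L `` {M. \<exists>K\<in>a. \<exists>K'\<in>b. is_gluing L K K' M}"

definition kKL :: "nat \<Rightarrow> 'a cw \<Rightarrow> ('a bounded_cw set \<Rightarrow>\<^sub>0 'k::comm_ring_1) set" where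
  "kKL n L = {x. Poly_Mapping.keys x \<subseteq> KL n L}"

definition kKL_mult ::
  "nat \<Rightarrow> 'a cw \<Rightarrow> ('a bounded_cw set \<Rightarrow>\<^sub>0 'k::comm_ring_1) \<Rightarrow> ('a bounded_cw set \<Rightarrow>\<^sub>0 'k)
     \<Rightarrow> ('a bounded_cw set \<Rightarrow>\<^sub>0 'k)" where
  "kKL_mult n L x y =
     (\<Sum>a\<in>Poly_Mapping.keys x. \<Sum>b\<in>Poly_Mapping.keys y.
        Poly_Mapping.single (KL_mult n L a b)
          (Poly_Mapping.lookup x a * Poly_Mapping.lookup y b))"

text \<open>The type whose elements serve as points of complexes. Complexes carry arbitrary topologies
  on subsets of it; a finite CW complex has at most continuum many points, so each one is
  isomorphic to one of this kind.\<close>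

type_synonym point = "nat \<Rightarrow> real"


section \<open>Basic consistency facts\<close>

lemma cw_isomorphism_id: "cw_isomorphism K K (\<lambda>x. x)"
  using homeomorphic_map_id[of "cw_space K" "cw_space K"]
  by (simp add: cw_isomorphism_def id_def)

lemma isomorphism_step_sym: "sym (isomorphism_step d L)"
proof (rule symI, clarify)
  fix X i Y j assume "((X, i), (Y, j)) \<in> isomorphism_step d (L :: 'a cw)"
  then obtain f where XY: "(X, i) \<in> complexes_over d L" "(Y, j) \<in> complexes_over d L"
    and f: "cw_isomorphism X Y f" and fi: "\<And>x. x \<in> cw_points L \<Longrightarrow> j x = f (i x)"
    by (auto simp: isomorphism_step_def)
  have hom: "homeomorphic_map (cw_space X) (cw_space Y) f"
    using f by (simp add: cw_isomorphism_def)
  then obtain g where fg: "homeomorphic_maps (cw_space X) (cw_space Y) f g"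
    using homeomorphic_map_maps by blast
  have gf: "g (f x) = x" if "x \<in> cw_points X" for x
    using fg that by (simp add: homeomorphic_maps_def cw_points_def)
  have sub: "e \<subseteq> cw_points X" if "e \<in> cw_cells X m" for e m
    using XY that by (auto simp: complexes_over_def finite_cw_def)
  have "g ` f ` e = e" if "e \<in> cw_cells X m" for e m
    using sub[OF that] gf by (force simp: image_image)
  then have "cw_isomorphism Y X g"
    using f homeomorphic_maps_map[of "cw_space X" "cw_space Y" f g] fg
    by (auto simp: cw_isomorphism_def image_image)
  moreover have "i x = g (j x)" if "x \<in> cw_points L" for x
  proof -
    obtain B where B: "subcomplex B X" "cw_isomorphism L B i"
      using XY by (auto simp: complexes_over_def cw_embedding_def)
    then have "i x \<in> cw_points B"
      using that homeomorphic_imp_surjective_map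
      by (fastforce simp: cw_isomorphism_def cw_points_def)
    then have "i x \<in> cw_points X"
      using B by (auto simp: subcomplex_def)
    then show ?thesis using gf fi[OF that] by simp
  qed
  ultimately show "((Y, j), (X, i)) \<in> isomorphism_step d L"
    using XY by (auto simp: isomorphism_step_def)
qed

lemma equiv_deformation_rel: "equiv (complexes_over n L) (deformation_rel n L)"
proof -
  have "sym (expansion_step (n+1) L \<union> (expansion_step (n+1) L)\<inverse> \<union> isomorphism_step (n+1) L)"
    by (intro sym_Un sym_Un_converse isomorphism_step_sym)
  then have "sym (deformation (n+1) L)"
    unfolding deformation_def by (rule sym_rtrancl)
  then have "sym (deformation_rel n L)"
    unfolding deformation_rel_def by (intro sym_Int) (auto simp: sym_def)
  moreover have "trans (deformation_rel n L)"
    unfolding deformation_rel_def deformation_def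
    by (intro trans_Int trans_rtrancl) (auto simp: trans_def)
  moreover have "refl_on (complexes_over n L) (deformation_rel n L)"
    by (simp add: refl_on_def deformation_rel_def deformation_def)
  moreover have "deformation_rel n L \<subseteq> complexes_over n L \<times> complexes_over n L"
    by (simp add: deformation_rel_def)
  ultimately show ?thesis
    by (simp add: equiv_def)
qed

lemma KL_mult_commute: "KL_mult n L a b = KL_mult n L b a"
proof -
  have "is_gluing L K K' M \<Longrightarrow> is_gluing L K' K M" for K K' M
    unfolding is_gluing_def
    apply (clarsimp split: prod.splits)
    subgoal for _ _ _ _ _ _ f f'
      by (rule exI[of _ f'], simp, rule exI[of _ f]) (simp add: Un_commute Int_commute)
    done
  then show ?thesis unfolding KL_mult_def
    by (intro arg_cong[where f = "\<lambda>S. deformation_rel n L `` S"] Collect_cong iffI; elim bexE) blast+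
qed

end

theory Submission
  imports Defs "HOL-Analysis.Analysis"
begin

text \<open>The boundary \<open>L\<close> consists of a circle, an \<open>(n - 1)\<close>-cell attached by a constant map and a
  2-cell attached by \<open>z^5\<close>; attaching one more 2-cell to \<open>L\<close> by \<open>z^v\<close> gives \<open>K v\<close>, and
  \<open>x = [K 1] - [K 2]\<close>. Since \<open>v\<close> is prime to 5, the circle is null-homotopic in \<open>K v\<close>, so that
  further attaching maps \<open>z^1\<close> and \<open>z^2\<close> become homotopic there. Complexes that differ by homotopic
  attaching maps of a 2-cell are related by the expansion and collapse of a 3-cell. Hence the four
  products \<open>K v \<cdot> K w\<close> are equal and \<open>x \<cdot> x = 0\<close>. On the other hand, a deformation relative to
  \<open>L\<close> induces an isomorphism of the groups \<open>H\<^sub>2(K v, L)\<close>, which are infinite cyclic, over their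
  boundary maps to \<open>H\<^sub>1(L)\<close>. These send the generators to \<open>v s\<close> up to sign, where \<open>s\<close> is the class of the
  circle; as \<open>s\<close> has order 5, it differs from \<open>2 s\<close> and \<open>-2 s\<close>.\<close>

section \<open>Compact Hausdorff spaces glued from two pieces\<close>

text \<open>The modulus 5 is the least one with units that differ even up to sign: modulo 2, 3 and 4
  every unit is 1 or -1, and a generator of an infinite cyclic group is determined only up to sign.
  The \<open>(n - 1)\<close>-cell gives \<open>L\<close> its dimension, and \<open>n \<ge> 3\<close>
  leaves room in \<open>L\<close> for a 2-cell. Null homotopies in \<open>K 1\<close> and in
  \<open>K 2\<close> each identify only two of the four products; commutativity joins the two pairs.
  Two obstacles shape the development. The product of classes ranges over all representatives, so
  gluing along \<open>L\<close> has to be compatible with every step of a deformation. Finite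
  complexes are compact Hausdorff, so continuity out of a glued space can be checked on its pieces,
  and quotient topologies occur only in the construction of spaces.\<close>

lemma continuous_map_out_of_two_pieces:
  assumes "Hausdorff_space T" "compact_space X" "compact_space B"
    and p: "continuous_map X T p" and q: "continuous_map B T q"
    and cover: "topspace T \<subseteq> p ` topspace X \<union> q ` topspace B"
    and hp: "continuous_map X T' (\<lambda>x. h (p x))" and hq: "continuous_map B T' (\<lambda>x. h (q x))"
  shows "continuous_map T T' h"
proof -
  have im: "p x \<in> topspace T" if "x \<in> topspace X" for x
    using p that by (auto simp: continuous_map_def)
  have iq: "q x \<in> topspace T" if "x \<in> topspace B" for x
    using q that by (auto simp: continuous_map_def)
  have "h x \<in> topspace T'" if "x \<in> topspace T" for x
    using hp hq cover that by (auto simp: continuous_map_def Pi_iff dest!: subsetD)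
  moreover have "closedin T {x \<in> topspace T. h x \<in> C}" if C: "closedin T' C" for C
  proof -
    \<comment> \<open>The preimage of a closed set is a union of images of closed subsets of the two
      pieces; these images are compact, hence closed in the Hausdorff space
      \<open>T\<close>.\<close>
    have eq: "{x \<in> topspace T. h x \<in> C} =
        p ` {x \<in> topspace X. h (p x) \<in> C} \<union> q ` {x \<in> topspace B. h (q x) \<in> C}"
      using cover im iq by blast
    have "compactin X {x \<in> topspace X. h (p x) \<in> C}" "compactin B {x \<in> topspace B. h (q x) \<in> C}"
      using closedin_continuous_map_preimage[OF hp C] closedin_continuous_map_preimage[OF hq C]
        assms closedin_compact_space by blast+
    then have "compactin T (p ` {x \<in> topspace X. h (p x) \<in> C})"
       "compactin T (q ` {x \<in> topspace B. h (q x) \<in> C})"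
      using p q image_compactin by blast+
    then show ?thesis
      unfolding eq using assms(1) by (intro closedin_Un compactin_imp_closedin) auto
  qed
  ultimately show ?thesis
    by (simp add: continuous_map_closedin)
qed

text \<open>On an adjunction space real functions are easy to construct from the pieces, disjoint
  open sets are not.\<close>

lemma Hausdorff_space_if_real_functions_separate:
  assumes "\<And>u v. u \<in> topspace T \<Longrightarrow> v \<in> topspace T \<Longrightarrow> u \<noteq> v \<Longrightarrow>
     \<exists>g. continuous_map T euclideanreal g \<and> g u \<noteq> g v"
  shows "Hausdorff_space T"
  unfolding Hausdorff_space_def
proof (intro allI impI, elim conjE)
  fix u v assume uv: "u \<in> topspace T" "v \<in> topspace T" "u \<noteq> v"
  then obtain g where g: "continuous_map T euclideanreal g" "g u \<noteq> g v"
    using assms by blast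
  then obtain U V where UV: "open U" "open V" "g u \<in> U" "g v \<in> V" "U \<inter> V = {}"
    using hausdorff[OF g(2)] by blast
  show "\<exists>U V. openin T U \<and> openin T V \<and> u \<in> U \<and> v \<in> V \<and> disjnt U V"
  proof (intro exI conjI)
    show "openin T {x \<in> topspace T. g x \<in> U}" "openin T {x \<in> topspace T. g x \<in> V}"
      using openin_continuous_map_preimage[OF g(1)] UV by auto
  qed (use uv UV in \<open>auto simp: disjnt_def\<close>)
qed

text \<open>This is the adjunction space of \<open>X\<close> and \<open>B\<close> along
  \<open>f\<close>, realised on a prescribed point set by \<open>p\<close> and \<open>q\<close>. The
  substance is that it is Hausdorff: Tietze extends a function on \<open>X\<close> over
  \<open>B\<close>, and Urysohn gives functions on \<open>B\<close> that vanish on \<open>A\<close>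
  and so extend by zero over \<open>X\<close>; together these separate all points.\<close>

lemma adjunction_space_exists:
  fixes X :: "'a topology" and B :: "'b topology" and p :: "'a \<Rightarrow> 'c" and q :: "'b \<Rightarrow> 'c"
  assumes X: "compact_space X" "Hausdorff_space X" and B: "compact_space B" "Hausdorff_space B"
    and A: "closedin B A" and f: "continuous_map (subtopology B A) X f"
    and p: "inj_on p (topspace X)" and q: "inj_on q (topspace B - A)"
    and disj: "q ` (topspace B - A) \<inter> p ` topspace X = {}"
    and qf: "\<And>a. a \<in> A \<Longrightarrow> q a = p (f a)"
  obtains T where "topspace T = p ` topspace X \<union> q ` topspace B" "compact_space T"
    "Hausdorff_space T" "continuous_map X T p" "continuous_map B T q"
proof -
  define S where "S = p ` topspace X \<union> q ` topspace B"
  \<comment> \<open>The final topology with respect to \<open>p\<close> and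
    \<open>q\<close>.\<close>
  define T where "T = topology (\<lambda>U. U \<subseteq> S \<and> openin X {x \<in> topspace X. p x \<in> U} \<and>
      openin B {x \<in> topspace B. q x \<in> U})"
  have "istopology (\<lambda>U. U \<subseteq> S \<and> openin X {x \<in> topspace X. p x \<in> U} \<and>
      openin B {x \<in> topspace B. q x \<in> U})"
    unfolding istopology_def
  proof (intro conjI allI impI)
    fix U V
    assume U: "U \<subseteq> S \<and> openin X {x \<in> topspace X. p x \<in> U} \<and> openin B {x \<in> topspace B. q x \<in> U}"
      and V: "V \<subseteq> S \<and> openin X {x \<in> topspace X. p x \<in> V} \<and> openin B {x \<in> topspace B. q x \<in> V}"
    have "{x \<in> topspace X. p x \<in> U \<inter> V} = {x \<in> topspace X. p x \<in> U} \<inter> {x \<in> topspace X. p x \<in> V}"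
      "{x \<in> topspace B. q x \<in> U \<inter> V} = {x \<in> topspace B. q x \<in> U} \<inter> {x \<in> topspace B. q x \<in> V}"
      by auto
    then show "U \<inter> V \<subseteq> S" "openin X {x \<in> topspace X. p x \<in> U \<inter> V}"
      "openin B {x \<in> topspace B. q x \<in> U \<inter> V}"
      using U V by auto
  next
    fix \<U>
    assume \<U>: "\<forall>U\<in>\<U>. U \<subseteq> S \<and> openin X {x \<in> topspace X. p x \<in> U} \<and>
      openin B {x \<in> topspace B. q x \<in> U}"
    have "{x \<in> topspace X. p x \<in> \<Union>\<U>} = (\<Union>U\<in>\<U>. {x \<in> topspace X. p x \<in> U})"
      "{x \<in> topspace B. q x \<in> \<Union>\<U>} = (\<Union>U\<in>\<U>. {x \<in> topspace B. q x \<in> U})"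
      by auto
    then show "\<Union>\<U> \<subseteq> S" "openin X {x \<in> topspace X. p x \<in> \<Union>\<U>}"
      "openin B {x \<in> topspace B. q x \<in> \<Union>\<U>}"
      using \<U> by (auto intro!: openin_Union)
  qed
  then have opT: "openin T U \<longleftrightarrow> U \<subseteq> S \<and> openin X {x \<in> topspace X. p x \<in> U} \<and>
      openin B {x \<in> topspace B. q x \<in> U}" for U
    unfolding T_def by (simp add: topology_inverse')
  have "{x \<in> topspace X. p x \<in> S} = topspace X" "{x \<in> topspace B. q x \<in> S} = topspace B"
    by (auto simp: S_def)
  then have "openin T S"
    by (simp add: opT)
  then have topT: "topspace T = S"
    by (metis opT openin_subset openin_topspace subset_antisym)
  have contp: "continuous_map X T p" and contq: "continuous_map B T q"
    using opT by (simp_all add: continuous_map_def topT S_def Pi_iff)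
  have contT: "continuous_map T euclideanreal g" if "continuous_map X euclideanreal (\<lambda>x. g (p x))"
    "continuous_map B euclideanreal (\<lambda>x. g (q x))" for g
    unfolding continuous_map_def
  proof (intro conjI allI impI)
    fix U :: "real set" assume U: "openin euclideanreal U"
    have eq: "{x \<in> topspace X. p x \<in> {x \<in> topspace T. g x \<in> U}} = {x \<in> topspace X. g (p x) \<in> U}"
       "{x \<in> topspace B. q x \<in> {x \<in> topspace T. g x \<in> U}} = {x \<in> topspace B. g (q x) \<in> U}"
      by (auto simp: topT S_def)
    have "openin X {x \<in> topspace X. g (p x) \<in> U}" "openin B {x \<in> topspace B. g (q x) \<in> U}"
      using that U openin_continuous_map_preimage by blast+
    then show "openin T {x \<in> topspace T. g x \<in> U}"
      unfolding opT eq using topT by auto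
  qed auto
  have "compactin T S"
  proof -
    have "compactin T (p ` topspace X)" "compactin T (q ` topspace B)"
      using X B contp contq by (meson compact_space_def image_compactin)+
    then show ?thesis unfolding S_def by (rule compactin_Un)
  qed
  then have "compact_space T"
    by (simp add: compact_space_def topT)
  have nX: "normal_space X"
    using X compact_Hausdorff_or_regular_imp_normal_space by blast
  have nB: "normal_space B"
    using B compact_Hausdorff_or_regular_imp_normal_space by blast
  have fim: "f a \<in> topspace X" if "a \<in> A" for a
    using f A that closedin_subset by (fastforce simp: continuous_map_def)
  have inv: "the_inv_into (topspace X) p (p x) = x" if "x \<in> topspace X" for x
    using p that the_inv_into_f_f by metis
  have inv': "the_inv_into (topspace B - A) q (q x) = x" if "x \<in> topspace B - A" for x
    using q that the_inv_into_f_f by metis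
  \<comment> \<open>Real functions on \<open>X\<close> and \<open>B\<close> that match over
    \<open>A\<close> glue; all separating functions below are obtained in this way.\<close>
  have ext: "\<exists>g. continuous_map T euclideanreal g \<and> (\<forall>x\<in>topspace X. g (p x) = gX x) \<and> (\<forall>x\<in>topspace B. g (q x) = gB x)"
    if "continuous_map X euclideanreal gX" "continuous_map B euclideanreal gB"
      "\<And>a. a \<in> A \<Longrightarrow> gB a = gX (f a)" for gX gB
  proof -
    define g where "g u = (if u \<in> p ` topspace X then gX (the_inv_into (topspace X) p u)
       else gB (the_inv_into (topspace B - A) q u))" for u
    have gp: "g (p x) = gX x" if "x \<in> topspace X" for x
      using that by (simp add: g_def inv)
    moreover have gq: "g (q x) = gB x" if "x \<in> topspace B" for x
    proof (cases "x \<in> A")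
      case True
      then show ?thesis using gp fim \<open>\<And>a. a \<in> A \<Longrightarrow> gB a = gX (f a)\<close> qf by simp
    next
      case False
      then have "q x \<notin> p ` topspace X" using disj that by blast
      then show ?thesis using False that by (simp add: g_def inv')
    qed
    moreover have "continuous_map T euclideanreal g"
      using that(1,2) gp gq
      by (intro contT) (auto elim: continuous_map_eq)
    ultimately show ?thesis by blast
  qed
  have pt: "closedin X {x}" if "x \<in> topspace X" for x
    using X that closedin_Hausdorff_singleton by metis
  have ptB: "closedin B {x}" if "x \<in> topspace B" for x
    using B that closedin_Hausdorff_singleton by metis
  have sepq: "\<exists>g. continuous_map T euclideanreal g \<and> g u \<noteq> g v"
    if b: "b \<in> topspace B - A" "u = q b" "u \<noteq> v" "v \<in> topspace T" for u v b
  proof -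
    define C where "C = A \<union> {b' \<in> topspace B. q b' = v}"
    \<comment> \<open>\<open>q\<close> is injective off \<open>A\<close>, so the fibre over
      \<open>v\<close> contributes at most one point besides \<open>A\<close>, and \<open>C\<close>
      is closed.\<close>
    have "\<exists>D. closedin B D \<and> A \<union> {b' \<in> topspace B. q b' = v} = A \<union> D \<and> b \<notin> D"
    proof (cases "\<exists>b' \<in> topspace B - A. q b' = v")
      case True
      then obtain b' where b': "b' \<in> topspace B - A" "q b' = v" by blast
      have "A \<union> {b' \<in> topspace B. q b' = v} = A \<union> {b'}"
        using b' q by (auto simp: inj_on_def)
      then show ?thesis using b b' ptB by (intro exI[of _ "{b'}"]) auto
    next
      case False
      then show ?thesis by (intro exI[of _ "{}"]) auto
    qed
    then obtain D where "closedin B D" "C = A \<union> D" "b \<notin> D"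
      unfolding C_def by blast
    then have C: "closedin B C" "b \<notin> C"
      using A b by auto
    then obtain gB where gB: "continuous_map B euclideanreal gB" "gB ` {b} \<subseteq> {1}" "gB ` C \<subseteq> {0::real}"
      using nB[unfolded normal_space_iff_Urysohn_alt, rule_format, of C "{b}"] ptB[of b] b
      by (auto simp: disjnt_def)
    obtain g where g: "continuous_map T euclideanreal g" "\<forall>x\<in>topspace X. g (p x) = 0" "\<forall>x\<in>topspace B. g (q x) = gB x"
      using ext[of "\<lambda>x. 0" gB] gB by (auto simp: C_def image_subset_iff)
    have "g u = 1" using g b gB by auto
    moreover have "g v = 0"
      using g b gB \<open>v \<in> topspace T\<close> by (auto simp: topT S_def C_def)
    ultimately show ?thesis using g by auto
  qed
  have "Hausdorff_space T"
  proof (rule Hausdorff_space_if_real_functions_separate)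
    fix u v assume uv: "u \<in> topspace T" "v \<in> topspace T" "u \<noteq> v"
    have *: "w \<in> p ` topspace X \<or> (\<exists>b \<in> topspace B - A. w = q b)" if "w \<in> topspace T" for w
      using that qf fim unfolding topT S_def by auto
    show "\<exists>g. continuous_map T euclideanreal g \<and> g u \<noteq> g v"
    proof (cases "u \<in> p ` topspace X \<and> v \<in> p ` topspace X")
      case True
      then obtain x y where xy: "x \<in> topspace X" "y \<in> topspace X" "u = p x" "v = p y" "x \<noteq> y"
        using uv by auto
      obtain gX where gX: "continuous_map X euclideanreal gX" "gX ` {x} \<subseteq> {0}" "gX ` {y} \<subseteq> {1::real}"
        using nX[unfolded normal_space_iff_Urysohn_alt, rule_format, of "{x}" "{y}"] pt xy by auto
      \<comment> \<open>A function that separates the two points on \<open>X\<close> is pulled back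
        to \<open>A\<close> and then extended over \<open>B\<close> by Tietze.\<close>
      have "continuous_map (subtopology B A) euclideanreal (gX \<circ> f)"
        using f gX continuous_map_compose by blast
      then obtain gB where gB: "continuous_map B euclideanreal gB" "\<And>a. a \<in> A \<Longrightarrow> gB a = gX (f a)"
        by (rule Tietze_extension_realinterval[OF nB A is_interval_univ UNIV_not_empty]) auto
      then obtain g where "continuous_map T euclideanreal g" "\<forall>x\<in>topspace X. g (p x) = gX x"
        using ext[OF gX(1) gB] by blast
      then show ?thesis using gX xy by (intro exI[of _ g]) auto
    next
      case False
      then consider b where "b \<in> topspace B - A" "u = q b" | b where "b \<in> topspace B - A" "v = q b"
        using *[OF uv(1)] *[OF uv(2)] by blast
      then show ?thesis
      proof cases
        case 1
        then show ?thesis using sepq[OF 1 uv(3,2)] by blast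
      next
        case 2
        then show ?thesis using sepq[OF 2 uv(3)[symmetric] uv(1)] by metis
      qed
    qed
  qed
  then show thesis
    using that[of T] \<open>compact_space T\<close> contp contq topT by (simp add: S_def)
qed

section \<open>Disks and characteristic maps\<close>

text \<open>\<open>Euclidean_space m\<close> is a subspace of the product topology on
  \<open>nat \<Rightarrow> real\<close>, so continuity on disks can be argued coordinatewise with
  \<open>continuous_on\<close>.\<close>

lemma disk_eq: "disk m = top_of_set (disk_set m)"
proof -
  have "disk_set m \<subseteq> {x. \<forall>i\<ge>m. x i = 0}"
    by (auto simp: disk_set_def topspace_Euclidean_space)
  then show ?thesis
    unfolding disk_def Euclidean_space_def
    by (simp add: subtopology_subtopology euclidean_product_topology Int_absorb1)
qed

lemma topspace_disk [simp]: "topspace (disk m) = disk_set m"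
  by (simp add: disk_eq)

lemma disk_set_alt: "disk_set m = {x. (\<forall>i\<ge>m. x i = 0) \<and> (\<Sum>i<m. (x i)\<^sup>2) \<le> 1}"
  by (auto simp: disk_set_def topspace_Euclidean_space)

lemma disk_interior_alt: "disk_interior m = {x. (\<forall>i\<ge>m. x i = 0) \<and> (\<Sum>i<m. (x i)\<^sup>2) < 1}"
  by (auto simp: disk_interior_def topspace_Euclidean_space)

lemma disk_boundary_alt: "disk_boundary m = {x. (\<forall>i\<ge>m. x i = 0) \<and> (\<Sum>i<m. (x i)\<^sup>2) = 1}"
  by (auto simp: disk_boundary_def topspace_Euclidean_space)

lemma disk_set_split: "disk_set m = disk_interior m \<union> disk_boundary m"
  and disk_interior_boundary_disjoint: "disk_interior m \<inter> disk_boundary m = {}"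
  by (auto simp: disk_set_alt disk_interior_alt disk_boundary_alt)

lemma continuous_on_coord [continuous_intros]: "continuous_on S (\<lambda>x::nat \<Rightarrow> real. x i)"
  by (rule continuous_on_subset[OF continuous_on_product_coordinates]) simp

text \<open>Tychonoff: the disk is a closed subset of the cube of all sequences with values in
  \<open>[-1, 1]\<close>.\<close>

lemma compact_disk_set: "compact (disk_set m)"
proof -
  have "closed {x::nat\<Rightarrow>real. x i = 0}" for i
    by (intro closed_Collect_eq continuous_intros)
  moreover have "closed {x::nat\<Rightarrow>real. (\<Sum>i<m. (x i)\<^sup>2) \<le> 1}"
    by (intro closed_Collect_le continuous_intros)
  moreover have "disk_set m = (\<Inter>i\<in>{m..}. {x. x i = 0}) \<inter> {x. (\<Sum>i<m. (x i)\<^sup>2) \<le> 1}"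
    by (auto simp: disk_set_alt)
  ultimately have "closed (disk_set m)"
    by auto
  moreover have "disk_set m \<subseteq> (UNIV \<rightarrow>\<^sub>E {-1..1})"
  proof
    fix x assume x: "x \<in> disk_set m"
    have "\<bar>x i\<bar> \<le> 1" for i
    proof (cases "i < m")
      case True
      then have "(x i)\<^sup>2 \<le> (\<Sum>i<m. (x i)\<^sup>2)" by (intro member_le_sum) auto
      then have "(x i)\<^sup>2 \<le> 1" using x by (auto simp: disk_set_alt)
      then show ?thesis by (simp add: abs_square_le_1)
    qed (use x in \<open>auto simp: disk_set_alt\<close>)
    then show "x \<in> (UNIV \<rightarrow>\<^sub>E {-1..1})" by (auto simp: abs_le_iff minus_le_iff)
  qed
  moreover have "compact (UNIV \<rightarrow>\<^sub>E {-1..1::real} :: (nat \<Rightarrow> real) set)"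
    using compactin_PiE[of "\<lambda>_. euclideanreal" UNIV "\<lambda>_. {-1..1}"]
    by (simp add: euclidean_product_topology)
  ultimately show ?thesis
    by (metis compact_Int_closed inf.absorb_iff2)
qed

lemma compact_space_disk [simp]: "compact_space (disk m)"
  by (simp add: disk_eq compact_space_subtopology compact_disk_set)

lemma Hausdorff_space_disk [simp]: "Hausdorff_space (disk m)"
  by (simp add: disk_eq Hausdorff_space_subtopology)

lemma closedin_disk_boundary: "closedin (disk m) (disk_boundary m)"
proof -
  have "disk_boundary m = disk_set m \<inter> {x. (\<Sum>i<m. (x i)\<^sup>2) = 1}"
    by (auto simp: disk_set_alt disk_boundary_alt)
  moreover have "closed {x::nat\<Rightarrow>real. (\<Sum>i<m. (x i)\<^sup>2) = 1}"
    by (intro closed_Collect_eq continuous_intros)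
  ultimately show ?thesis
    by (simp add: disk_eq closedin_closed_Int)
qed

lemma zero_in_disk_interior [simp]: "(\<lambda>i. 0) \<in> disk_interior m"
  by (simp add: disk_interior_alt)

text \<open>A map from the compact disk to a Hausdorff space is closed, and so is its restriction to
  the full preimage of \<open>e\<close>. As the boundary sphere misses \<open>e\<close>, this
  preimage is the open disk, on which a closed continuous bijection is a homeomorphism.\<close>

lemma characteristic_mapI:
  assumes "Hausdorff_space (cw_space K)" and cont: "continuous_map (disk m) (cw_space K) \<phi>"
    and inj: "inj_on \<phi> (disk_interior m)" and im: "\<phi> ` disk_interior m = e"
    and bd: "\<phi> ` disk_boundary m \<subseteq> (\<Union>k<m. \<Union>(cw_cells K k))" and disj: "\<phi> ` disk_boundary m \<inter> e = {}"
  shows "characteristic_map K m e \<phi>"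
proof -
  have cl: "closed_map (disk m) (cw_space K) \<phi>"
    using assms compact_space_disk T1_Spaces.continuous_imp_closed_map by blast
  have e: "e \<subseteq> topspace (cw_space K)"
    using cont im by (auto simp: continuous_map_def disk_set_split)
  have "{x \<in> topspace (disk m). \<phi> x \<in> e} = disk_interior m"
    using im disj by (auto simp: disk_set_split)
  then have "closed_map (subtopology (disk m) (disk_interior m)) (subtopology (cw_space K) e) \<phi>"
    using cl closed_map_restriction by blast
  moreover have "continuous_map (subtopology (disk m) (disk_interior m)) (subtopology (cw_space K) e) \<phi>"
    using cont im by (auto simp: continuous_map_in_subtopology continuous_map_from_subtopology)
  ultimately have "homeomorphic_map (subtopology (disk m) (disk_interior m)) (subtopology (cw_space K) e) \<phi>"
    using inj im e by (intro bijective_closed_imp_homeomorphic_map) (auto simp: disk_set_split inj_on_def)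
  then show ?thesis
    using cont bd by (simp add: characteristic_map_def)
qed

lemma characteristic_map_image:
  assumes "characteristic_map K m e \<phi>"
  shows "inj_on \<phi> (disk_interior m)" "\<phi> ` disk_interior m = e \<inter> topspace (cw_space K)"
    "\<phi> ` disk_set m \<subseteq> topspace (cw_space K)"
proof -
  have h: "homeomorphic_map (subtopology (disk m) (disk_interior m)) (subtopology (cw_space K) e) \<phi>"
    using assms by (simp add: characteristic_map_def)
  have eq: "disk_set m \<inter> disk_interior m = disk_interior m" by (auto simp: disk_set_split)
  show "inj_on \<phi> (disk_interior m)"
    using homeomorphic_imp_injective_map[OF h] by (simp add: eq)
  show "\<phi> ` disk_interior m = e \<inter> topspace (cw_space K)"
    using homeomorphic_imp_surjective_map[OF h] by (auto simp: eq)
  show "\<phi> ` disk_set m \<subseteq> topspace (cw_space K)"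
    using assms by (auto simp: characteristic_map_def continuous_map_def)
qed

section \<open>Embeddings of complexes\<close>

lemma image_Union_cells:
  assumes "S \<subseteq> (\<Union>k<m. \<Union>(C k))" "\<And>k e. e \<in> C k \<Longrightarrow> f ` e \<in> D k"
  shows "f ` S \<subseteq> (\<Union>k<m. \<Union>(D k))"
proof
  fix y assume "y \<in> f ` S"
  then obtain k e x where "k < m" "e \<in> C k" "x \<in> e" "y = f x"
    using assms(1) by blast
  then show "y \<in> (\<Union>k<m. \<Union>(D k))"
    using assms(2)[of e k] by blast
qed

section \<open>Cells of a finite complex, and its compactness\<close>

lemma finite_cw_Hausdorff: "finite_cw K \<Longrightarrow> Hausdorff_space (cw_space K)"
  by (simp add: finite_cw_def)

lemma cell_subset_points: "finite_cw K \<Longrightarrow> e \<in> cw_cells K m \<Longrightarrow> e \<subseteq> cw_points K"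
  by (simp add: finite_cw_def)

lemma cell_characteristic_map:
  assumes "finite_cw K" "e \<in> cw_cells K m"
  obtains \<phi> where "characteristic_map K m e \<phi>"
proof -
  have "\<forall>e\<in>cw_cells K m. \<exists>\<phi>. characteristic_map K m e \<phi>"
    using assms(1) by (simp add: finite_cw_def)
  then show thesis using that assms(2) by blast
qed

lemma point_in_cell:
  assumes "finite_cw K" "x \<in> cw_points K"
  obtains m e where "e \<in> cw_cells K m" "x \<in> e"
proof -
  have "(\<Union>m. \<Union>(cw_cells K m)) = cw_points K"
    using assms(1) by (simp add: finite_cw_def)
  then have "x \<in> (\<Union>m. \<Union>(cw_cells K m))" using assms(2) by simp
  then show thesis using that by blast
qed

lemma cell_unique:
  assumes "finite_cw K" "e \<in> cw_cells K m" "e' \<in> cw_cells K m'" "x \<in> e" "x \<in> e'"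
  shows "m = m'" "e = e'"
proof -
  have "\<forall>m e m' e'. e \<in> cw_cells K m \<and> e' \<in> cw_cells K m' \<and> (m, e) \<noteq> (m', e') \<longrightarrow> e \<inter> e' = {}"
    using assms(1) unfolding finite_cw_def by (elim conjE)
  then have "(m, e) = (m', e')"
    using assms(2-5) by blast
  then show "m = m'" "e = e'" by auto
qed

lemma characteristic_map_cell_image:
  assumes "finite_cw K" "e \<in> cw_cells K m" "characteristic_map K m e \<phi>"
  shows "\<phi> ` disk_interior m = e"
  using characteristic_map_image(2)[OF assms(3)] cell_subset_points[OF assms(1,2)]
  by (auto simp: cw_points_def)

lemma cell_nonempty:
  assumes "finite_cw K" "e \<in> cw_cells K m"
  shows "e \<noteq> {}"
proof -
  obtain \<phi> where "characteristic_map K m e \<phi>"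
    using cell_characteristic_map[OF assms] by metis
  then have "\<phi> ` disk_interior m = e"
    using characteristic_map_cell_image[OF assms] by simp
  then show ?thesis using zero_in_disk_interior by blast
qed

lemma characteristic_map_boundary_disjoint:
  assumes K: "finite_cw K" "e \<in> cw_cells K m" and "characteristic_map K m e \<phi>"
  shows "\<phi> ` disk_boundary m \<inter> e = {}"
proof (rule ccontr)
  assume "\<phi> ` disk_boundary m \<inter> e \<noteq> {}"
  then obtain x where x: "x \<in> \<phi> ` disk_boundary m" "x \<in> e" by blast
  then obtain k e' where "k < m" "e' \<in> cw_cells K k" "x \<in> e'"
    using assms unfolding characteristic_map_def by blast
  then show False
    using cell_unique(1)[OF K(1) K(2) _ x(2)] by blast
qed

text \<open>The closed cells are images of compact disks and form a finite cover.\<close>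

lemma finite_cw_compact:
  assumes K: "finite_cw K"
  shows "compact_space (cw_space K)"
proof -
  have "\<exists>\<phi>. \<forall>m e. e \<in> cw_cells K m \<longrightarrow> characteristic_map K m e (\<phi> m e)"
    using K unfolding finite_cw_def by metis
  then obtain \<phi> where \<phi>: "\<And>m e. e \<in> cw_cells K m \<Longrightarrow> characteristic_map K m e (\<phi> m e)"
    by blast
  let ?I = "{(m, e). e \<in> cw_cells K m}"
  have "compactin (cw_space K) (\<Union>((\<lambda>(m, e). \<phi> m e ` disk_set m) ` ?I))"
  proof (rule compactin_Union)
    show "finite ((\<lambda>(m, e). \<phi> m e ` disk_set m) ` ?I)"
      using K by (simp add: finite_cw_def)
    fix S assume "S \<in> (\<lambda>(m, e). \<phi> m e ` disk_set m) ` ?I"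
    then obtain m e where "e \<in> cw_cells K m" "S = \<phi> m e ` disk_set m" by auto
    then show "compactin (cw_space K) S"
      using \<phi> compact_space_disk
      by (metis characteristic_map_def compact_space_def image_compactin topspace_disk)
  qed
  moreover have "\<Union>((\<lambda>(m, e). \<phi> m e ` disk_set m) ` ?I) = topspace (cw_space K)"
  proof
    show "\<Union>((\<lambda>(m, e). \<phi> m e ` disk_set m) ` ?I) \<subseteq> topspace (cw_space K)"
      using \<phi> characteristic_map_image(3) by fast
    show "topspace (cw_space K) \<subseteq> \<Union>((\<lambda>(m, e). \<phi> m e ` disk_set m) ` ?I)"
    proof
      fix x assume "x \<in> topspace (cw_space K)"
      then obtain m e where e: "e \<in> cw_cells K m" "x \<in> e"
        using point_in_cell[OF K, of x] unfolding cw_points_def by metis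
      then have "x \<in> \<phi> m e ` disk_set m"
        using characteristic_map_cell_image[OF K e(1) \<phi>[OF e(1)]] by (auto simp: disk_set_split)
      moreover have "(m, e) \<in> ?I" using e by simp
      ultimately show "x \<in> \<Union>((\<lambda>(m, e). \<phi> m e ` disk_set m) ` ?I)"
        by blast
    qed
  qed
  ultimately show ?thesis by (simp add: compact_space_def)
qed

section \<open>Subcomplexes spanned by sets of cells\<close>

definition restrict_cells :: "'a cw \<Rightarrow> (nat \<Rightarrow> 'a set set) \<Rightarrow> 'a cw" where
  "restrict_cells K D = \<lparr>cw_space = subtopology (cw_space K) (\<Union>m. \<Union>(D m)), cw_cells = D\<rparr>"

lemma points_restrict_cells:
  assumes "finite_cw K" "\<And>m. D m \<subseteq> cw_cells K m"
  shows "cw_points (restrict_cells K D) = (\<Union>m. \<Union>(D m))"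
proof -
  have "(\<Union>m. \<Union>(D m)) \<subseteq> topspace (cw_space K)"
    using assms cell_subset_points unfolding cw_points_def by blast
  then show ?thesis
    by (auto simp: cw_points_def restrict_cells_def)
qed

text \<open>Because the boundaries stay inside the family, the given characteristic maps land in the
  spanned subspace and are characteristic there as well; one such map per cell suffices.\<close>

lemma subcomplex_restrict_cells:
  assumes K: "finite_cw K" and D: "\<And>m. D m \<subseteq> cw_cells K m"
    and bd: "\<And>m e. e \<in> D m \<Longrightarrow> \<exists>\<phi>. characteristic_map K m e \<phi> \<and> \<phi> ` disk_boundary m \<subseteq> (\<Union>k<m. \<Union>(D k))"
  shows "subcomplex (restrict_cells K D) K"
proof -
  let ?R = "restrict_cells K D"
  have pts: "cw_points ?R = (\<Union>m. \<Union>(D m))"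
    using points_restrict_cells[OF K D] .
  have cells: "cw_cells ?R = D"
    by (simp add: restrict_cells_def)
  have sp: "cw_space ?R = subtopology (cw_space K) (cw_points ?R)"
    unfolding pts by (simp add: restrict_cells_def)
  have Haus: "Hausdorff_space (cw_space ?R)"
    unfolding sp using K finite_cw_Hausdorff Hausdorff_space_subtopology by blast
  have "finite_cw ?R"
    unfolding finite_cw_def
  proof (intro conjI allI ballI impI)
    show "finite {(m, e). e \<in> cw_cells ?R m}"
    proof (rule finite_subset)
      show "{(m, e). e \<in> cw_cells ?R m} \<subseteq> {(m, e). e \<in> cw_cells K m}"
        using D by (auto simp: cells)
    qed (use K in \<open>simp add: finite_cw_def\<close>)
    show "(\<Union>m. \<Union>(cw_cells ?R m)) = cw_points ?R"
      by (simp add: pts cells)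
    show "e \<inter> e' = {}" if "e \<in> cw_cells ?R m \<and> e' \<in> cw_cells ?R m' \<and> (m, e) \<noteq> (m', e')" for m e m' e'
    proof -
      have "e \<in> cw_cells K m" "e' \<in> cw_cells K m'" "(m, e) \<noteq> (m', e')"
        using that D by (auto simp: cells)
      then show ?thesis using cell_unique[OF K] by blast
    qed
    fix m e assume e: "e \<in> cw_cells ?R m"
    then show "e \<subseteq> cw_points ?R" by (auto simp: pts cells)
    obtain \<phi> where \<phi>: "characteristic_map K m e \<phi>" "\<phi> ` disk_boundary m \<subseteq> (\<Union>k<m. \<Union>(D k))"
      using bd[of e m] e unfolding cells by blast
    have eK: "e \<in> cw_cells K m" using e D by (auto simp: cells)
    have im: "\<phi> ` disk_interior m = e"
      using characteristic_map_cell_image[OF K eK \<phi>(1)] .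
    have "\<phi> ` disk_boundary m \<subseteq> cw_points ?R"
      using \<phi>(2) unfolding pts by blast
    then have "\<phi> ` disk_set m \<subseteq> cw_points ?R"
      using im \<open>e \<subseteq> cw_points ?R\<close> by (auto simp: disk_set_split)
    then have "characteristic_map ?R m e \<phi>"
      using \<phi> im characteristic_map_boundary_disjoint[OF K eK \<phi>(1)] characteristic_map_image(1)[OF \<phi>(1)]
      by (intro characteristic_mapI Haus)
         (auto simp: sp cells continuous_map_in_subtopology characteristic_map_def)
    then show "\<exists>\<phi>. characteristic_map ?R m e \<phi>" by blast
  qed (rule Haus)
  moreover have "cw_points ?R \<subseteq> cw_points K"
    using D cell_subset_points[OF K] by (fastforce simp: pts)
  ultimately show ?thesis
    using K D sp by (simp add: subcomplex_def cells)
qed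

text \<open>For finite complexes this is equivalent to \<^const>\<open>cw_embedding\<close>: a continuous injection of a
  compact space into a Hausdorff space is a homeomorphism onto its image.\<close>

definition emb :: "'a cw \<Rightarrow> 'a cw \<Rightarrow> ('a \<Rightarrow> 'a) \<Rightarrow> bool" where
  "emb A K f \<longleftrightarrow> finite_cw A \<and> finite_cw K \<and> continuous_map (cw_space A) (cw_space K) f \<and>
     inj_on f (cw_points A) \<and> (\<forall>m. \<forall>e\<in>cw_cells A m. f ` e \<in> cw_cells K m)"

lemma embD:
  assumes "emb A K f"
  shows "finite_cw A" "finite_cw K" "continuous_map (cw_space A) (cw_space K) f"
    "inj_on f (cw_points A)" "\<And>m e. e \<in> cw_cells A m \<Longrightarrow> f ` e \<in> cw_cells K m"
    "\<And>x. x \<in> cw_points A \<Longrightarrow> f x \<in> cw_points K"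
proof -
  show cont: "continuous_map (cw_space A) (cw_space K) f" using assms by (simp add: emb_def)
  show "finite_cw A" "finite_cw K" "inj_on f (cw_points A)" "\<And>m e. e \<in> cw_cells A m \<Longrightarrow> f ` e \<in> cw_cells K m"
    using assms by (simp_all add: emb_def)
  show "f x \<in> cw_points K" if "x \<in> cw_points A" for x
    using cont that continuous_map_image_subset_topspace unfolding cw_points_def by blast
qed

lemma emb_characteristic_map:
  assumes f: "emb A K f" and e: "e \<in> cw_cells A m" and \<phi>: "characteristic_map A m e \<phi>"
  shows "characteristic_map K m (f ` e) (f \<circ> \<phi>)"
proof (rule characteristic_mapI)
  note f' = embD[OF f]
  show "Hausdorff_space (cw_space K)" using f' finite_cw_Hausdorff by blast
  show "continuous_map (disk m) (cw_space K) (f \<circ> \<phi>)"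
    using \<phi> f'(3) continuous_map_compose unfolding characteristic_map_def by blast
  have im: "\<phi> ` disk_interior m = e"
    using characteristic_map_cell_image[OF f'(1) e \<phi>] .
  have sub: "e \<subseteq> cw_points A" using cell_subset_points f'(1) e by blast
  then have "inj_on f (\<phi> ` disk_interior m)"
    using f'(4) im by (auto simp: inj_on_def)
  then show "inj_on (f \<circ> \<phi>) (disk_interior m)"
    using characteristic_map_image(1)[OF \<phi>] comp_inj_on by blast
  show "(f \<circ> \<phi>) ` disk_interior m = f ` e"
    using im by (auto simp: image_comp[symmetric])
  have bd: "\<phi> ` disk_boundary m \<subseteq> (\<Union>k<m. \<Union>(cw_cells A k))"
    using \<phi> by (simp add: characteristic_map_def)
  then show "(f \<circ> \<phi>) ` disk_boundary m \<subseteq> (\<Union>k<m. \<Union>(cw_cells K k))"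
    unfolding image_comp[symmetric] using f'(5) by (intro image_Union_cells[where C="cw_cells A"])
  have "\<phi> ` disk_boundary m \<inter> e = {}"
    using characteristic_map_boundary_disjoint[OF f'(1) e \<phi>] .
  moreover have "\<phi> ` disk_boundary m \<subseteq> cw_points A"
    using characteristic_map_image(3)[OF \<phi>] by (auto simp: disk_set_split cw_points_def)
  ultimately show "(f \<circ> \<phi>) ` disk_boundary m \<inter> f ` e = {}"
    using f'(4) sub unfolding inj_on_def image_comp[symmetric] by blast
qed

lemma emb_homeomorphic_image:
  assumes f: "emb A K f"
  shows "homeomorphic_map (cw_space A) (subtopology (cw_space K) (f ` cw_points A)) f"
proof -
  note f' = embD[OF f]
  have "closed_map (cw_space A) (cw_space K) f"
    using f' finite_cw_compact finite_cw_Hausdorff T1_Spaces.continuous_imp_closed_map by blast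
  then have "embedding_map (cw_space A) (cw_space K) f"
    using f'(3,4) injective_closed_imp_embedding_map unfolding cw_points_def by blast
  then show ?thesis by (simp add: embedding_map_def cw_points_def)
qed

lemma emb_image_subcomplex:
  assumes f: "emb A K f"
  shows "subcomplex (restrict_cells K (\<lambda>m. (\<lambda>e. f ` e) ` cw_cells A m)) K"
    "cw_points (restrict_cells K (\<lambda>m. (\<lambda>e. f ` e) ` cw_cells A m)) = f ` cw_points A"
proof -
  note f' = embD[OF f]
  have D: "(\<lambda>e. f ` e) ` cw_cells A m \<subseteq> cw_cells K m" for m
    using f'(5) by blast
  show "subcomplex (restrict_cells K (\<lambda>m. (\<lambda>e. f ` e) ` cw_cells A m)) K"
  proof (rule subcomplex_restrict_cells[OF f'(2) D])
    fix m e assume "e \<in> (\<lambda>e. f ` e) ` cw_cells A m"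
    then obtain e0 where e0: "e0 \<in> cw_cells A m" "e = f ` e0" by blast
    then obtain \<phi> where \<phi>: "characteristic_map A m e0 \<phi>"
      using cell_characteristic_map[OF f'(1) e0(1)] by metis
    have "(f \<circ> \<phi>) ` disk_boundary m \<subseteq> (\<Union>k<m. \<Union>((\<lambda>e. f ` e) ` cw_cells A k))"
      using \<phi> unfolding characteristic_map_def image_comp[symmetric]
      by (intro image_Union_cells[where C="cw_cells A"]) auto
    then show "\<exists>\<phi>. characteristic_map K m e \<phi> \<and> \<phi> ` disk_boundary m \<subseteq> (\<Union>k<m. \<Union>((\<lambda>e. f ` e) ` cw_cells A k))"
      using emb_characteristic_map[OF f e0(1) \<phi>] e0(2) by blast
  qed
  have "(\<Union>m. \<Union>(cw_cells A m)) = cw_points A"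
    using f'(1) by (simp add: finite_cw_def)
  then show "cw_points (restrict_cells K (\<lambda>m. (\<lambda>e. f ` e) ` cw_cells A m)) = f ` cw_points A"
    unfolding points_restrict_cells[OF f'(2) D] by blast
qed

lemma cw_embedding_iff_emb:
  assumes "finite_cw A"
  shows "cw_embedding A K f \<longleftrightarrow> emb A K f"
proof
  assume "cw_embedding A K f"
  then obtain B where B: "subcomplex B K" "cw_isomorphism A B f"
    unfolding cw_embedding_def by blast
  have hom: "homeomorphic_map (cw_space A) (subtopology (cw_space K) (cw_points B)) f"
    using B by (metis cw_isomorphism_def subcomplex_def)
  then have "continuous_map (cw_space A) (cw_space K) f"
    using continuous_map_in_subtopology homeomorphic_imp_continuous_map by blast
  moreover have "inj_on f (cw_points A)"
    using hom homeomorphic_imp_injective_map unfolding cw_points_def by blast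
  moreover have "f ` e \<in> cw_cells K m" if "e \<in> cw_cells A m" for m e
  proof -
    have "f ` e \<in> cw_cells B m" using B(2) that by (simp add: cw_isomorphism_def)
    then show ?thesis using B(1) unfolding subcomplex_def by blast
  qed
  ultimately show "emb A K f"
    using assms B by (auto simp: emb_def subcomplex_def)
next
  assume f: "emb A K f"
  let ?B = "restrict_cells K (\<lambda>m. (\<lambda>e. f ` e) ` cw_cells A m)"
  have "subcomplex ?B K" using emb_image_subcomplex(1)[OF f] .
  moreover have "cw_isomorphism A ?B f"
    using emb_homeomorphic_image[OF f] emb_image_subcomplex(2)[OF f] calculation
    unfolding cw_isomorphism_def subcomplex_def by (simp add: restrict_cells_def)
  ultimately show "cw_embedding A K f" unfolding cw_embedding_def by blast
qed

text \<open>Reduces facts about subcomplexes to facts about embeddings. In the reverse direction the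
  identity is a homeomorphism between the two topologies on \<open>cw_points A\<close>, which are
  therefore equal.\<close>

lemma subcomplex_iff_emb: "subcomplex A K \<longleftrightarrow> emb A K (\<lambda>x. x)"
proof
  assume A: "subcomplex A K"
  then have eq: "cw_space A = subtopology (cw_space K) (cw_points A)"
    unfolding subcomplex_def by blast
  have "continuous_map (subtopology (cw_space K) (cw_points A)) (cw_space K) (\<lambda>x. x)"
    by (simp add: continuous_map_from_subtopology)
  then have "continuous_map (cw_space A) (cw_space K) (\<lambda>x. x)"
    by (subst eq)
  moreover have "finite_cw A" "finite_cw K" "\<And>m. cw_cells A m \<subseteq> cw_cells K m"
    using A unfolding subcomplex_def by blast+
  ultimately show "emb A K (\<lambda>x. x)"
    unfolding emb_def by auto
next
  assume f: "emb A K (\<lambda>x. x)"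
  have "homeomorphic_map (cw_space A) (subtopology (cw_space K) (cw_points A)) id"
    using emb_homeomorphic_image[OF f] by (simp add: id_def)
  then have "cw_space A = subtopology (cw_space K) (cw_points A)"
    unfolding homeomorphic_map_id by (rule sym)
  moreover have "cw_cells A m \<subseteq> cw_cells K m" for m
    using embD(5)[OF f] by auto
  moreover have "cw_points A \<subseteq> cw_points K"
    using embD(6)[OF f] by auto
  ultimately show "subcomplex A K"
    using embD(1,2)[OF f] unfolding subcomplex_def by blast
qed

lemma emb_id:
  assumes "finite_cw K"
  shows "emb K K (\<lambda>x. x)"
proof -
  have "continuous_map (cw_space K) (cw_space K) (\<lambda>x. x)" by simp
  moreover have "inj_on (\<lambda>x. x) (cw_points K)" by (simp add: inj_on_def)
  moreover have "\<forall>m. \<forall>e\<in>cw_cells K m. (\<lambda>x. x) ` e \<in> cw_cells K m" by simp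
  ultimately show ?thesis unfolding emb_def using assms by blast
qed

lemma emb_compose:
  assumes f: "emb A B f" and g: "emb B C g"
  shows "emb A C (\<lambda>x. g (f x))"
proof -
  have "continuous_map (cw_space A) (cw_space C) (\<lambda>x. g (f x))"
    using continuous_map_compose[OF embD(3)[OF f] embD(3)[OF g]] by (simp add: o_def)
  moreover have "inj_on (\<lambda>x. g (f x)) (cw_points A)"
    using inj_onD[OF embD(4)[OF f]] inj_onD[OF embD(4)[OF g]] embD(6)[OF f] by (intro inj_onI) metis
  moreover have "(\<lambda>x. g (f x)) ` e \<in> cw_cells C m" if "e \<in> cw_cells A m" for m e
    using embD(5)[OF g embD(5)[OF f that]] by (simp add: image_image)
  ultimately show ?thesis
    using embD(1)[OF f] embD(2)[OF g] by (simp add: emb_def)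
qed

lemma emb_cong:
  assumes "emb A K f" "\<And>x. x \<in> cw_points A \<Longrightarrow> g x = f x"
  shows "emb A K g"
proof -
  have "continuous_map (cw_space A) (cw_space K) g"
    using continuous_map_eq[OF embD(3)[OF assms(1)], of g] assms(2) unfolding cw_points_def by simp
  moreover have "g ` e = f ` e" if "e \<in> cw_cells A m" for e m
    using cell_subset_points[OF embD(1)[OF assms(1)] that] assms(2) by (intro image_cong refl) blast
  moreover have "inj_on g (cw_points A)"
    using embD(4)[OF assms(1)] assms(2) by (simp cong: inj_on_cong)
  ultimately show ?thesis
    using assms(1) by (simp add: emb_def)
qed

lemma emb_into_subcomplex:
  assumes B: "subcomplex B K" and f: "emb A K f" and "\<And>m e. e \<in> cw_cells A m \<Longrightarrow> f ` e \<in> cw_cells B m"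
  shows "emb A B f"
proof -
  have fB: "finite_cw B" using B by (simp add: subcomplex_def)
  have "f x \<in> cw_points B" if x: "x \<in> cw_points A" for x
  proof -
    obtain m e where "e \<in> cw_cells A m" "x \<in> e"
      using point_in_cell[OF embD(1)[OF f] x] by metis
    then show ?thesis using cell_subset_points[OF fB assms(3)] by blast
  qed
  then have "continuous_map (cw_space A) (subtopology (cw_space K) (cw_points B)) f"
    using embD(3)[OF f] by (auto simp: continuous_map_in_subtopology cw_points_def)
  then show ?thesis
    using B f assms(3) unfolding emb_def subcomplex_def by metis
qed

text \<open>Cells are disjoint or equal: the image of the cell of \<open>K\<close> around
  \<open>x\<close> is a cell of \<open>M\<close> that shares a point with \<open>e\<close>.\<close>

lemma emb_cell_cover:
  assumes f: "emb K M f" and e: "e \<in> cw_cells M m" and x: "x \<in> cw_points K" "f x \<in> e"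
  obtains e0 where "e0 \<in> cw_cells K m" "e = f ` e0" "x \<in> e0"
proof -
  obtain k e0 where e0: "e0 \<in> cw_cells K k" "x \<in> e0"
    using point_in_cell[OF embD(1)[OF f] x(1)] by metis
  have "f ` e0 \<in> cw_cells M k" "f x \<in> f ` e0"
    using embD(5)[OF f] e0 by auto
  then have "m = k" "e = f ` e0"
    using cell_unique[OF embD(2)[OF f] e _ x(2)] by blast+
  then show thesis using that e0 by blast
qed

text \<open>Every cell of \<open>M\<close> contains an image point, so \<open>emb_cell_cover\<close>
  exhibits it as the image of a cell of the same dimension.\<close>

lemma emb_onto_isomorphism:
  assumes f: "emb K M f" and onto: "f ` cw_points K = cw_points M"
  shows "cw_isomorphism K M f"
proof -
  have "homeomorphic_map (cw_space K) (cw_space M) f"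
    using emb_homeomorphic_image[OF f] unfolding onto by (simp add: cw_points_def)
  moreover have "cw_cells M m = (\<lambda>e. f ` e) ` cw_cells K m" for m
  proof
    show "(\<lambda>e. f ` e) ` cw_cells K m \<subseteq> cw_cells M m" using embD(5)[OF f] by blast
    show "cw_cells M m \<subseteq> (\<lambda>e. f ` e) ` cw_cells K m"
    proof
      fix e assume e: "e \<in> cw_cells M m"
      then obtain y where y: "y \<in> e" using cell_nonempty embD(2)[OF f] by blast
      then have "y \<in> f ` cw_points K"
        using cell_subset_points[OF embD(2)[OF f] e] onto by blast
      then obtain x where "x \<in> cw_points K" "y = f x" by blast
      then obtain e0 where "e0 \<in> cw_cells K m" "e = f ` e0"
        using emb_cell_cover[OF f e] y by metis
      then show "e \<in> (\<lambda>e. f ` e) ` cw_cells K m" by blast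
    qed
  qed
  ultimately show ?thesis by (simp add: cw_isomorphism_def)
qed

lemma isomorphism_emb:
  assumes "finite_cw K" "finite_cw M" "cw_isomorphism K M f"
  shows "emb K M f" "f ` cw_points K = cw_points M"
proof -
  have h: "homeomorphic_map (cw_space K) (cw_space M) f" and c: "\<And>m. cw_cells M m = (\<lambda>e. f ` e) ` cw_cells K m"
    using assms(3) by (simp_all add: cw_isomorphism_def)
  show "emb K M f"
    using assms(1,2) c homeomorphic_imp_continuous_map[OF h] homeomorphic_imp_injective_map[OF h]
    by (simp add: emb_def cw_points_def)
  show "f ` cw_points K = cw_points M"
    using homeomorphic_imp_surjective_map[OF h] by (simp add: cw_points_def)
qed

text \<open>With injectivity given, only continuity and the images of cells are at stake, and both
  are checked on the two compact pieces.\<close>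

lemma emb_from_two_pieces:
  assumes f: "emb K M f" and f': "emb K' M f'" and cover: "cw_points M = f ` cw_points K \<union> f' ` cw_points K'"
    and hf: "emb K N (\<lambda>x. h (f x))" and hf': "emb K' N (\<lambda>x. h (f' x))" and inj: "inj_on h (cw_points M)"
  shows "emb M N h"
proof -
  have cont: "continuous_map (cw_space M) (cw_space N) h"
    using embD[OF f] embD[OF f'] embD[OF hf] embD[OF hf'] cover finite_cw_compact finite_cw_Hausdorff
    by (intro continuous_map_out_of_two_pieces[of "cw_space M" "cw_space K" "cw_space K'" f f'])
       (auto simp: cw_points_def)
  have "h ` e \<in> cw_cells N m" if e: "e \<in> cw_cells M m" for m e
  proof -
    obtain y where y: "y \<in> e" using cell_nonempty embD(2)[OF f] e by blast
    then have "y \<in> f ` cw_points K \<union> f' ` cw_points K'"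
      using cell_subset_points[OF embD(2)[OF f] e] cover by blast
    then consider x where "x \<in> cw_points K" "y = f x" | x where "x \<in> cw_points K'" "y = f' x" by blast
    then show ?thesis
    proof cases
      case 1
      then obtain e0 where "e0 \<in> cw_cells K m" "e = f ` e0"
        using emb_cell_cover[OF f e] y by metis
      then show ?thesis using embD(5)[OF hf] by (simp add: image_image)
    next
      case 2
      then obtain e0 where "e0 \<in> cw_cells K' m" "e = f' ` e0"
        using emb_cell_cover[OF f' e] y by metis
      then show ?thesis using embD(5)[OF hf'] by (simp add: image_image)
    qed
  qed
  then show ?thesis
    using cont inj embD(2)[OF f] embD(2)[OF hf] by (simp add: emb_def)
qed

section \<open>Gluings\<close>

lemma complexes_over_iff:
  assumes "finite_cw L"
  shows "(K, i) \<in> complexes_over d L \<longleftrightarrow> cw_dim_le K d \<and> emb L K i"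
  using embD(2)[of L K i] by (auto simp: complexes_over_def cw_embedding_iff_emb[OF assms])

text \<open>The relation \<open>is_gluing\<close> with the embeddings of the two factors kept as
  parameters, so that later constructions can refer to them.\<close>

definition glues :: "'a cw \<Rightarrow> 'a cw \<Rightarrow> ('a \<Rightarrow> 'a) \<Rightarrow> 'a cw \<Rightarrow> ('a \<Rightarrow> 'a) \<Rightarrow> 'a cw \<Rightarrow> ('a \<Rightarrow> 'a) \<Rightarrow>
    ('a \<Rightarrow> 'a) \<Rightarrow> ('a \<Rightarrow> 'a) \<Rightarrow> bool" where
  "glues L K i K' i' M j f f' \<longleftrightarrow> emb K M f \<and> emb K' M f' \<and>
     (\<forall>x \<in> cw_points L. f (i x) = j x \<and> f' (i' x) = j x) \<and>
     f ` cw_points K \<union> f' ` cw_points K' = cw_points M \<and>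
     f ` cw_points K \<inter> f' ` cw_points K' = j ` cw_points L"

lemma is_gluing_iff:
  assumes "finite_cw K" "finite_cw K'"
  shows "is_gluing L (K, i) (K', i') (M, j) \<longleftrightarrow> (\<exists>f f'. glues L K i K' i' M j f f')"
  unfolding is_gluing_def glues_def
  by (auto simp: cw_embedding_iff_emb[OF assms(1)] cw_embedding_iff_emb[OF assms(2)] dest: embD(2))

lemma gluesD:
  assumes "glues L K i K' i' M j f f'"
  shows "emb K M f" "emb K' M f'" "\<And>x. x \<in> cw_points L \<Longrightarrow> f (i x) = j x"
    "\<And>x. x \<in> cw_points L \<Longrightarrow> f' (i' x) = j x"
    "cw_points M = f ` cw_points K \<union> f' ` cw_points K'"
    "f ` cw_points K \<inter> f' ` cw_points K' = j ` cw_points L"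
  using assms by (simp_all add: glues_def)

lemma glues_cells:
  assumes g: "glues L K i K' i' M j f f'"
  shows "cw_cells M m = (\<lambda>e. f ` e) ` cw_cells K m \<union> (\<lambda>e. f' ` e) ` cw_cells K' m"
proof
  show "(\<lambda>e. f ` e) ` cw_cells K m \<union> (\<lambda>e. f' ` e) ` cw_cells K' m \<subseteq> cw_cells M m"
    using embD(5)[OF gluesD(1)[OF g]] embD(5)[OF gluesD(2)[OF g]] by blast
  show "cw_cells M m \<subseteq> (\<lambda>e. f ` e) ` cw_cells K m \<union> (\<lambda>e. f' ` e) ` cw_cells K' m"
  proof
    fix e assume e: "e \<in> cw_cells M m"
    have M: "finite_cw M" using embD(2)[OF gluesD(1)[OF g]] .
    obtain y where y: "y \<in> e" using cell_nonempty[OF M e] by blast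
    then have "y \<in> f ` cw_points K \<union> f' ` cw_points K'"
      using cell_subset_points[OF M e] gluesD(5)[OF g] by blast
    then consider x where "x \<in> cw_points K" "f x \<in> e" | x where "x \<in> cw_points K'" "f' x \<in> e"
      using y by blast
    then show "e \<in> (\<lambda>e. f ` e) ` cw_cells K m \<union> (\<lambda>e. f' ` e) ` cw_cells K' m"
    proof cases
      case 1
      then show ?thesis by (rule emb_cell_cover[OF gluesD(1)[OF g] e]) blast
    next
      case 2
      then show ?thesis by (rule emb_cell_cover[OF gluesD(2)[OF g] e]) blast
    qed
  qed
qed

lemma glues_emb:
  assumes "emb L K i" and g: "glues L K i K' i' M j f f'"
  shows "emb L M j"
  using emb_cong[OF emb_compose[OF assms(1) gluesD(1)[OF g]], of j] gluesD(3)[OF g] by simp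

lemma glues_dim_le:
  assumes "glues L K i K' i' M j f f'" "cw_dim_le K d" "cw_dim_le K' d"
  shows "cw_dim_le M d"
  using assms(2,3) by (simp add: cw_dim_le_def glues_cells[OF assms(1)])

lemma glues_in_complexes_over:
  assumes "finite_cw L" "(K, i) \<in> complexes_over d L" "(K', i') \<in> complexes_over d L" "glues L K i K' i' M j f f'"
  shows "(M, j) \<in> complexes_over d L"
  using assms glues_emb[OF _ assms(4)] glues_dim_le[OF assms(4)]
  by (simp add: complexes_over_iff[OF assms(1)])

text \<open>The isomorphism is \<open>g\<close> after the inverse of \<open>f\<close> on one copy
  and \<open>g'\<close> after the inverse of \<open>f'\<close> on the other. It is well defined and
  injective because in both gluings the copies meet in \<open>L\<close> and nowhere else.\<close>

lemma glues_unique: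
  assumes i: "emb L K i" and i': "emb L K' i'"
    and fg: "glues L K i K' i' M j f f'" and gg: "glues L K i K' i' N k g g'"
  obtains h where "cw_isomorphism M N h" "\<And>x. x \<in> cw_points L \<Longrightarrow> k x = h (j x)"
proof -
  note F = gluesD[OF fg] and G = gluesD[OF gg]
  define h where "h u = (if u \<in> f ` cw_points K then g (the_inv_into (cw_points K) f u)
     else g' (the_inv_into (cw_points K') f' u))" for u
  have hf: "h (f x) = g x" if "x \<in> cw_points K" for x
    using that the_inv_into_f_f[OF embD(4)[OF F(1)]] by (simp add: h_def)
  \<comment> \<open>Points of the two copies can coincide only over \<open>L\<close>; injectivity of
    \<open>f\<close> and \<open>f'\<close> then makes them the two images of one point of
    \<open>L\<close>.\<close>
  have ov: "\<exists>z\<in>cw_points L. x = i z \<and> y = i' z"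
    if xy: "x \<in> cw_points K" "y \<in> cw_points K'" "f x = f' y" for x y
  proof -
    have "f x \<in> j ` cw_points L" using F(6) xy by blast
    then obtain z where z: "z \<in> cw_points L" "f x = j z" by blast
    then have "f x = f (i z)" "f' y = f' (i' z)"
      using F(3)[OF z(1)] F(4)[OF z(1)] xy(3) by simp_all
    then have "x = i z" "y = i' z"
      using inj_onD[OF embD(4)[OF F(1)] _ xy(1) embD(6)[OF i z(1)]]
        inj_onD[OF embD(4)[OF F(2)] _ xy(2) embD(6)[OF i' z(1)]] by blast+
    then show ?thesis using z by blast
  qed
  have ov': "\<exists>z\<in>cw_points L. x = i z \<and> y = i' z"
    if xy: "x \<in> cw_points K" "y \<in> cw_points K'" "g x = g' y" for x y
  proof -
    have "g x \<in> k ` cw_points L" using G(6) xy by blast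
    then obtain z where z: "z \<in> cw_points L" "g x = k z" by blast
    then have "g x = g (i z)" "g' y = g' (i' z)"
      using G(3)[OF z(1)] G(4)[OF z(1)] xy(3) by simp_all
    then have "x = i z" "y = i' z"
      using inj_onD[OF embD(4)[OF G(1)] _ xy(1) embD(6)[OF i z(1)]]
        inj_onD[OF embD(4)[OF G(2)] _ xy(2) embD(6)[OF i' z(1)]] by blast+
    then show ?thesis using z by blast
  qed
  have hf': "h (f' y) = g' y" if y: "y \<in> cw_points K'" for y
  proof (cases "f' y \<in> f ` cw_points K")
    case True
    then obtain x where x: "x \<in> cw_points K" "f x = f' y" by (metis imageE)
    then obtain z where z: "z \<in> cw_points L" "x = i z" "y = i' z" using ov y by blast
    have "h (f' y) = g (i z)" using hf x z by metis
    also have "\<dots> = g' y" using G(3,4) z by simp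
    finally show ?thesis .
  next
    case False
    then show ?thesis using the_inv_into_f_f[OF embD(4)[OF F(2)] y] by (simp add: h_def)
  qed
  have inj: "inj_on h (cw_points M)"
  proof (rule inj_onI)
    have mixed: "f x = f' y" if "x \<in> cw_points K" "y \<in> cw_points K'" "g x = g' y" for x y
      using ov'[OF that] F(3,4) by auto
    fix u v assume u: "u \<in> cw_points M" and v: "v \<in> cw_points M" and eq: "h u = h v"
    consider x y where "x \<in> cw_points K" "y \<in> cw_points K" "u = f x" "v = f y"
      | x y where "x \<in> cw_points K" "y \<in> cw_points K'" "u = f x" "v = f' y"
      | x y where "x \<in> cw_points K'" "y \<in> cw_points K" "u = f' x" "v = f y"
      | x y where "x \<in> cw_points K'" "y \<in> cw_points K'" "u = f' x" "v = f' y"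
      using u v unfolding F(5) by blast
    then show "u = v"
    proof cases
      case 1
      then have "g x = g y" using eq hf by simp
      then show ?thesis using 1 inj_onD[OF embD(4)[OF G(1)]] by blast
    next
      case 2
      then show ?thesis using mixed[of x y] eq hf hf' by simp
    next
      case 3
      then show ?thesis using mixed[of y x] eq hf hf' by simp
    next
      case 4
      then have "g' x = g' y" using eq hf' by simp
      then show ?thesis using 4 inj_onD[OF embD(4)[OF G(2)]] by blast
    qed
  qed
  have "emb K N (\<lambda>x. h (f x))" "emb K' N (\<lambda>x. h (f' x))"
    by (rule emb_cong[OF G(1) hf], assumption, rule emb_cong[OF G(2) hf'], assumption)
  then have "emb M N h"
    by (rule emb_from_two_pieces[OF F(1,2,5) _ _ inj])
  moreover have "h ` cw_points M = cw_points N"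
    unfolding F(5) G(5) image_Un image_image using hf hf' by (simp cong: image_cong)
  ultimately have "cw_isomorphism M N h" by (rule emb_onto_isomorphism)
  moreover have "k x = h (j x)" if "x \<in> cw_points L" for x
  proof -
    have "h (j x) = h (f (i x))" using F(3) that by simp
    then show ?thesis using hf[OF embD(6)[OF i that]] G(3)[OF that] by simp
  qed
  ultimately show thesis using that by blast
qed

text \<open>An expansion of one factor expands the gluing: \<open>M\<close> is the part of
  \<open>N\<close> spanned by the cells of \<open>X\<close> and \<open>K'\<close>. The second copy
  meets the first only in \<open>L\<close>, which lies in \<open>X\<close>, so it does not touch the
  two new cells.\<close>

lemma glues_expansion:
  assumes i: "emb L X i" and j': "\<And>x. x \<in> cw_points L \<Longrightarrow> j' x = i x" and i': "emb L K' i'"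
    and ex: "elementary_expansion m X Y" and g: "glues L Y j' K' i' N k f f'"
  obtains M where "glues L X i K' i' M k f f'" "elementary_expansion m M N"
proof -
  note F = gluesD[OF g]
  have XY: "subcomplex X Y" using ex by (simp add: elementary_expansion_def)
  then have eXY: "emb X Y (\<lambda>x. x)" by (simp add: subcomplex_iff_emb)
  obtain e e' \<phi> where e: "e \<notin> cw_cells X m" and e': "e' \<notin> cw_cells X (Suc m)"
    and cY: "cw_cells Y = (cw_cells X)(m := insert e (cw_cells X m), Suc m := insert e' (cw_cells X (Suc m)))"
    and ch': "characteristic_map Y (Suc m) e' \<phi>" and ch: "characteristic_map Y m e (\<phi> \<circ> upper_hemisphere_map m)"
    and low: "\<phi> ` lower_hemisphere m \<subseteq> skeleton X m"
    using ex unfolding elementary_expansion_def by metis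
  have N: "finite_cw N" and Y: "finite_cw Y" and X: "finite_cw X" and K': "finite_cw K'"
    using embD[OF F(1)] embD[OF F(2)] embD[OF eXY] by blast+
  have eY: "e \<in> cw_cells Y m" and eY': "e' \<in> cw_cells Y (Suc m)" unfolding cY by auto
  have eX: "emb X N f" using emb_compose[OF eXY F(1)] .
  define D where "D = (\<lambda>k. (\<lambda>e. f ` e) ` cw_cells X k \<union> (\<lambda>e. f' ` e) ` cw_cells K' k)"
  define M where "M = restrict_cells N D"
  have D: "D k \<subseteq> cw_cells N k" for k
    using embD(5)[OF eX] embD(5)[OF F(2)] by (auto simp: D_def)
  have MN: "subcomplex M N"
    unfolding M_def
  proof (rule subcomplex_restrict_cells[OF N D])
    fix k c assume "c \<in> D k"
    then consider c0 where "c0 \<in> cw_cells X k" "c = f ` c0" | c0 where "c0 \<in> cw_cells K' k" "c = f' ` c0"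
      unfolding D_def by blast
    then show "\<exists>\<phi>. characteristic_map N k c \<phi> \<and> \<phi> ` disk_boundary k \<subseteq> (\<Union>k<k. \<Union>(D k))"
    proof cases
      case 1
      obtain \<psi> where \<psi>: "characteristic_map X k c0 \<psi>"
        using cell_characteristic_map[OF X 1(1)] by metis
      have "(f \<circ> \<psi>) ` disk_boundary k \<subseteq> (\<Union>k<k. \<Union>(D k))"
        using \<psi> unfolding image_comp[symmetric] characteristic_map_def
        by (intro image_Union_cells[where C="cw_cells X"]) (auto simp: D_def)
      then show ?thesis using emb_characteristic_map[OF eX 1(1) \<psi>] 1(2) by blast
    next
      case 2
      obtain \<psi> where \<psi>: "characteristic_map K' k c0 \<psi>"
        using cell_characteristic_map[OF K' 2(1)] by metis
      have "(f' \<circ> \<psi>) ` disk_boundary k \<subseteq> (\<Union>k<k. \<Union>(D k))"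
        using \<psi> unfolding image_comp[symmetric] characteristic_map_def
        by (intro image_Union_cells[where C="cw_cells K'"]) (auto simp: D_def)
      then show ?thesis using emb_characteristic_map[OF F(2) 2(1) \<psi>] 2(2) by blast
    qed
  qed
  have cM: "cw_cells M = D" by (simp add: M_def restrict_cells_def)
  have "(\<Union>k. \<Union>(cw_cells X k)) = cw_points X" "(\<Union>k. \<Union>(cw_cells K' k)) = cw_points K'"
    using X K' by (simp_all add: finite_cw_def)
  moreover have "cw_points M = (\<Union>m. \<Union>(D m))"
    unfolding M_def by (rule points_restrict_cells[OF N D])
  moreover have "(\<Union>m. \<Union>(D m)) = f ` (\<Union>k. \<Union>(cw_cells X k)) \<union> f' ` (\<Union>k. \<Union>(cw_cells K' k))"
    unfolding D_def by (simp add: image_UN image_Union UN_Un_distrib)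
  ultimately have pM: "cw_points M = f ` cw_points X \<union> f' ` cw_points K'"
    by simp
  have fX: "emb X M f"
    by (rule emb_into_subcomplex[OF MN eX]) (simp add: cM D_def)
  have fK': "emb K' M f'"
    by (rule emb_into_subcomplex[OF MN F(2)]) (simp add: cM D_def)
  have XsubY: "cw_points X \<subseteq> cw_points Y" using XY by (simp add: subcomplex_def)
  have jL: "k ` cw_points L \<subseteq> f ` cw_points X"
  proof
    fix y assume "y \<in> k ` cw_points L"
    then obtain x where "x \<in> cw_points L" "y = k x" by blast
    then have "y = f (i x)" "i x \<in> cw_points X" using F(3)[of x] j'[of x] embD(6)[OF i, of x] by auto
    then show "y \<in> f ` cw_points X" by blast
  qed
  have jL': "k ` cw_points L \<subseteq> f' ` cw_points K'"
    unfolding F(6)[symmetric] by (rule Int_lower2)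
  have glX: "glues L X i K' i' M k f f'"
    unfolding glues_def
  proof (intro conjI ballI)
    show "f (i x) = k x" "f' (i' x) = k x" if "x \<in> cw_points L" for x
      using F(3)[OF that] F(4)[OF that] j'[OF that] by auto
    show "f ` cw_points X \<inter> f' ` cw_points K' = k ` cw_points L"
      using F(6) XsubY jL jL' by blast
  qed (use fX fK' pM in auto)
  \<comment> \<open>A point in the image of a new cell that lay in \<open>M\<close> would come from
    \<open>X\<close>, either directly or, if it came from \<open>K'\<close>, by way of
    \<open>L\<close>; but new cells are disjoint from \<open>X\<close>.\<close>
  have new: "f ` c \<notin> D l" if c: "c \<in> cw_cells Y l" "c \<notin> cw_cells X l" for c l
  proof
    have disj: "c \<inter> cw_points X = {}"
    proof (rule ccontr)
      assume "c \<inter> cw_points X \<noteq> {}"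
      then obtain x where x: "x \<in> c" "x \<in> cw_points X" by blast
      then obtain l' c' where c': "c' \<in> cw_cells X l'" "x \<in> c'" using point_in_cell[OF X] by metis
      then have "c' \<in> cw_cells Y l'" using embD(5)[OF eXY] by force
      then have "l = l'" "c = c'" using cell_unique[OF Y c(1) _ x(1) c'(2)] by auto
      then show False using c c' by simp
    qed
    obtain x where x: "x \<in> c" using cell_nonempty[OF Y c(1)] by blast
    then have xY: "x \<in> cw_points Y" using cell_subset_points[OF Y c(1)] by blast
    assume "f ` c \<in> D l"
    then have "f x \<in> cw_points M"
      using x cell_subset_points[OF embD(2)[OF fX], of "f ` c" l] by (auto simp: cM)
    then have "f x \<in> f ` cw_points X"
      unfolding pM using F(6) jL xY by blast
    then show False
      using inj_onD[OF embD(4)[OF F(1)]] xY XsubY disj x by blast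
  qed
  have "cw_cells N = (cw_cells M)(m := insert (f ` e) (cw_cells M m), Suc m := insert (f ` e') (cw_cells M (Suc m)))"
    unfolding cM by (rule ext) (auto simp: glues_cells[OF g] D_def cY)
  moreover have "characteristic_map N (Suc m) (f ` e') (f \<circ> \<phi>)"
    using emb_characteristic_map[OF F(1) eY' ch'] .
  moreover have "characteristic_map N m (f ` e) ((f \<circ> \<phi>) \<circ> upper_hemisphere_map m)"
    using emb_characteristic_map[OF F(1) eY ch] by (simp add: comp_assoc)
  moreover have "(f \<circ> \<phi>) ` lower_hemisphere m \<subseteq> skeleton M m"
  proof -
    have "f ` skeleton X m \<subseteq> skeleton M m"
      unfolding skeleton_def cM D_def by blast
    then show ?thesis using low by (auto simp: image_comp[symmetric])
  qed
  ultimately have "elementary_expansion m M N"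
    unfolding elementary_expansion_def using MN new[OF eY e] new[OF eY' e'] cM by metis
  with glX that show thesis by blast
qed

text \<open>The shift of coordinates frees coordinate 0 for a label. Each \<open>at_level r\<close>
  is injective on the whole type, and different levels are disjoint.\<close>

definition at_level :: "real \<Rightarrow> point \<Rightarrow> point" where
  "at_level r x = (\<lambda>n. case n of 0 \<Rightarrow> r | Suc k \<Rightarrow> x k)"

lemma at_level_inject [simp]: "at_level r x = at_level s y \<longleftrightarrow> r = s \<and> x = y"
proof
  assume eq: "at_level r x = at_level s y"
  have "r = s" using fun_cong[OF eq, of 0] by (simp add: at_level_def)
  moreover have "x k = y k" for k using fun_cong[OF eq, of "Suc k"] by (simp add: at_level_def)
  ultimately show "r = s \<and> x = y" by auto
qed simp

lemma at_level_0 [simp]: "at_level r x 0 = r"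
  by (simp add: at_level_def)

text \<open>The pushout of \<open>K\<close> and \<open>K'\<close> over \<open>L\<close>:
  \<open>K\<close> is put on level 0, and the part of \<open>K'\<close> outside its copy of
  \<open>L\<close> on level 1.\<close>

lemma gluing_exists:
  fixes K K' L :: "point cw"
  assumes i: "emb L K i" and i': "emb L K' i'"
  obtains M j f f' where "glues L K i K' i' M j f f'"
proof -
  define A where "A = i' ` cw_points L"
  define g where "g y = i (the_inv_into (cw_points L) i' y)" for y
  define p where "p = at_level 0"
  define q where "q y = (if y \<in> A then p (g y) else at_level 1 y)" for y
  have L: "finite_cw L" and K: "finite_cw K" and K': "finite_cw K'"
    using embD[OF i] embD[OF i'] by blast+
  have gi: "g (i' x) = i x" if "x \<in> cw_points L" for x
    using the_inv_into_f_f[OF embD(4)[OF i'] that] by (simp add: g_def)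
  have AK': "A \<subseteq> cw_points K'" using embD(6)[OF i'] by (auto simp: A_def)
  have "compactin (cw_space K') A"
    using image_compactin[OF _ embD(3)[OF i']] finite_cw_compact[OF L]
    by (simp add: A_def compact_space_def cw_points_def)
  then have Acl: "closedin (cw_space K') A"
    using compactin_imp_closedin finite_cw_Hausdorff[OF K'] by blast
  obtain g0 where "homeomorphic_maps (cw_space L) (subtopology (cw_space K') A) i' g0"
    using emb_homeomorphic_image[OF i'] unfolding homeomorphic_map_maps A_def by blast
  then have g0: "continuous_map (subtopology (cw_space K') A) (cw_space L) g0"
    "\<And>x. x \<in> cw_points L \<Longrightarrow> g0 (i' x) = x"
    unfolding homeomorphic_maps_def cw_points_def by blast+
  have "continuous_map (subtopology (cw_space K') A) (cw_space K) (i \<circ> g0)"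
    using continuous_map_compose[OF g0(1) embD(3)[OF i]] .
  moreover have "(i \<circ> g0) y = g y" if "y \<in> topspace (subtopology (cw_space K') A)" for y
    using that g0(2) gi by (auto simp: A_def)
  ultimately have gc: "continuous_map (subtopology (cw_space K') A) (cw_space K) g"
    using continuous_map_eq by blast
  have pinj: "inj p" by (simp add: p_def inj_def)
  have qinj: "inj_on q (cw_points K' - A)" by (auto simp: q_def inj_on_def)
  have pq: "q y \<notin> range p" if "y \<notin> A" for y
    using that by (auto simp: q_def p_def)
  obtain T where T: "topspace T = p ` cw_points K \<union> q ` cw_points K'" "compact_space T"
    "Hausdorff_space T" "continuous_map (cw_space K) T p" "continuous_map (cw_space K') T q"
    unfolding cw_points_def
  proof (rule adjunction_space_exists[OF finite_cw_compact[OF K] finite_cw_Hausdorff[OF K]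
        finite_cw_compact[OF K'] finite_cw_Hausdorff[OF K'] Acl gc, of p q])
    show "inj_on p (topspace (cw_space K))" using pinj inj_on_subset by blast
    show "inj_on q (topspace (cw_space K') - A)" using qinj by (simp add: cw_points_def)
    show "q ` (topspace (cw_space K') - A) \<inter> p ` topspace (cw_space K) = {}" using pq by blast
    show "q a = p (g a)" if "a \<in> A" for a using that by (simp add: q_def)
  qed
  \<comment> \<open>A cell of \<open>K'\<close> that meets \<open>A\<close> is the image of a cell
    of \<open>L\<close> and is therefore already present as a cell of \<open>K\<close>; only the
    other cells of \<open>K'\<close> are added.\<close>
  define M where "M = \<lparr>cw_space = T, cw_cells = (\<lambda>m. (\<lambda>e. p ` e) ` cw_cells K m \<union>
      (\<lambda>e. q ` e) ` {e \<in> cw_cells K' m. e \<inter> A = {}})\<rparr>"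
  have pM: "cw_points M = p ` cw_points K \<union> q ` cw_points K'"
    by (simp add: cw_points_def M_def T(1)[unfolded cw_points_def])
  have inA: "\<exists>e0\<in>cw_cells L m. e = i' ` e0 \<and> q ` e = p ` (i ` e0)"
    if e: "e \<in> cw_cells K' m" "e \<inter> A \<noteq> {}" for e m
  proof -
    obtain x where "x \<in> cw_points L" "i' x \<in> e" using e by (auto simp: A_def)
    then obtain e0 where e0: "e0 \<in> cw_cells L m" "e = i' ` e0"
      using emb_cell_cover[OF i' e(1)] by metis
    have sub: "e0 \<subseteq> cw_points L" using cell_subset_points[OF L e0(1)] .
    then have "q (i' x) = p (i x)" if "x \<in> e0" for x
    proof -
      have x: "x \<in> cw_points L" using that sub by blast
      then have "i' x \<in> A" by (simp add: A_def)
      then show ?thesis unfolding q_def using gi[OF x] by simp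
    qed
    then have "q ` e = p ` (i ` e0)"
      unfolding e0(2) image_image by (intro image_cong refl)
    then show ?thesis using e0 by blast
  qed
  have qcell: "q ` e \<in> cw_cells M m" if e: "e \<in> cw_cells K' m" for e m
  proof (cases "e \<inter> A = {}")
    case False
    then obtain e0 where "e0 \<in> cw_cells L m" "q ` e = p ` (i ` e0)" using inA[OF e] by blast
    then show ?thesis using embD(5)[OF i] by (simp add: M_def)
  qed (use e in \<open>simp add: M_def\<close>)
  have pcell: "p ` e \<in> cw_cells M m" if e: "e \<in> cw_cells K m" for e m
    using e by (simp add: M_def)
  have cases_M: "(\<exists>e0\<in>cw_cells K m. e = p ` e0) \<or> (\<exists>e0\<in>cw_cells K' m. e0 \<inter> A = {} \<and> e = q ` e0)"
    if "e \<in> cw_cells M m" for e m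
    using that by (auto simp: M_def)
  have disj_pq: "p ` c \<inter> q ` e = {}" if "e \<inter> A = {}" for c e
  proof -
    have "p x \<noteq> q y" if "y \<in> e" for x y
      using pq[of y] that \<open>e \<inter> A = {}\<close> by (metis disjoint_iff rangeI)
    then show ?thesis by (auto simp: disjoint_iff)
  qed
  have M: "finite_cw M"
    unfolding finite_cw_def
  proof (intro conjI allI ballI impI)
    show Haus: "Hausdorff_space (cw_space M)" by (simp add: M_def T)
    have "{(m, e). e \<in> cw_cells M m} \<subseteq> (\<lambda>(m, e). (m, p ` e)) ` {(m, e). e \<in> cw_cells K m} \<union>
       (\<lambda>(m, e). (m, q ` e)) ` {(m, e). e \<in> cw_cells K' m}"
      by (auto simp: M_def)
    moreover have "finite {(m, e). e \<in> cw_cells K m}" "finite {(m, e). e \<in> cw_cells K' m}"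
      using K K' by (simp_all add: finite_cw_def)
    ultimately show "finite {(m, e). e \<in> cw_cells M m}"
      by (elim finite_subset) (intro finite_UnI finite_imageI)
    show "(\<Union>m. \<Union>(cw_cells M m)) = cw_points M"
    proof
      show "(\<Union>m. \<Union>(cw_cells M m)) \<subseteq> cw_points M"
      proof
        fix y assume "y \<in> (\<Union>m. \<Union>(cw_cells M m))"
        then obtain m e where e: "e \<in> cw_cells M m" "y \<in> e" by blast
        then consider c where "c \<in> cw_cells K m" "e = p ` c" | c where "c \<in> cw_cells K' m" "e = q ` c"
          using cases_M by metis
        then show "y \<in> cw_points M"
          using e(2) cell_subset_points[OF K, of _ m] cell_subset_points[OF K', of _ m]
          unfolding pM by cases blast+
      qed
      show "cw_points M \<subseteq> (\<Union>m. \<Union>(cw_cells M m))"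
      proof
        fix y assume "y \<in> cw_points M"
        then consider x where "x \<in> cw_points K" "y = p x" | x where "x \<in> cw_points K'" "y = q x"
          unfolding pM by blast
        then show "y \<in> (\<Union>m. \<Union>(cw_cells M m))"
        proof cases
          case 1
          then obtain m e where "e \<in> cw_cells K m" "x \<in> e" using point_in_cell[OF K] by metis
          then show ?thesis using pcell 1 by blast
        next
          case 2
          then obtain m e where "e \<in> cw_cells K' m" "x \<in> e" using point_in_cell[OF K'] by metis
          then show ?thesis using qcell 2 by blast
        qed
      qed
    qed
    show "e \<inter> e' = {}" if a: "e \<in> cw_cells M m \<and> e' \<in> cw_cells M m' \<and> (m, e) \<noteq> (m', e')" for m e m' e'
    proof -
      have pp: "c \<inter> c' = {}" if "c \<in> cw_cells K m" "c' \<in> cw_cells K m'" "(m, p ` c) \<noteq> (m', p ` c')" for c c'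
        using that cell_unique[OF K] by blast
      have qq: "c \<inter> c' = {}" if "c \<in> cw_cells K' m" "c' \<in> cw_cells K' m'" "(m, q ` c) \<noteq> (m', q ` c')" for c c'
        using that cell_unique[OF K'] by blast
      have qq': "q ` c \<inter> q ` c' = {}" if "c \<in> cw_cells K' m" "c \<inter> A = {}" "c' \<in> cw_cells K' m'" "c' \<inter> A = {}" "c \<inter> c' = {}" for c c'
      proof -
        have "c \<subseteq> cw_points K' - A" "c' \<subseteq> cw_points K' - A"
          using that cell_subset_points[OF K'] by blast+
        then show ?thesis using qinj that(5) by (metis image_empty inj_on_image_Int)
      qed
      consider c c' where "c \<in> cw_cells K m" "e = p ` c" "c' \<in> cw_cells K m'" "e' = p ` c'"
        | c c' where "e = p ` c" "e' = q ` c'" "c' \<inter> A = {}"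
        | c c' where "e = q ` c" "e' = p ` c'" "c \<inter> A = {}"
        | c c' where "c \<in> cw_cells K' m" "c \<inter> A = {}" "e = q ` c" "c' \<in> cw_cells K' m'" "c' \<inter> A = {}" "e' = q ` c'"
        using cases_M a by metis
      then show ?thesis
      proof cases
        case 1
        then have "c \<inter> c' = {}" using pp a by blast
        then show ?thesis unfolding 1 image_Int[OF pinj, symmetric] by simp
      next
        case 2
        then show ?thesis using disj_pq by blast
      next
        case 3
        then show ?thesis using disj_pq by blast
      next
        case 4
        then have "c \<inter> c' = {}" using qq a by blast
        then show ?thesis using qq' 4 by blast
      qed
    qed
    fix m e assume e: "e \<in> cw_cells M m"
    consider c where "c \<in> cw_cells K m" "e = p ` c" | c where "c \<in> cw_cells K' m" "c \<inter> A = {}" "e = q ` c"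
      using cases_M[OF e] by blast
    then have "e \<subseteq> cw_points M \<and> (\<exists>\<phi>. characteristic_map M m e \<phi>)"
    proof cases
      case 1
      obtain \<psi> where \<psi>: "characteristic_map K m c \<psi>" using cell_characteristic_map[OF K 1(1)] by metis
      have im: "\<psi> ` disk_interior m = c" using characteristic_map_cell_image[OF K 1(1) \<psi>] .
      have bd: "\<psi> ` disk_boundary m \<inter> c = {}" using characteristic_map_boundary_disjoint[OF K 1(1) \<psi>] .
      have "characteristic_map M m e (p \<circ> \<psi>)"
      proof (rule characteristic_mapI[OF Haus])
        show "continuous_map (disk m) (cw_space M) (p \<circ> \<psi>)"
          using continuous_map_compose[OF _ T(4), of "disk m" \<psi>] \<psi> by (simp add: characteristic_map_def M_def)
        show "inj_on (p \<circ> \<psi>) (disk_interior m)"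
          by (rule comp_inj_on[OF characteristic_map_image(1)[OF \<psi>] inj_on_subset[OF pinj subset_UNIV]])
        show "(p \<circ> \<psi>) ` disk_interior m = e" unfolding image_comp[symmetric] im 1(2) by (rule refl)
        show "(p \<circ> \<psi>) ` disk_boundary m \<subseteq> (\<Union>k<m. \<Union>(cw_cells M k))"
          unfolding image_comp[symmetric]
          by (rule image_Union_cells[where C="cw_cells K" and f=p])
            (use \<psi> pcell in \<open>simp_all add: characteristic_map_def\<close>)
        show "(p \<circ> \<psi>) ` disk_boundary m \<inter> e = {}"
          unfolding image_comp[symmetric] 1(2) image_Int[OF pinj, symmetric] bd by simp
      qed
      moreover have "e \<subseteq> cw_points M" using cell_subset_points[OF K 1(1)] 1(2) by (auto simp: pM)
      ultimately show ?thesis by blast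
    next
      case 2
      obtain \<psi> where \<psi>: "characteristic_map K' m c \<psi>" using cell_characteristic_map[OF K' 2(1)] by metis
      have im: "\<psi> ` disk_interior m = c" using characteristic_map_cell_image[OF K' 2(1) \<psi>] .
      have bd: "\<psi> ` disk_boundary m \<inter> c = {}" using characteristic_map_boundary_disjoint[OF K' 2(1) \<psi>] .
      have cA: "c \<subseteq> cw_points K' - A" using cell_subset_points[OF K' 2(1)] 2 by blast
      have bdK: "\<psi> ` disk_boundary m \<subseteq> cw_points K'"
        using characteristic_map_image(3)[OF \<psi>] by (auto simp: cw_points_def disk_set_split)
      have "characteristic_map M m e (q \<circ> \<psi>)"
      proof (rule characteristic_mapI[OF Haus])
        show "continuous_map (disk m) (cw_space M) (q \<circ> \<psi>)"
          using continuous_map_compose[OF _ T(5), of "disk m" \<psi>] \<psi> by (simp add: characteristic_map_def M_def)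
        show "inj_on (q \<circ> \<psi>) (disk_interior m)"
          using comp_inj_on[OF characteristic_map_image(1)[OF \<psi>], of q] inj_on_subset[OF qinj cA] im by simp
        show "(q \<circ> \<psi>) ` disk_interior m = e" unfolding image_comp[symmetric] im 2(3) by (rule refl)
        show "(q \<circ> \<psi>) ` disk_boundary m \<subseteq> (\<Union>k<m. \<Union>(cw_cells M k))"
          unfolding image_comp[symmetric]
          by (rule image_Union_cells[where C="cw_cells K'" and f=q])
            (use \<psi> qcell in \<open>simp_all add: characteristic_map_def\<close>)
        have "q y \<notin> q ` c" if y: "y \<in> \<psi> ` disk_boundary m" for y
        proof (cases "y \<in> A")
          case True
          then have qy: "q y \<in> range p" by (simp add: q_def)
          show ?thesis
          proof
            assume "q y \<in> q ` c"
            then obtain z where "z \<in> c" "q y = q z" by (metis imageE)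
            then show False using pq[of z] qy cA by auto
          qed
        next
          case False
          show ?thesis
          proof
            assume "q y \<in> q ` c"
            then obtain z where z: "z \<in> c" "q y = q z" by (metis imageE)
            then have "y = z" using inj_onD[OF qinj, OF z(2)] False y bdK cA by blast
            then show False using z y bd by blast
          qed
        qed
        then show "(q \<circ> \<psi>) ` disk_boundary m \<inter> e = {}"
          unfolding image_comp[symmetric] 2(3) by blast
      qed
      moreover have "e \<subseteq> cw_points M" using cA 2(3) by (auto simp: pM)
      ultimately show ?thesis by blast
    qed
    then show "e \<subseteq> cw_points M" "\<exists>\<phi>. characteristic_map M m e \<phi>" by auto
  qed
  have "continuous_map (cw_space K) (cw_space M) p" by (simp add: M_def T)
  then have "emb K M p"
    using K M inj_on_subset[OF pinj subset_UNIV] pcell by (simp add: emb_def)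
  moreover have "emb K' M q"
  proof -
    have "y = z" if yz: "y \<in> cw_points K'" "z \<in> cw_points K'" "q y = q z" for y z
    proof (cases "y \<in> A")
      case True
      then have "q y \<in> range p" by (simp add: q_def)
      then have "z \<in> A" using pq yz by metis
      then have gyz: "g y = g z" using True yz by (simp add: q_def p_def)
      obtain a b where "a \<in> cw_points L" "b \<in> cw_points L" "y = i' a" "z = i' b"
        using True \<open>z \<in> A\<close> by (auto simp: A_def)
      then show ?thesis using gyz gi[of a] gi[of b] inj_onD[OF embD(4)[OF i], of a b] by simp
    next
      case False
      then have "z \<notin> A" using pq[of y] yz by (auto simp: q_def)
      then show ?thesis using False yz(1,2) inj_onD[OF qinj, OF yz(3)] by blast
    qed
    then have "inj_on q (cw_points K')" by (auto simp: inj_on_def)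
    moreover have "continuous_map (cw_space K') (cw_space M) q" by (simp add: M_def T)
    ultimately show ?thesis using K' M qcell by (simp add: emb_def)
  qed
  moreover have "p ` cw_points K \<inter> q ` cw_points K' = (\<lambda>x. p (i x)) ` cw_points L"
  proof
    show "p ` cw_points K \<inter> q ` cw_points K' \<subseteq> (\<lambda>x. p (i x)) ` cw_points L"
    proof
      fix u assume "u \<in> p ` cw_points K \<inter> q ` cw_points K'"
      then obtain y where y: "y \<in> cw_points K'" "u = q y" "u \<in> range p" by blast
      then have "y \<in> A" using pq by blast
      then obtain x where "x \<in> cw_points L" "y = i' x" by (auto simp: A_def)
      then show "u \<in> (\<lambda>x. p (i x)) ` cw_points L" using y gi \<open>y \<in> A\<close> by (auto simp: q_def)
    qed
    show "(\<lambda>x. p (i x)) ` cw_points L \<subseteq> p ` cw_points K \<inter> q ` cw_points K'"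
    proof
      fix u assume "u \<in> (\<lambda>x. p (i x)) ` cw_points L"
      then obtain x where x: "x \<in> cw_points L" "u = p (i x)" by blast
      then have "u = q (i' x)" using gi by (auto simp: q_def A_def)
      then show "u \<in> p ` cw_points K \<inter> q ` cw_points K'"
        using x embD(6)[OF i] embD(6)[OF i'] by blast
    qed
  qed
  moreover have "q (i' x) = p (i x)" if "x \<in> cw_points L" for x
    using gi[OF that] that by (auto simp: q_def A_def)
  ultimately have "glues L K i K' i' M (\<lambda>x. p (i x)) p q"
    unfolding glues_def pM by blast
  then show thesis using that by blast
qed

section \<open>The product is compatible with deformations\<close>

lemma complexes_over_mono: "d \<le> d' \<Longrightarrow> complexes_over d L \<subseteq> complexes_over d' L"
  unfolding complexes_over_def cw_dim_le_def by auto

lemma complexes_over_finite: "(K, i) \<in> complexes_over d L \<Longrightarrow> finite_cw K"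
  by (simp add: complexes_over_def)

lemma isomorphism_deformation:
  assumes "(M, j) \<in> complexes_over d L" "(N, k) \<in> complexes_over d L" "cw_isomorphism M N h"
    "\<And>x. x \<in> cw_points L \<Longrightarrow> k x = h (j x)"
  shows "((M, j), (N, k)) \<in> deformation d L"
proof -
  have "((M, j), (N, k)) \<in> isomorphism_step d L"
    unfolding isomorphism_step_def using assms by blast
  then show ?thesis unfolding deformation_def by blast
qed

lemma expansion_deformation:
  assumes "(M, j) \<in> complexes_over d L" "(N, j) \<in> complexes_over d L" "elementary_expansion m M N" "Suc m \<le> d"
  shows "((M, j), (N, j)) \<in> deformation d L" "((N, j), (M, j)) \<in> deformation d L"
proof -
  have "((M, j), (N, j)) \<in> expansion_step d L"
    unfolding expansion_step_def using assms by blast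
  then show "((M, j), (N, j)) \<in> deformation d L" "((N, j), (M, j)) \<in> deformation d L"
    unfolding deformation_def by blast+
qed

lemma deformation_trans:
  "(A, B) \<in> deformation d L \<Longrightarrow> (B, C) \<in> deformation d L \<Longrightarrow> (A, C) \<in> deformation d L"
  unfolding deformation_def by (rule rtrancl_trans)

lemma glues_unique_deformation:
  assumes L: "finite_cw L" and K: "(K, i) \<in> complexes_over d L" and K': "(K', i') \<in> complexes_over d L"
    and M: "glues L K i K' i' M j f f'" and N: "glues L K i K' i' N k g g'"
  shows "((M, j), (N, k)) \<in> deformation d L"
proof -
  have "emb L K i" "emb L K' i'"
    using K K' complexes_over_iff[OF L] by blast+
  then obtain h where "cw_isomorphism M N h" "\<And>x. x \<in> cw_points L \<Longrightarrow> k x = h (j x)"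
    using glues_unique[OF _ _ M N] by metis
  then show ?thesis
    using isomorphism_deformation glues_in_complexes_over[OF L K K' M] glues_in_complexes_over[OF L K K' N]
    by metis
qed

text \<open>For an expansion or an isomorphism, a gluing of \<open>A\<close> is found directly from
  \<open>N\<close>. For a collapse \<open>N\<close> is too small: a gluing of the larger complex
  \<open>A\<close> is formed afresh, a gluing of \<open>B\<close> is found inside it, and uniqueness
  compares the latter with \<open>N\<close>.\<close>

lemma gluing_step:
  fixes L :: "point cw"
  assumes L: "finite_cw L" and K': "(K', i') \<in> complexes_over d L"
    and st: "((A, a), (B, b)) \<in> expansion_step d L \<union> (expansion_step d L)\<inverse> \<union> isomorphism_step d L"
    and N: "glues L B b K' i' N k f f'"
  obtains M j g g' where "glues L A a K' i' M j g g'" "((M, j), (N, k)) \<in> deformation d L"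
proof -
  have iff: "\<And>K i. (K, i) \<in> complexes_over d L \<longleftrightarrow> cw_dim_le K d \<and> emb L K i"
    using complexes_over_iff[OF L] .
  have i': "emb L K' i'" using K' iff by blast
  consider (e) "((A, a), (B, b)) \<in> expansion_step d L" | (c) "((B, b), (A, a)) \<in> expansion_step d L"
    | (i) "((A, a), (B, b)) \<in> isomorphism_step d L"
    using st by blast
  then show thesis
  proof cases
    case e
    then obtain m where m: "Suc m \<le> d" "elementary_expansion m A B"
      and A: "(A, a) \<in> complexes_over d L" and B: "(B, b) \<in> complexes_over d L"
      and ba: "\<And>x. x \<in> cw_points L \<Longrightarrow> b x = a x"
      unfolding expansion_step_def by blast
    have "emb L A a" using A iff by blast
    then obtain M where M: "glues L A a K' i' M k f f'" "elementary_expansion m M N"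
      using glues_expansion[OF _ ba i' m(2) N] by metis
    then show thesis
      using that expansion_deformation(1)[OF glues_in_complexes_over[OF L A K' M(1)] glues_in_complexes_over[OF L B K' N] M(2) m(1)]
      by blast
  next
    case c
    then obtain m where m: "Suc m \<le> d" "elementary_expansion m B A"
      and A: "(A, a) \<in> complexes_over d L" and B: "(B, b) \<in> complexes_over d L"
      and ab: "\<And>x. x \<in> cw_points L \<Longrightarrow> a x = b x"
      unfolding expansion_step_def by blast
    have ea: "emb L A a" and eb: "emb L B b" using A B iff by blast+
    obtain M j g g' where M: "glues L A a K' i' M j g g'"
      using gluing_exists[OF ea i'] by metis
    obtain N' where N': "glues L B b K' i' N' j g g'" "elementary_expansion m N' M"
      using glues_expansion[OF eb ab i' m(2) M] by metis
    have "((M, j), (N', j)) \<in> deformation d L"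
      using expansion_deformation(2)[OF glues_in_complexes_over[OF L B K' N'(1)] glues_in_complexes_over[OF L A K' M] N'(2) m(1)] .
    moreover have "((N', j), (N, k)) \<in> deformation d L"
      using glues_unique_deformation[OF L B K' N'(1) N] .
    ultimately show thesis using that M deformation_trans by blast
  next
    case i
    then obtain h where h: "cw_isomorphism A B h" "\<And>x. x \<in> cw_points L \<Longrightarrow> b x = h (a x)"
      and A: "(A, a) \<in> complexes_over d L" and B: "(B, b) \<in> complexes_over d L"
      unfolding isomorphism_step_def by blast
    have hh: "emb A B h" "h ` cw_points A = cw_points B"
      using isomorphism_emb[OF complexes_over_finite[OF A] complexes_over_finite[OF B] h(1)] by auto
    have eq: "(\<lambda>x. f (h x)) ` cw_points A = f ` cw_points B"
      using hh(2) by (metis image_image)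
    have "glues L A a K' i' N k (\<lambda>x. f (h x)) f'"
      using gluesD[OF N] emb_compose[OF hh(1) gluesD(1)[OF N]] h(2) by (simp add: glues_def eq)
    then show thesis using that by (simp add: deformation_def)
  qed
qed

text \<open>Induction along the deformation. The induction statement ranges over all gluings of the
  current end, because \<open>gluing_step\<close> produces a gluing of the preceding complex that
  cannot be prescribed.\<close>

lemma gluing_deformation:
  fixes L :: "point cw"
  assumes L: "finite_cw L" and K': "(K', i') \<in> complexes_over d L"
    and def: "((A, a), (B, b)) \<in> deformation d L"
    and A: "(A, a) \<in> complexes_over d L" and M: "glues L A a K' i' M j g g'" and N: "glues L B b K' i' N k f f'"
  shows "((M, j), (N, k)) \<in> deformation d L"
proof -
  have "\<forall>N k f f'. glues L (fst X) (snd X) K' i' N k f f' \<longrightarrow> ((M, j), (N, k)) \<in> deformation d L"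
    if "((A, a), X) \<in> deformation d L" for X
    using that unfolding deformation_def[of d L]
  proof (induction rule: rtrancl_induct)
    case base
    then show ?case
      using glues_unique_deformation[OF L A K' M] unfolding deformation_def by simp
  next
    case (step X Y)
    have st: "((fst X, snd X), (fst Y, snd Y)) \<in> expansion_step d L \<union> (expansion_step d L)\<inverse> \<union> isomorphism_step d L"
      using step.hyps(2) by simp
    show ?case
    proof (intro allI impI)
      fix N k f f' assume N: "glues L (fst Y) (snd Y) K' i' N k f f'"
      obtain N' k' h h' where N': "glues L (fst X) (snd X) K' i' N' k' h h'" "((N', k'), (N, k)) \<in> deformation d L"
        using gluing_step[OF L K' st N] by metis
      have "((M, j), (N', k')) \<in> deformation d L"
        using step.IH N'(1) unfolding deformation_def by blast
      then have "((M, j), (N, k)) \<in> deformation d L"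
        using N'(2) by (rule deformation_trans)
      then show "((M, j), (N, k)) \<in> (expansion_step d L \<union> (expansion_step d L)\<inverse> \<union> isomorphism_step d L)\<^sup>*"
        by (simp add: deformation_def)
    qed
  qed
  from this[OF def] N show ?thesis unfolding fst_conv snd_conv by blast
qed

lemma glues_commute: "glues L K i K' i' M j f f' \<Longrightarrow> glues L K' i' K i M j f' f"
  by (auto simp: glues_def)

text \<open>Independence of representatives. The factors are changed one at a time, by way of a
  gluing of the new first factor with the old second one; the second change uses the symmetry of
  gluings.\<close>

lemma KL_mult_eq_class:
  fixes L :: "point cw"
  assumes L: "finite_cw L" and K: "(K, i) \<in> complexes_over n L" and K': "(K', i') \<in> complexes_over n L"
    and M: "glues L K i K' i' M j f f'"
  shows "KL_mult n L (deformation_rel n L `` {(K, i)}) (deformation_rel n L `` {(K', i')})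
     = deformation_rel n L `` {(M, j)}"
proof -
  let ?R = "deformation_rel n L"
  let ?S = "{N. \<exists>P\<in>?R `` {(K, i)}. \<exists>P'\<in>?R `` {(K', i')}. is_gluing L P P' N}"
  have eq: "equiv (complexes_over n L) ?R" by (rule equiv_deformation_rel)
  \<comment> \<open>Deformations pass through dimension \<open>n + 1\<close>, so the factors are
    regarded as complexes of dimension at most \<open>n + 1\<close>.\<close>
  have up: "\<And>P. P \<in> complexes_over n L \<Longrightarrow> P \<in> complexes_over (n+1) L"
    using complexes_over_mono[of n "n+1" L] by auto
  have "is_gluing L (K, i) (K', i') (M, j)"
    using is_gluing_iff[OF complexes_over_finite[OF K] complexes_over_finite[OF K']] M by blast
  moreover have "(K, i) \<in> ?R `` {(K, i)}" "(K', i') \<in> ?R `` {(K', i')}"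
    using equiv_class_self[OF eq] K K' by blast+
  ultimately have MS: "(M, j) \<in> ?S" by blast
  have "((M, j), N) \<in> ?R" if N: "N \<in> ?S" for N
  proof -
    obtain Q Q' where "((K, i), Q) \<in> ?R" "((K', i'), Q') \<in> ?R" "is_gluing L Q Q' N"
      using N by blast
    moreover obtain P p P' p' where "Q = (P, p)" "Q' = (P', p')" by (metis surj_pair)
    ultimately have P: "((K, i), (P, p)) \<in> ?R" "((K', i'), (P', p')) \<in> ?R"
      and gl: "is_gluing L (P, p) (P', p') (fst N, snd N)"
      by simp_all
    have Pc: "(P, p) \<in> complexes_over n L" "(P', p') \<in> complexes_over n L"
      using P by (auto simp: deformation_rel_def)
    obtain g g' where g: "glues L P p P' p' (fst N) (snd N) g g'"
      using gl is_gluing_iff[OF complexes_over_finite[OF Pc(1)] complexes_over_finite[OF Pc(2)]] by blast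
    have "emb L P p" "emb L K' i'"
      using Pc(1) K' complexes_over_iff[OF L] by blast+
    \<comment> \<open>The mixed gluing, in which only the first factor has been replaced.\<close>
    then obtain Q q h h' where Q: "glues L P p K' i' Q q h h'"
      using gluing_exists by metis
    have "((K, i), (P, p)) \<in> deformation (n+1) L" "((K', i'), (P', p')) \<in> deformation (n+1) L"
      using P by (auto simp: deformation_rel_def)
    then have "((M, j), (Q, q)) \<in> deformation (n+1) L" "((Q, q), (fst N, snd N)) \<in> deformation (n+1) L"
      using gluing_deformation[OF L up[OF K'] _ up[OF K] M Q]
        gluing_deformation[OF L up[OF Pc(1)] _ up[OF K'] glues_commute[OF Q] glues_commute[OF g]] by blast+
    then have "((M, j), N) \<in> deformation (n+1) L"
      using deformation_trans by fastforce
    moreover have "(M, j) \<in> complexes_over n L" "(fst N, snd N) \<in> complexes_over n L"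
      using glues_in_complexes_over[OF L K K' M] glues_in_complexes_over[OF L Pc g] .
    ultimately show ?thesis by (simp add: deformation_rel_def)
  qed
  then have "?S \<subseteq> ?R `` {(M, j)}" by blast
  then have "?R `` ?S = ?R `` {(M, j)}"
    using MS equiv_class_eq[OF eq] by blast
  then show ?thesis by (simp add: KL_mult_def)
qed

section \<open>Attaching a cell\<close>

text \<open>The characteristic map is a parameter because its restriction to the boundary sphere,
  the attaching map, determines \<open>Y\<close> up to isomorphism relative to
  \<open>X\<close>.\<close>

definition cell_attached :: "'a cw \<Rightarrow> 'a cw \<Rightarrow> nat \<Rightarrow> 'a set \<Rightarrow> ((nat \<Rightarrow> real) \<Rightarrow> 'a) \<Rightarrow> bool" where
  "cell_attached X Y m e \<phi> \<longleftrightarrow> subcomplex X Y \<and> e \<notin> cw_cells X m \<and>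
     cw_cells Y = (cw_cells X)(m := insert e (cw_cells X m)) \<and> characteristic_map Y m e \<phi>"

lemma cell_attachedD:
  assumes a: "cell_attached X Y m e \<phi>"
  shows "subcomplex X Y" "e \<notin> cw_cells X m" "cw_cells Y = (cw_cells X)(m := insert e (cw_cells X m))"
    "characteristic_map Y m e \<phi>" "finite_cw X" "finite_cw Y" "emb X Y (\<lambda>x. x)" "e \<in> cw_cells Y m"
    "cw_points Y = cw_points X \<union> e" "cw_points X \<inter> e = {}" "\<phi> ` disk_interior m = e"
    "\<phi> ` disk_boundary m \<subseteq> (\<Union>k<m. \<Union>(cw_cells X k))" "\<phi> ` disk_boundary m \<subseteq> cw_points X"
    "continuous_map (disk m) (cw_space Y) \<phi>" "inj_on \<phi> (disk_interior m)"
    "cw_space X = subtopology (cw_space Y) (cw_points X)"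
proof -
  show sub: "subcomplex X Y" and new: "e \<notin> cw_cells X m" and cells: "cw_cells Y = (cw_cells X)(m := insert e (cw_cells X m))"
    and ch: "characteristic_map Y m e \<phi>"
    using a by (simp_all add: cell_attached_def)
  show X: "finite_cw X" and Y: "finite_cw Y" and "cw_space X = subtopology (cw_space Y) (cw_points X)"
    using sub unfolding subcomplex_def by blast+
  show XY: "emb X Y (\<lambda>x. x)" using sub by (simp add: subcomplex_iff_emb)
  show eY: "e \<in> cw_cells Y m" by (simp add: cells)
  have uX: "(\<Union>k. \<Union>(cw_cells X k)) = cw_points X" and uY: "(\<Union>k. \<Union>(cw_cells Y k)) = cw_points Y"
    using X Y by (simp_all add: finite_cw_def)
  have "(\<Union>k. \<Union>(cw_cells Y k)) = (\<Union>k. \<Union>(cw_cells X k)) \<union> e"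
  proof
    have "c \<in> cw_cells X k \<or> c = e" if "c \<in> cw_cells Y k" for c k
      using that by (auto simp: cells split: if_splits)
    then show "(\<Union>k. \<Union>(cw_cells Y k)) \<subseteq> (\<Union>k. \<Union>(cw_cells X k)) \<union> e" by blast
    have "cw_cells X k \<subseteq> cw_cells Y k" for k using embD(5)[OF XY] by auto
    then show "(\<Union>k. \<Union>(cw_cells X k)) \<union> e \<subseteq> (\<Union>k. \<Union>(cw_cells Y k))" using eY by blast
  qed
  then show "cw_points Y = cw_points X \<union> e" using uX uY by simp
  show disj: "cw_points X \<inter> e = {}"
  proof (rule ccontr)
    assume "cw_points X \<inter> e \<noteq> {}"
    then obtain x where x: "x \<in> cw_points X" "x \<in> e" by blast
    then obtain k c where c: "c \<in> cw_cells X k" "x \<in> c" using point_in_cell[OF X] by metis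
    then have "c \<in> cw_cells Y k" using embD(5)[OF XY] by force
    then show False using cell_unique[OF Y eY _ x(2) c(2)] c new by auto
  qed
  show "\<phi> ` disk_interior m = e" using characteristic_map_cell_image[OF Y eY ch] .
  have "(\<Union>k<m. \<Union>(cw_cells Y k)) = (\<Union>k<m. \<Union>(cw_cells X k))"
    unfolding cells by (intro SUP_cong) auto
  then show bd: "\<phi> ` disk_boundary m \<subseteq> (\<Union>k<m. \<Union>(cw_cells X k))"
    using ch by (simp add: characteristic_map_def)
  then show "\<phi> ` disk_boundary m \<subseteq> cw_points X" using uX by blast
  show "continuous_map (disk m) (cw_space Y) \<phi>" using ch by (simp add: characteristic_map_def)
  show "inj_on \<phi> (disk_interior m)" using characteristic_map_image(1)[OF ch] .
qed

lemma cell_attached_points: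
  assumes "cell_attached X Y m e \<phi>"
  shows "cw_points Y = cw_points X \<union> \<phi> ` disk_set m"
  using cell_attachedD(9,11,13)[OF assms] by (auto simp: disk_set_split)

lemma cell_attached_dim_le: "cell_attached X Y m e \<phi> \<Longrightarrow> cw_dim_le X d \<Longrightarrow> m \<le> d \<Longrightarrow> cw_dim_le Y d"
  using cell_attachedD(3)[of X Y m e \<phi>] by (auto simp: cw_dim_le_def)

text \<open>The interior of the new cell is placed on level \<open>r\<close>, which the bound on
  coordinate 0 keeps free. The new bound \<open>r + 1\<close> allows the construction to be
  iterated.\<close>

lemma cell_attached_exists:
  fixes X :: "point cw"
  assumes X: "finite_cw X" and room: "\<forall>x\<in>cw_points X. x 0 < r"
    and f: "continuous_map (subtopology (disk m) (disk_boundary m)) (cw_space X) f"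
    and fim: "f ` disk_boundary m \<subseteq> (\<Union>k<m. \<Union>(cw_cells X k))"
  obtains Y e \<phi> where "cell_attached X Y m e \<phi>" "\<And>x. x \<in> disk_boundary m \<Longrightarrow> \<phi> x = f x"
    "\<forall>x\<in>cw_points Y. x 0 < r + 1"
proof -
  define q where "q y = (if y \<in> disk_boundary m then f y else at_level r y)" for y
  have diff: "disk_set m - disk_boundary m = disk_interior m"
    using disk_interior_boundary_disjoint by (auto simp: disk_set_split)
  have qi: "q y = at_level r y" if "y \<in> disk_interior m" for y
    using that disk_interior_boundary_disjoint by (auto simp: q_def)
  have new: "q y \<notin> cw_points X" if "y \<in> disk_interior m" for y
    using bspec[OF room, of "q y"] that by (auto simp: qi)
  have qinj: "inj_on q (disk_interior m)" by (auto simp: inj_on_def qi)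
  obtain T where T: "topspace T = (\<lambda>x. x) ` topspace (cw_space X) \<union> q ` topspace (disk m)" "compact_space T"
    "Hausdorff_space T" "continuous_map (cw_space X) T (\<lambda>x. x)" "continuous_map (disk m) T q"
  proof (rule adjunction_space_exists[OF finite_cw_compact[OF X] finite_cw_Hausdorff[OF X]
        compact_space_disk Hausdorff_space_disk closedin_disk_boundary f, of "\<lambda>x. x" q])
    show "q ` (topspace (disk m) - disk_boundary m) \<inter> (\<lambda>x. x) ` topspace (cw_space X) = {}"
      using new by (auto simp: diff cw_points_def)
  qed (use qinj in \<open>auto simp: diff q_def\<close>)
  define e where "e = q ` disk_interior m"
  define Y where "Y = \<lparr>cw_space = T, cw_cells = (cw_cells X)(m := insert e (cw_cells X m))\<rparr>"
  have uX: "(\<Union>k. \<Union>(cw_cells X k)) = cw_points X"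
    using X by (simp add: finite_cw_def)
  have fX: "f ` disk_boundary m \<subseteq> cw_points X"
    using fim unfolding uX[symmetric] by blast
  have qb: "q ` disk_boundary m = f ` disk_boundary m" by (simp add: q_def)
  have pY: "cw_points Y = cw_points X \<union> e"
    unfolding cw_points_def e_def using fX by (simp add: Y_def T(1) disk_set_split image_Un qb cw_points_def) blast
  have eX: "cw_points X \<inter> e = {}" using new by (auto simp: e_def)
  have ene: "e \<noteq> {}" unfolding e_def using zero_in_disk_interior[of m] by blast
  have enew: "e \<notin> cw_cells X k" for k
    using cell_subset_points[OF X] eX ene by blast
  have cY: "cw_cells Y = (cw_cells X)(m := insert e (cw_cells X m))" by (simp add: Y_def)
  have caseY: "c \<in> cw_cells X k \<or> k = m \<and> c = e" if "c \<in> cw_cells Y k" for c k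
    using that by (auto simp: cY split: if_splits)
  have cXY: "cw_cells X k \<subseteq> cw_cells Y k" for k by (auto simp: cY)
  have Haus: "Hausdorff_space (cw_space Y)" by (simp add: Y_def T)
  have contX: "continuous_map (cw_space X) (cw_space Y) (\<lambda>x. x)" by (simp add: Y_def T)
  have ch: "characteristic_map Y m e q"
  proof (rule characteristic_mapI[OF Haus _ qinj])
    have "(\<Union>k<m. \<Union>(cw_cells X k)) \<subseteq> (\<Union>k<m. \<Union>(cw_cells Y k))" using cXY by blast
    then show "q ` disk_boundary m \<subseteq> (\<Union>k<m. \<Union>(cw_cells Y k))" using fim qb by simp
    show "q ` disk_boundary m \<inter> e = {}" using eX fX qb by blast
  qed (simp_all add: Y_def T e_def)
  have Y: "finite_cw Y"
    unfolding finite_cw_def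
  proof (intro conjI allI ballI impI)
    have "{(k, c). c \<in> cw_cells Y k} \<subseteq> insert (m, e) {(k, c). c \<in> cw_cells X k}" using caseY by auto
    moreover have "finite {(k, c). c \<in> cw_cells X k}" using X by (simp add: finite_cw_def)
    ultimately show "finite {(m, e). e \<in> cw_cells Y m}" by (meson finite_insert finite_subset)
    have "e \<in> cw_cells Y m" by (simp add: cY)
    then show "(\<Union>m. \<Union>(cw_cells Y m)) = cw_points Y"
      unfolding pY uX[symmetric] using caseY cXY by blast
    show "c \<inter> c' = {}" if a: "c \<in> cw_cells Y k \<and> c' \<in> cw_cells Y k' \<and> (k, c) \<noteq> (k', c')" for k c k' c'
    proof -
      consider "c \<in> cw_cells X k" "c' \<in> cw_cells X k'" | "c = e" "c' \<in> cw_cells X k'" | "c \<in> cw_cells X k" "c' = e"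
        using a caseY by blast
      then show ?thesis
      proof cases
        case 1
        then show ?thesis using cell_unique[OF X] a by blast
      next
        case 2
        then show ?thesis using cell_subset_points[OF X 2(2)] eX by blast
      next
        case 3
        then show ?thesis using cell_subset_points[OF X 3(1)] eX by blast
      qed
    qed
    fix k c assume c: "c \<in> cw_cells Y k"
    show "c \<subseteq> cw_points Y"
      using caseY[OF c] cell_subset_points[OF X] unfolding pY by blast
    show "\<exists>\<phi>. characteristic_map Y k c \<phi>"
    proof (cases "c \<in> cw_cells X k")
      case True
      then obtain \<psi> where \<psi>: "characteristic_map X k c \<psi>" using cell_characteristic_map[OF X] by metis
      have "characteristic_map Y k c \<psi>"
      proof (rule characteristic_mapI[OF Haus _ characteristic_map_image(1)[OF \<psi>]])
        show "continuous_map (disk k) (cw_space Y) \<psi>"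
          using continuous_map_compose[OF _ contX, of "disk k" \<psi>] \<psi> by (simp add: characteristic_map_def o_def)
        show "\<psi> ` disk_interior k = c" using characteristic_map_cell_image[OF X True \<psi>] .
        have "(\<Union>k'<k. \<Union>(cw_cells X k')) \<subseteq> (\<Union>k'<k. \<Union>(cw_cells Y k'))" using cXY by blast
        then show "\<psi> ` disk_boundary k \<subseteq> (\<Union>k<k. \<Union>(cw_cells Y k))"
          using \<psi> unfolding characteristic_map_def by blast
        show "\<psi> ` disk_boundary k \<inter> c = {}" using characteristic_map_boundary_disjoint[OF X True \<psi>] .
      qed
      then show ?thesis by blast
    next
      case False
      then show ?thesis using caseY[OF c] ch by blast
    qed
  qed (rule Haus)
  have "emb X Y (\<lambda>x. x)"
    unfolding emb_def using X Y contX cXY by auto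
  then have "cell_attached X Y m e q"
    using enew ch cY by (simp add: cell_attached_def subcomplex_iff_emb)
  moreover have "q x = f x" if "x \<in> disk_boundary m" for x using that by (simp add: q_def)
  moreover have "\<forall>x\<in>cw_points Y. x 0 < r + 1"
    using room unfolding pY e_def by (auto simp: qi)
  ultimately show thesis using that by blast
qed

text \<open>The universal property of the adjunction space; continuity comes from compactness of the
  two pieces.\<close>

lemma cell_attached_map:
  assumes a: "cell_attached X Y m e \<phi>" and h: "continuous_map (cw_space X) T h"
    and g: "continuous_map (disk m) T g" and gh: "\<And>x. x \<in> disk_boundary m \<Longrightarrow> g x = h (\<phi> x)"
  obtains H where "continuous_map (cw_space Y) T H" "\<And>x. x \<in> cw_points X \<Longrightarrow> H x = h x"
    "\<And>x. x \<in> disk_set m \<Longrightarrow> H (\<phi> x) = g x"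
proof -
  note A = cell_attachedD[OF a]
  define H where "H u = (if u \<in> cw_points X then h u else g (the_inv_into (disk_interior m) \<phi> u))" for u
  have HX: "H x = h x" if "x \<in> cw_points X" for x using that by (simp add: H_def)
  have H\<phi>: "H (\<phi> x) = g x" if x: "x \<in> disk_set m" for x
  proof (cases "x \<in> disk_boundary m")
    case True
    then show ?thesis using A(13) gh by (auto simp: H_def)
  next
    case False
    then have xi: "x \<in> disk_interior m" using x by (simp add: disk_set_split)
    then have "\<phi> x \<notin> cw_points X" using A(10,11) by blast
    then show ?thesis using the_inv_into_f_f[OF A(15) xi] by (simp add: H_def)
  qed
  have "continuous_map (cw_space Y) T H"
  proof (rule continuous_map_out_of_two_pieces[OF finite_cw_Hausdorff[OF A(6)] finite_cw_compact[OF A(5)]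
        compact_space_disk embD(3)[OF A(7)] A(14)])
    show "topspace (cw_space Y) \<subseteq> (\<lambda>x. x) ` topspace (cw_space X) \<union> \<phi> ` topspace (disk m)"
      using cell_attached_points[OF a] by (simp add: cw_points_def)
    show "continuous_map (cw_space X) T H"
      using continuous_map_eq[OF h] HX by (simp add: cw_points_def)
    show "continuous_map (disk m) T (\<lambda>x. H (\<phi> x))"
      using continuous_map_eq[OF g] H\<phi> by simp
  qed
  then show thesis using that HX H\<phi> by blast
qed

text \<open>Serves to identify a complex cut out of a larger one with a given complex that has the
  same attaching map.\<close>

lemma cell_attached_unique:
  assumes a: "cell_attached X Y m e \<phi>" and a': "cell_attached X' Y' m e' \<phi>'"
    and h: "emb X X' h" "h ` cw_points X = cw_points X'"
    and bd: "\<And>x. x \<in> disk_boundary m \<Longrightarrow> \<phi>' x = h (\<phi> x)"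
  obtains H where "cw_isomorphism Y Y' H" "\<And>x. x \<in> cw_points X \<Longrightarrow> H x = h x"
proof -
  note A = cell_attachedD[OF a] and A' = cell_attachedD[OF a']
  have hY: "emb X Y' h" using emb_compose[OF h(1) A'(7)] .
  obtain H where H: "continuous_map (cw_space Y) (cw_space Y') H" "\<And>x. x \<in> cw_points X \<Longrightarrow> H x = h x"
    "\<And>x. x \<in> disk_set m \<Longrightarrow> H (\<phi> x) = \<phi>' x"
    using cell_attached_map[OF a embD(3)[OF hY] A'(14) bd] by metis
  have H\<phi>: "H (\<phi> x) = \<phi>' x" if "x \<in> disk_interior m" for x using H(3) that by (simp add: disk_set_split)
  have He: "H ` e = e'"
    unfolding A(11)[symmetric] A'(11)[symmetric] image_image using H\<phi> by (intro image_cong refl)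
  have HX: "H ` cw_points X = cw_points X'"
    using H(2) h(2) by (simp cong: image_cong)
  have "H ` c \<in> cw_cells Y' k" if c: "c \<in> cw_cells Y k" for c k
  proof (cases "c \<in> cw_cells X k")
    case True
    then have "H ` c = h ` c"
      using cell_subset_points[OF A(5) True] H(2) by (intro image_cong refl) blast
    then show ?thesis using embD(5)[OF hY True] by simp
  next
    case False
    then have "k = m" "c = e" using c by (auto simp: A(3) split: if_splits)
    then show ?thesis using He A'(8) by simp
  qed
  moreover have "inj_on H (cw_points Y)"
    unfolding A(9)
  proof (rule inj_on_Un[THEN iffD2], intro conjI)
    show "inj_on H (cw_points X)" using embD(4)[OF h(1)] H(2) by (simp cong: inj_on_cong)
    show "inj_on H e"
    proof (rule inj_onI)
      fix u v assume "u \<in> e" "v \<in> e" and eq: "H u = H v"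
      then obtain x y where xy: "x \<in> disk_interior m" "y \<in> disk_interior m" "u = \<phi> x" "v = \<phi> y"
        using A(11) by blast
      then have "\<phi>' x = \<phi>' y" using eq H\<phi> by simp
      then have "x = y" using inj_onD[OF A'(15)] xy by blast
      then show "u = v" using xy by simp
    qed
    have "H ` (cw_points X - e) \<subseteq> cw_points X'" "H ` (e - cw_points X) \<subseteq> e'"
      using HX He by blast+
    then show "H ` (cw_points X - e) \<inter> H ` (e - cw_points X) = {}" using A'(10) by blast
  qed
  ultimately have "emb Y Y' H" using A(6) A'(6) H(1) by (simp add: emb_def)
  moreover have "H ` cw_points Y = cw_points Y'"
    by (simp add: A(9) A'(9) image_Un HX He)
  ultimately have "cw_isomorphism Y Y' H" by (rule emb_onto_isomorphism)
  then show thesis using that H(2) by blast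
qed

section \<open>Homotopic attaching maps\<close>

text \<open>The map \<open>klein m\<close> is an involution of the ball which preserves the sphere and exchanges the upper
  hemisphere with the cap \<open>z \<le> -3/5\<close>: it is the hyperbolic half-turn of the Klein model that
  exchanges these two half-spaces.\<close>

definition klein :: "nat \<Rightarrow> (nat \<Rightarrow> real) \<Rightarrow> (nat \<Rightarrow> real)" where
  "klein m x = (\<lambda>i. if i < m then 4 * x i / (5 + 3 * x m)
     else if i = m then - (5 * x m + 3) / (5 + 3 * x m) else 0)"

lemma disk_last_coordinate: "x \<in> disk_set (Suc m) \<Longrightarrow> \<bar>x m\<bar> \<le> 1"
proof -
  assume "x \<in> disk_set (Suc m)"
  then have "(\<Sum>i<m. (x i)\<^sup>2) + (x m)\<^sup>2 \<le> 1" by (simp add: disk_set_alt)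
  moreover have "(\<Sum>i<m. (x i)\<^sup>2) \<ge> 0" by (simp add: sum_nonneg)
  ultimately have "(x m)\<^sup>2 \<le> 1" by linarith
  then show ?thesis by (simp add: abs_square_le_1)
qed

lemma klein_denominator: "x \<in> disk_set (Suc m) \<Longrightarrow> 5 + 3 * x m > 0"
  using disk_last_coordinate[of x m] by linarith

text \<open>Read as \<open>1 - |klein x|^2 = 16 (1 - |x|^2) / (5 + 3 x_m)^2\<close>, it shows that
  the open ball and the sphere are preserved. The 16 is \<open>5^2 - 3^2\<close>.\<close>

lemma klein_norm:
  assumes x: "x \<in> disk_set (Suc m)"
  shows "(\<Sum>i<Suc m. (klein m x i)\<^sup>2) = 1 - 16 * (1 - (\<Sum>i<Suc m. (x i)\<^sup>2)) / (5 + 3 * x m)\<^sup>2"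
proof -
  let ?d = "5 + 3 * x m"
  have d: "?d \<noteq> 0" using klein_denominator[OF x] by simp
  have km: "klein m x m = - ((5 * x m + 3) / ?d)" by (simp add: klein_def minus_divide_left)
  have "(\<Sum>i<Suc m. (klein m x i)\<^sup>2) = (\<Sum>i<m. (4 * x i / ?d)\<^sup>2) + ((5 * x m + 3) / ?d)\<^sup>2"
    unfolding sum.lessThan_Suc km power2_minus by (simp add: klein_def)
  also have "(\<Sum>i<m. (4 * x i / ?d)\<^sup>2) = 16 * (\<Sum>i<m. (x i)\<^sup>2) / ?d\<^sup>2"
    by (simp add: power_divide power_mult_distrib sum_distrib_left sum_divide_distrib)
  also have "16 * (\<Sum>i<m. (x i)\<^sup>2) / ?d\<^sup>2 + ((5 * x m + 3) / ?d)\<^sup>2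
      = (16 * (\<Sum>i<m. (x i)\<^sup>2) + (5 * x m + 3)\<^sup>2) / ?d\<^sup>2"
    unfolding power_divide[of "5 * x m + 3"] by (rule add_divide_distrib[symmetric])
  also have "16 * (\<Sum>i<m. (x i)\<^sup>2) + (5 * x m + 3)\<^sup>2 = ?d\<^sup>2 - 16 * (1 - (\<Sum>i<Suc m. (x i)\<^sup>2))"
    by (simp add: power2_eq_square algebra_simps)
  finally show ?thesis using d by (simp add: diff_divide_distrib)
qed

lemma klein_disk:
  assumes x: "x \<in> disk_set (Suc m)"
  shows "klein m x \<in> disk_set (Suc m)" "klein m x \<in> disk_boundary (Suc m) \<longleftrightarrow> x \<in> disk_boundary (Suc m)"
proof -
  have d: "(5 + 3 * x m)\<^sup>2 > 0" using klein_denominator[OF x] by simp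
  have z: "klein m x i = 0" if "i \<ge> Suc m" for i using that by (simp add: klein_def)
  have "16 * (1 - (\<Sum>i<Suc m. (x i)\<^sup>2)) / (5 + 3 * x m)\<^sup>2 \<ge> 0"
    using x d by (intro divide_nonneg_pos) (auto simp: disk_set_alt)
  then show "klein m x \<in> disk_set (Suc m)"
    using klein_norm[OF x] z unfolding disk_set_alt by simp
  have "16 * (1 - (\<Sum>i<Suc m. (x i)\<^sup>2)) / (5 + 3 * x m)\<^sup>2 = 0 \<longleftrightarrow> (\<Sum>i<Suc m. (x i)\<^sup>2) = 1"
    using d by auto
  then have "(\<Sum>i<Suc m. (klein m x i)\<^sup>2) = 1 \<longleftrightarrow> (\<Sum>i<Suc m. (x i)\<^sup>2) = 1"
    unfolding klein_norm[OF x] by linarith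
  then show "klein m x \<in> disk_boundary (Suc m) \<longleftrightarrow> x \<in> disk_boundary (Suc m)"
    using z x unfolding disk_boundary_alt disk_set_alt by blast
qed

lemma klein_klein:
  assumes x: "x \<in> disk_set (Suc m)"
  shows "klein m (klein m x) = x"
proof
  fix i
  have d: "5 + 3 * x m \<noteq> 0" using klein_denominator[OF x] by simp
  have k: "klein m x m = - (5 * x m + 3) / (5 + 3 * x m)" by (simp add: klein_def)
  have d': "5 + 3 * klein m x m = 16 / (5 + 3 * x m)"
    unfolding k using d by (simp add: field_simps)
  show "klein m (klein m x) i = x i"
  proof (cases "i < m")
    case True
    then have "klein m (klein m x) i = 4 * (4 * x i / (5 + 3 * x m)) / (5 + 3 * klein m x m)"
      by (simp add: klein_def)
    also have "\<dots> = x i" unfolding d' using d by simp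
    finally show ?thesis .
  next
    case False
    show ?thesis
    proof (cases "i = m")
      case True
      have "klein m (klein m x) i = - (5 * klein m x m + 3) / (5 + 3 * klein m x m)"
        using True by (simp add: klein_def)
      also have "\<dots> = x m" unfolding d' unfolding k using d by (simp add: field_simps)
      finally show ?thesis using True by simp
    next
      case False
      then show ?thesis using \<open>\<not> i < m\<close> x by (simp add: klein_def disk_set_alt)
    qed
  qed
qed

lemma klein_height:
  assumes x: "x \<in> disk_set (Suc m)"
  shows "klein m x m \<ge> 0 \<longleftrightarrow> x m \<le> -3/5" "klein m x m \<le> 0 \<longleftrightarrow> x m \<ge> -3/5"
    "klein m x m \<ge> -3/5 \<longleftrightarrow> x m \<le> 0"
proof -
  have d: "5 + 3 * x m > 0" using klein_denominator[OF x] .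
  have k: "klein m x m = - (5 * x m + 3) / (5 + 3 * x m)" by (simp add: klein_def)
  show "klein m x m \<ge> 0 \<longleftrightarrow> x m \<le> -3/5" "klein m x m \<le> 0 \<longleftrightarrow> x m \<ge> -3/5"
    "klein m x m \<ge> -3/5 \<longleftrightarrow> x m \<le> 0"
    unfolding k using d by (auto simp: field_simps)
qed

lemma continuous_on_klein: "continuous_on (disk_set (Suc m)) (klein m)"
proof (rule continuous_on_coordinatewise_then_product)
  fix i
  have nz: "\<forall>x\<in>disk_set (Suc m). 5 + 3 * x m \<noteq> 0"
    using klein_denominator by (metis less_irrefl)
  consider "i < m" | "i = m" | "i > m" by linarith
  then show "continuous_on (disk_set (Suc m)) (\<lambda>x. klein m x i)"
    by cases (auto simp: klein_def intro!: continuous_intros nz[rule_format])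
qed

lemma upper_hemisphere_map_props:
  assumes y: "y \<in> disk_set m"
  shows "upper_hemisphere_map m y \<in> disk_boundary (Suc m)" "upper_hemisphere_map m y m \<ge> 0"
    "(upper_hemisphere_map m y)(m := 0) = y"
proof -
  have "(\<Sum>i<m. (upper_hemisphere_map m y i)\<^sup>2) = (\<Sum>i<m. (y i)\<^sup>2)"
    by (intro sum.cong) (auto simp: upper_hemisphere_map_def)
  then show "upper_hemisphere_map m y \<in> disk_boundary (Suc m)"
    using y by (auto simp: disk_boundary_alt disk_set_alt upper_hemisphere_map_def)
  show "upper_hemisphere_map m y m \<ge> 0"
    using y by (auto simp: disk_set_alt upper_hemisphere_map_def)
  show "(upper_hemisphere_map m y)(m := 0) = y"
    using y by (auto simp: disk_set_alt upper_hemisphere_map_def)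
qed

lemma sphere_projection:
  assumes x: "x \<in> disk_boundary (Suc m)"
  shows "x(m := 0) \<in> disk_set m" "x m = 0 \<Longrightarrow> x(m := 0) \<in> disk_boundary m"
proof -
  have "(\<Sum>i<m. ((x(m := 0)) i)\<^sup>2) = (\<Sum>i<m. (x i)\<^sup>2)"
    by (intro sum.cong) auto
  moreover have "(\<Sum>i<m. (x i)\<^sup>2) + (x m)\<^sup>2 = 1" "\<forall>i\<ge>Suc m. x i = 0"
    using x by (simp_all add: disk_boundary_alt)
  moreover have "(x(m := 0)) i = 0" if "i \<ge> m" for i
    using calculation(3) that by (cases "i = m") auto
  ultimately show "x(m := 0) \<in> disk_set m" "x m = 0 \<Longrightarrow> x(m := 0) \<in> disk_boundary m"
    by (auto simp: disk_boundary_alt disk_set_alt) (smt (verit) zero_le_power2)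
qed

lemma characteristic_map_cong:
  assumes K: "finite_cw K" "e \<in> cw_cells K m" and ch: "characteristic_map K m e \<phi>"
    and eq: "\<And>x. x \<in> disk_set m \<Longrightarrow> \<psi> x = \<phi> x"
  shows "characteristic_map K m e \<psi>"
proof (rule characteristic_mapI[OF finite_cw_Hausdorff[OF K(1)]])
  have i: "\<psi> ` disk_interior m = \<phi> ` disk_interior m" and b: "\<psi> ` disk_boundary m = \<phi> ` disk_boundary m"
    using eq by (auto simp: disk_set_split intro!: image_cong)
  show "continuous_map (disk m) (cw_space K) \<psi>"
    using ch continuous_map_eq[of "disk m" "cw_space K" \<phi> \<psi>] eq by (simp add: characteristic_map_def)
  have "inj_on \<psi> (disk_interior m) \<longleftrightarrow> inj_on \<phi> (disk_interior m)"
    using eq by (intro inj_on_cong) (simp add: disk_set_split)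
  then show "inj_on \<psi> (disk_interior m)" using characteristic_map_image(1)[OF ch] by simp
  show "\<psi> ` disk_interior m = e" unfolding i using characteristic_map_cell_image[OF K ch] .
  show "\<psi> ` disk_boundary m \<subseteq> (\<Union>k<m. \<Union>(cw_cells K k))"
    unfolding b using ch by (simp add: characteristic_map_def)
  show "\<psi> ` disk_boundary m \<inter> e = {}" unfolding b using characteristic_map_boundary_disjoint[OF K ch] .
qed

lemma klein_interior_image: "klein m ` disk_interior (Suc m) = disk_interior (Suc m)"
  and klein_boundary_image: "klein m ` disk_boundary (Suc m) = disk_boundary (Suc m)"
proof -
  have i: "klein m x \<in> disk_interior (Suc m)" if x: "x \<in> disk_interior (Suc m)" for x
  proof -
    have xs: "x \<in> disk_set (Suc m)" "x \<notin> disk_boundary (Suc m)"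
      using x disk_interior_boundary_disjoint by (auto simp: disk_set_split)
    then show ?thesis using klein_disk[OF xs(1)] by (auto simp: disk_set_split)
  qed
  have b: "klein m x \<in> disk_boundary (Suc m)" if x: "x \<in> disk_boundary (Suc m)" for x
    using x klein_disk(2)[of x m] by (simp add: disk_set_split)
  have "x \<in> klein m ` disk_interior (Suc m)" if "x \<in> disk_interior (Suc m)" for x
    using i[OF that] klein_klein[of x m] that by (metis UnI1 disk_set_split imageI)
  then show "klein m ` disk_interior (Suc m) = disk_interior (Suc m)" using i by blast
  have "x \<in> klein m ` disk_boundary (Suc m)" if "x \<in> disk_boundary (Suc m)" for x
    using b[OF that] klein_klein[of x m] that by (metis UnI2 disk_set_split imageI)
  then show "klein m ` disk_boundary (Suc m) = disk_boundary (Suc m)" using b by blast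
qed

text \<open>Reparametrized by the half-turn, a cell offers its cap in the place that the definition
  of an expansion reserves for the upper hemisphere.\<close>

lemma characteristic_map_klein:
  assumes K: "finite_cw K" "e \<in> cw_cells K (Suc m)" and ch: "characteristic_map K (Suc m) e \<phi>"
  shows "characteristic_map K (Suc m) e (\<phi> \<circ> klein m)"
proof (rule characteristic_mapI[OF finite_cw_Hausdorff[OF K(1)]])
  have "continuous_map (disk (Suc m)) (disk (Suc m)) (klein m)"
    using continuous_on_klein klein_disk(1) by (auto simp: disk_eq)
  then show "continuous_map (disk (Suc m)) (cw_space K) (\<phi> \<circ> klein m)"
    using continuous_map_compose ch unfolding characteristic_map_def by blast
  have "inj_on (klein m) (disk_interior (Suc m))"
    by (metis UnI1 disk_set_split inj_onI klein_klein)
  then show "inj_on (\<phi> \<circ> klein m) (disk_interior (Suc m))"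
    using characteristic_map_image(1)[OF ch] by (simp add: comp_inj_on klein_interior_image)
  show "(\<phi> \<circ> klein m) ` disk_interior (Suc m) = e"
    unfolding image_comp[symmetric] klein_interior_image using characteristic_map_cell_image[OF K ch] .
  show "(\<phi> \<circ> klein m) ` disk_boundary (Suc m) \<subseteq> (\<Union>k<Suc m. \<Union>(cw_cells K k))"
    unfolding image_comp[symmetric] klein_boundary_image using ch by (simp add: characteristic_map_def)
  show "(\<phi> \<circ> klein m) ` disk_boundary (Suc m) \<inter> e = {}"
    unfolding image_comp[symmetric] klein_boundary_image using characteristic_map_boundary_disjoint[OF K ch] .
qed

section \<open>The attaching map of a cell that joins two homotopic cells\<close>

lemma sphere_eq: "subtopology (disk m) (disk_boundary m) = top_of_set (disk_boundary m)"
proof -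
  have "disk_set m \<inter> disk_boundary m = disk_boundary m" by (auto simp: disk_set_split)
  then show ?thesis by (simp add: disk_eq subtopology_subtopology)
qed

text \<open>Parametrizes the belt \<open>-3/5 \<le> x_m \<le> 0\<close> of the sphere by time and
  equator: the factor \<open>-5/3\<close> turns heights into times, from 0 on the equator to 1 on
  the rim of the cap, and the remaining coordinates are scaled to length 1.\<close>

definition strip :: "nat \<Rightarrow> (nat \<Rightarrow> real) \<Rightarrow> real \<times> (nat \<Rightarrow> real)" where
  "strip m x = (- (5/3) * x m, \<lambda>i. if i < m then x i / sqrt (1 - (x m)\<^sup>2) else 0)"

lemma strip_continuous:
  "continuous_map (top_of_set {x \<in> disk_boundary (Suc m). -3/5 \<le> x m \<and> x m \<le> 0})
     (prod_topology (top_of_set {0..1}) (top_of_set (disk_boundary m))) (strip m)"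
proof -
  let ?B = "{x \<in> disk_boundary (Suc m). -3/5 \<le> x m \<and> x m \<le> 0}"
  have pos: "1 - (x m)\<^sup>2 > 0" if "x \<in> ?B" for x
  proof -
    have "(x m)\<^sup>2 \<le> (3/5)\<^sup>2" using that by (intro power2_le_iff_abs_le[THEN iffD2]) auto
    then show ?thesis by (simp add: power2_eq_square)
  qed
  have "snd (strip m x) \<in> disk_boundary m" if x: "x \<in> ?B" for x
  proof -
    have "(\<Sum>i<m. (snd (strip m x) i)\<^sup>2) = (\<Sum>i<m. (x i)\<^sup>2 / (1 - (x m)\<^sup>2))"
      using pos[OF x] by (intro sum.cong) (auto simp: strip_def power_divide)
    also have "\<dots> = (\<Sum>i<m. (x i)\<^sup>2) / (1 - (x m)\<^sup>2)" by (simp add: sum_divide_distrib)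
    also have "(\<Sum>i<m. (x i)\<^sup>2) = 1 - (x m)\<^sup>2" using x by (simp add: disk_boundary_alt)
    also have "(1 - (x m)\<^sup>2) / (1 - (x m)\<^sup>2) = 1" using pos[OF x] by simp
    finally show ?thesis by (simp add: disk_boundary_alt) (simp add: strip_def)
  qed
  moreover have cs: "continuous_on ?B (\<lambda>x. snd (strip m x))"
  proof (rule continuous_on_coordinatewise_then_product)
    fix i
    have nz: "sqrt (1 - (x m)\<^sup>2) \<noteq> 0" if "x \<in> ?B" for x using pos[OF that] by simp
    have "continuous_on ?B (\<lambda>x. x i / sqrt (1 - (x m)\<^sup>2))"
      by (intro continuous_intros) (use nz in blast)
    then show "continuous_on ?B (\<lambda>x. snd (strip m x) i)"
      by (cases "i < m") (simp_all add: strip_def)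
  qed
  moreover have cf: "continuous_on ?B (\<lambda>x. fst (strip m x))"
    unfolding strip_def fst_conv by (intro continuous_intros)
  have "continuous_on ?B (strip m)"
    using continuous_on_Pair[OF cf cs] by simp
  moreover have "fst (strip m x) \<in> {0..1}" if "x \<in> ?B" for x
    using that by (simp add: strip_def)
  ultimately show ?thesis
    by (simp add: mem_Times_iff Pi_iff)
qed

text \<open>The sphere has three zones: \<open>\<phi>\<close> on the upper hemisphere, the homotopy
  on the belt, and \<open>\<phi>'\<close> on the cap, which the half-turn moves to the upper
  hemisphere before projection. They fit because the homotopy starts at \<open>\<phi>\<close> on the
  equator and ends at \<open>\<phi>'\<close> on the rim.\<close>

lemma slide_attaching_map:
  assumes \<phi>: "continuous_map (disk m) T \<phi>" and \<phi>': "continuous_map (disk m) T \<phi>'"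
    and H: "continuous_map (prod_topology (top_of_set {0..1}) (top_of_set (disk_boundary m))) T H"
    and H0: "\<And>x. x \<in> disk_boundary m \<Longrightarrow> H (0, x) = \<phi> x"
    and H1: "\<And>x. x \<in> disk_boundary m \<Longrightarrow> H (1, x) = \<phi>' x"
  shows "continuous_map (top_of_set (disk_boundary (Suc m))) T
    (\<lambda>x. if 0 \<le> x m then \<phi> (x(m := 0)) else if -3/5 \<le> x m then H (strip m x) else \<phi>' ((klein m x)(m := 0)))"
proof -
  let ?S = "disk_boundary (Suc m)"
  have cz: "continuous_map (subtopology (top_of_set ?S) A) euclideanreal (\<lambda>x. x m)" for A
    by (simp add: subtopology_subtopology continuous_on_coord)
  have pc: "continuous_on A (\<lambda>x::nat\<Rightarrow>real. x(m := 0))" for A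
  proof (rule continuous_on_coordinatewise_then_product)
    show "continuous_on A (\<lambda>x::nat\<Rightarrow>real. (x(m := 0)) i)" for i
      by (cases "i = m") (simp_all add: continuous_on_coord)
  qed
  have "continuous_map (top_of_set {x \<in> ?S. 0 \<le> x m}) (disk m) (\<lambda>x. x(m := 0))"
    using pc sphere_projection(1) by (auto simp: disk_eq)
  then have up: "continuous_map (top_of_set {x \<in> ?S. 0 \<le> x m}) T (\<lambda>x. \<phi> (x(m := 0)))"
    using continuous_map_compose[OF _ \<phi>] by (auto simp: o_def)
  have kS: "klein m x \<in> ?S" if "x \<in> ?S" for x
    using that klein_boundary_image by blast
  have "continuous_on {x \<in> ?S. x m \<le> -3/5} (\<lambda>x. (klein m x)(m := 0))"
    by (rule continuous_on_compose2[OF pc[of UNIV] continuous_on_subset[OF continuous_on_klein]])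
      (auto simp: disk_set_split)
  then have "continuous_map (top_of_set {x \<in> ?S. x m \<le> -3/5}) (disk m) (\<lambda>x. (klein m x)(m := 0))"
    using sphere_projection(1) kS by (auto simp: disk_eq)
  then have lo: "continuous_map (top_of_set {x \<in> ?S. x m \<le> -3/5}) T (\<lambda>x. \<phi>' ((klein m x)(m := 0)))"
    using continuous_map_compose[OF _ \<phi>'] by (auto simp: o_def)
  have mid: "continuous_map (top_of_set {x \<in> ?S. -3/5 \<le> x m \<and> x m \<le> 0}) T (\<lambda>x. H (strip m x))"
    using continuous_map_compose[OF strip_continuous H] by (simp add: o_def)
  \<comment> \<open>At height \<open>-3/5\<close> both formulas multiply the horizontal coordinates
    by \<open>5/4\<close>: \<open>strip\<close> divides by \<open>sqrt (1 - 9/25)\<close>, and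
    \<open>klein\<close> has the factor \<open>4 / (5 - 9/5)\<close>.\<close>
  have eq1: "H (strip m x) = \<phi>' ((klein m x)(m := 0))" if x: "x \<in> ?S" "x m = -3/5" for x
  proof -
    have xd: "x \<in> disk_set (Suc m)" using x by (simp add: disk_set_split)
    have sq: "sqrt (1 - (x m)\<^sup>2) = 4/5"
      by (rule real_sqrt_unique) (simp_all add: x power2_eq_square)
    have s: "strip m x = (1, (klein m x)(m := 0))"
      unfolding strip_def sq using x by (auto simp: klein_def fun_eq_iff)
    have "klein m x m = 0" using x by (simp add: klein_def)
    then have "(klein m x)(m := 0) \<in> disk_boundary m"
      using sphere_projection(2)[OF kS[OF x(1)]] by blast
    then show ?thesis unfolding s by (rule H1)
  qed
  have eq0: "\<phi> (x(m := 0)) = H (strip m x)" if x: "x \<in> ?S" "x m = 0" for x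
  proof -
    have "strip m x = (0, x(m := 0))"
      using x by (auto simp: strip_def fun_eq_iff disk_boundary_alt)
    then show ?thesis using H0[OF sphere_projection(2)[OF x]] by simp
  qed
  have low: "continuous_map (top_of_set {x \<in> ?S. x m \<le> 0}) T
     (\<lambda>x. if -3/5 \<le> x m then H (strip m x) else \<phi>' ((klein m x)(m := 0)))"
  proof (rule continuous_map_cases_le)
    have "{x \<in> ?S. x m \<le> 0} \<inter> {x. (x \<in> ?S \<and> x m \<le> 0) \<and> -3/5 \<le> x m} = {x \<in> ?S. -3/5 \<le> x m \<and> x m \<le> 0}"
      by auto
    then show "continuous_map (subtopology (top_of_set {x \<in> ?S. x m \<le> 0})
       {x \<in> topspace (top_of_set {x \<in> ?S. x m \<le> 0}). -3/5 \<le> x m}) T (\<lambda>x. H (strip m x))"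
      using mid by (simp add: subtopology_subtopology)
    have "{x \<in> ?S. x m \<le> 0} \<inter> {x. (x \<in> ?S \<and> x m \<le> 0) \<and> x m \<le> -3/5} = {x \<in> ?S. x m \<le> -3/5}"
      by auto
    then show "continuous_map (subtopology (top_of_set {x \<in> ?S. x m \<le> 0})
       {x \<in> topspace (top_of_set {x \<in> ?S. x m \<le> 0}). x m \<le> -3/5}) T (\<lambda>x. \<phi>' ((klein m x)(m := 0)))"
      using lo by (simp add: subtopology_subtopology)
  qed (use eq1 in \<open>auto simp: continuous_on_coord\<close>)
  show ?thesis
  proof (rule continuous_map_cases_le)
    have "?S \<inter> {x \<in> ?S. 0 \<le> x m} = {x \<in> ?S. 0 \<le> x m}" "?S \<inter> {x \<in> ?S. x m \<le> 0} = {x \<in> ?S. x m \<le> 0}"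
      by auto
    then show "continuous_map (subtopology (top_of_set ?S) {x \<in> topspace (top_of_set ?S). 0 \<le> x m}) T
        (\<lambda>x. \<phi> (x(m := 0)))"
      "continuous_map (subtopology (top_of_set ?S) {x \<in> topspace (top_of_set ?S). x m \<le> 0}) T
        (\<lambda>x. if -3/5 \<le> x m then H (strip m x) else \<phi>' ((klein m x)(m := 0)))"
      using up low by (simp_all add: subtopology_subtopology)
  qed (use eq0 in \<open>auto simp: continuous_on_coord\<close>)
qed

text \<open>\<open>Y2\<close> carries both cells, and \<open>Z\<close> has in addition an
  \<open>(m+1)\<close>-cell whose attaching sphere consists of the two cells and the trace of the
  homotopy. Each of the two cells is a free face of it, so \<open>Y\<close> expands to
  \<open>Z\<close>, and \<open>Z\<close> collapses to \<open>Y1\<close>, which is isomorphic to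
  \<open>Y'\<close>. A fresh cell \<open>e1\<close> is used because the new cells of
  \<open>Y\<close> and \<open>Y'\<close> may share points.\<close>

lemma cell_attached_deformation:
  fixes X :: "point cw"
  assumes L: "finite_cw L" and i: "emb L X i" and dim: "cw_dim_le X n" "m \<le> n"
    and a: "cell_attached X Y m e \<phi>" and a': "cell_attached X Y' m e' \<phi>'"
    and room: "\<forall>x\<in>cw_points Y. x 0 < r"
    and H: "continuous_map (prod_topology (top_of_set {0..1::real}) (top_of_set (disk_boundary m))) (cw_space X) H"
    and Hsk: "\<And>s x. s \<in> {0..1::real} \<Longrightarrow> x \<in> disk_boundary m \<Longrightarrow> H (s, x) \<in> skeleton X m"
    and H0: "\<And>x. x \<in> disk_boundary m \<Longrightarrow> H (0, x) = \<phi> x"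
    and H1: "\<And>x. x \<in> disk_boundary m \<Longrightarrow> H (1, x) = \<phi>' x"
  shows "((Y, i), (Y', i)) \<in> deformation (n + 1) L"
proof -
  note A = cell_attachedD[OF a] and A' = cell_attachedD[OF a']
  have mono_sk: "skeleton B m \<subseteq> skeleton C m" if "emb B C (\<lambda>x. x)" for B C :: "point cw"
    using embD(5)[OF that] unfolding skeleton_def by auto
  have b': "continuous_map (top_of_set (disk_boundary m)) (cw_space X) \<phi>'"
    using A'(13) continuous_map_from_subtopology[OF A'(14), of "disk_boundary m"]
    unfolding A'(16) sphere_eq[symmetric] by (auto simp: continuous_map_in_subtopology)
  have cXY: "continuous_map (cw_space X) (cw_space Y) (\<lambda>x. x)" using embD(3)[OF A(7)] .
  have fim: "\<phi>' ` disk_boundary m \<subseteq> (\<Union>k<m. \<Union>(cw_cells Y k))"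
  proof -
    have "cw_cells X k \<subseteq> cw_cells Y k" for k using embD(5)[OF A(7)] by auto
    then have "(\<Union>k<m. \<Union>(cw_cells X k)) \<subseteq> (\<Union>k<m. \<Union>(cw_cells Y k))" by blast
    then show ?thesis by (rule order_trans[OF A'(12)])
  qed
  have fc: "continuous_map (subtopology (disk m) (disk_boundary m)) (cw_space Y) \<phi>'"
    using continuous_map_compose[OF b' cXY] by (simp add: sphere_eq o_def)
  obtain Y2 e1 \<phi>1 where a2: "cell_attached Y Y2 m e1 \<phi>1" and \<phi>1: "\<And>x. x \<in> disk_boundary m \<Longrightarrow> \<phi>1 x = \<phi>' x"
    and room2: "\<forall>x\<in>cw_points Y2. x 0 < r + 1"
    by (rule cell_attached_exists[where X=Y and r=r and m=m and f=\<phi>', OF A(6) room fc fim]) blast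
  note A2 = cell_attachedD[OF a2]
  have XY2: "emb X Y2 (\<lambda>x. x)" using emb_compose[OF A(7) A2(7)] .
  define \<Phi> where "\<Phi> x = (if 0 \<le> x m then \<phi> (x(m := 0)) else if -3/5 \<le> x m then H (strip m x) else \<phi>1 ((klein m x)(m := 0)))" for x
  have "continuous_map (disk m) (cw_space Y2) \<phi>"
    using continuous_map_compose[OF A(14) embD(3)[OF A2(7)]] by (simp add: o_def)
  moreover have "continuous_map (prod_topology (top_of_set {0..1::real}) (top_of_set (disk_boundary m))) (cw_space Y2) H"
    using continuous_map_compose[OF H embD(3)[OF XY2]] by (simp add: o_def)
  ultimately have \<Phi>c: "continuous_map (top_of_set (disk_boundary (Suc m))) (cw_space Y2) \<Phi>"
    unfolding \<Phi>_def using slide_attaching_map[OF _ A2(14), of \<phi> H] H0 H1 \<phi>1 by simp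
  have stripS: "fst (strip m x) \<in> {0..1::real} \<and> snd (strip m x) \<in> disk_boundary m"
    if "x \<in> disk_boundary (Suc m)" "-3/5 \<le> x m" "x m \<le> 0" for x
    using continuous_map_image_subset_topspace[OF strip_continuous[of m]] that
    by (auto simp: image_subset_iff mem_Times_iff)
  have \<phi>sk: "\<phi> ` disk_set m \<subseteq> skeleton Y m"
  proof -
    have "e \<subseteq> skeleton Y m" using A(8) unfolding skeleton_def by blast
    moreover have "(\<Union>k<m. \<Union>(cw_cells X k)) \<subseteq> skeleton X m" unfolding skeleton_def by (intro UN_mono) auto
    ultimately have "e \<union> \<phi> ` disk_boundary m \<subseteq> skeleton Y m"
      using order_trans[OF A(12)] mono_sk[OF A(7)] by (meson Un_least order_trans)
    then show ?thesis using A(11) by (simp add: disk_set_split image_Un)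
  qed
  \<comment> \<open>\<open>Y2\<close> without \<open>e\<close>: the result of the collapse.\<close>
  define Y1 where "Y1 = restrict_cells Y2 ((cw_cells X)(m := insert e1 (cw_cells X m)))"
  have bd1: "\<phi>1 ` disk_boundary m \<subseteq> (\<Union>k<m. \<Union>(cw_cells X k))"
    using A'(12) \<phi>1 by (simp cong: image_cong)
  have XY2c: "cw_cells X k \<subseteq> cw_cells Y2 k" for k using embD(5)[OF XY2] by auto
  have sub12: "subcomplex Y1 Y2"
    unfolding Y1_def
  proof (rule subcomplex_restrict_cells[OF A2(6)])
    show "((cw_cells X)(m := insert e1 (cw_cells X m))) k \<subseteq> cw_cells Y2 k" for k
      using XY2c A2(8) by auto
    fix k c assume c: "c \<in> ((cw_cells X)(m := insert e1 (cw_cells X m))) k"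
    have incl: "(\<Union>l<k. \<Union>(cw_cells X l)) \<subseteq> (\<Union>l<k. \<Union>(((cw_cells X)(m := insert e1 (cw_cells X m))) l))"
      by (intro UN_mono) auto
    show "\<exists>\<psi>. characteristic_map Y2 k c \<psi> \<and> \<psi> ` disk_boundary k \<subseteq> (\<Union>l<k. \<Union>(((cw_cells X)(m := insert e1 (cw_cells X m))) l))"
    proof (cases "c \<in> cw_cells X k")
      case True
      obtain \<psi> where \<psi>: "characteristic_map X k c \<psi>" using cell_characteristic_map[OF A(5) True] by metis
      then have "\<psi> ` disk_boundary k \<subseteq> (\<Union>l<k. \<Union>(cw_cells X l))" by (simp add: characteristic_map_def)
      moreover have "characteristic_map Y2 k c \<psi>"
        using emb_characteristic_map[OF XY2 True \<psi>] by (simp add: o_def)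
      ultimately show ?thesis using order_trans[OF _ incl] by blast
    next
      case False
      then have "k = m" "c = e1" using c by (auto split: if_splits)
      then show ?thesis using A2(4) order_trans[OF bd1 incl[unfolded \<open>k = m\<close>]] by blast
    qed
  qed
  have cY1: "cw_cells Y1 = (cw_cells X)(m := insert e1 (cw_cells X m))"
    by (simp add: Y1_def restrict_cells_def)
  have emb12: "emb Y1 Y2 (\<lambda>x. x)" using sub12 by (simp add: subcomplex_iff_emb)
  have Y1: "finite_cw Y1" using embD(1)[OF emb12] .
  have embX1: "emb X Y1 (\<lambda>x. x)"
    by (rule emb_into_subcomplex[OF sub12 XY2]) (auto simp: cY1)
  have e1new: "e1 \<notin> cw_cells X m" using A2(2) embD(5)[OF A(7)] by auto
  have im1: "\<phi>1 ` disk_set m \<subseteq> cw_points Y1"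
  proof -
    have "e1 \<subseteq> cw_points Y1" by (rule cell_subset_points[OF Y1, of _ m]) (simp add: cY1)
    moreover have "cw_points X \<subseteq> cw_points Y1" using embD(6)[OF embX1] by auto
    moreover have "(\<Union>k<m. \<Union>(cw_cells X k)) \<subseteq> cw_points X" using cell_subset_points[OF A(5)] by blast
    ultimately have "e1 \<union> \<phi>1 ` disk_boundary m \<subseteq> cw_points Y1"
      using order_trans[OF bd1] by (meson Un_least order_trans)
    then show ?thesis using A2(11) by (simp add: disk_set_split image_Un)
  qed
  have ch1: "characteristic_map Y1 m e1 \<phi>1"
  proof (rule characteristic_mapI[OF finite_cw_Hausdorff[OF Y1] _ A2(15) A2(11)])
    have sp: "cw_space Y1 = subtopology (cw_space Y2) (cw_points Y1)" using sub12 by (simp add: subcomplex_def)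
    show "continuous_map (disk m) (cw_space Y1) \<phi>1"
      unfolding sp using A2(14) im1 by (auto simp: continuous_map_in_subtopology)
    have "(\<Union>k<m. \<Union>(cw_cells X k)) \<subseteq> (\<Union>k<m. \<Union>(cw_cells Y1 k))"
      unfolding cY1 by (intro UN_mono) auto
    then show "\<phi>1 ` disk_boundary m \<subseteq> (\<Union>k<m. \<Union>(cw_cells Y1 k))" by (rule order_trans[OF bd1])
    show "\<phi>1 ` disk_boundary m \<inter> e1 = {}" using A2(10,13) by blast
  qed
  have a1: "cell_attached X Y1 m e1 \<phi>1"
    using embX1 e1new ch1 by (simp add: cell_attached_def cY1 subcomplex_iff_emb)
  have \<phi>1sk: "\<phi>1 ` disk_set m \<subseteq> skeleton Y1 m"
  proof -
    have "e1 \<subseteq> skeleton Y1 m" unfolding skeleton_def cY1 by auto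
    moreover have "(\<Union>k<m. \<Union>(cw_cells X k)) \<subseteq> skeleton X m" unfolding skeleton_def by (intro UN_mono) auto
    ultimately have "e1 \<union> \<phi>1 ` disk_boundary m \<subseteq> skeleton Y1 m"
      using order_trans[OF bd1] mono_sk[OF embX1] by (meson Un_least order_trans)
    then show ?thesis using A2(11) by (simp add: disk_set_split image_Un)
  qed
  have kS: "klein m x \<in> disk_boundary (Suc m)" if "x \<in> disk_boundary (Suc m)" for x
    using that klein_boundary_image by blast
  have HX: "H (strip m x) \<in> skeleton X m" if "x \<in> disk_boundary (Suc m)" "-3/5 \<le> x m" "x m \<le> 0" for x
    using stripS[OF that] Hsk[of "fst (strip m x)" "snd (strip m x)"] by simp
  \<comment> \<open>The lower half of the sphere avoids \<open>e\<close>, and the part above the cap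
    avoids \<open>e1\<close>. These are the conditions on the complementary faces in the two
    expansions.\<close>
  have \<Phi>lo: "\<Phi> x \<in> skeleton Y1 m" if x: "x \<in> disk_boundary (Suc m)" "x m \<le> 0" for x
  proof -
    consider "x m = 0" | "x m < 0" "-3/5 \<le> x m" | "x m < -3/5" using x by linarith
    then show ?thesis
    proof cases
      case 1
      have "x(m := 0) \<in> disk_boundary m" using sphere_projection(2)[OF x(1) 1] .
      then have "\<Phi> x = H (0, x(m := 0))" "H (0, x(m := 0)) \<in> skeleton X m"
        using H0 Hsk[of 0] 1 by (auto simp: \<Phi>_def)
      then show ?thesis using mono_sk[OF embX1] by auto
    next
      case 2
      then show ?thesis using HX[OF x(1) 2(2) x(2)] mono_sk[OF embX1] by (auto simp: \<Phi>_def)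
    next
      case 3
      then show ?thesis using \<phi>1sk sphere_projection(1)[OF kS[OF x(1)]] by (auto simp: \<Phi>_def)
    qed
  qed
  have \<Phi>hi: "\<Phi> x \<in> skeleton Y m" if x: "x \<in> disk_boundary (Suc m)" "-3/5 \<le> x m" for x
  proof (cases "0 \<le> x m")
    case True
    then show ?thesis using \<phi>sk sphere_projection(1)[OF x(1)] by (auto simp: \<Phi>_def)
  next
    case False
    then show ?thesis using HX[OF x] x mono_sk[OF A(7)] by (auto simp: \<Phi>_def)
  qed
  have sk12: "skeleton Y1 m \<subseteq> skeleton Y2 m" "skeleton Y m \<subseteq> skeleton Y2 m"
    using mono_sk[OF emb12] mono_sk[OF A2(7)] .
  have \<Phi>im: "\<Phi> ` disk_boundary (Suc m) \<subseteq> (\<Union>k<Suc m. \<Union>(cw_cells Y2 k))"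
  proof -
    have "\<Phi> x \<in> skeleton Y2 m" if "x \<in> disk_boundary (Suc m)" for x
      using \<Phi>lo[OF that] \<Phi>hi[OF that] sk12 by (cases "x m \<le> 0") auto
    then show ?thesis by (auto simp: skeleton_def lessThan_Suc_atMost)
  qed
  obtain Z E \<Psi> where az: "cell_attached Y2 Z (Suc m) E \<Psi>" and \<Psi>: "\<And>x. x \<in> disk_boundary (Suc m) \<Longrightarrow> \<Psi> x = \<Phi> x"
    by (rule cell_attached_exists[where X=Y2 and r="r+1" and m="Suc m" and f=\<Phi>, OF A2(6) room2 \<Phi>c[folded sphere_eq] \<Phi>im]) blast
  note Az = cell_attachedD[OF az]
  have embYZ: "emb Y Z (\<lambda>x. x)" and emb1Z: "emb Y1 Z (\<lambda>x. x)"
    using emb_compose[OF A2(7) Az(7)] emb_compose[OF emb12 Az(7)] by auto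
  have cZ: "cw_cells Z = (cw_cells X)(m := insert e1 (insert e (cw_cells X m)), Suc m := insert E (cw_cells X (Suc m)))"
    unfolding Az(3) A2(3) A(3) by (rule ext) auto
  have ex1: "elementary_expansion m Y1 Z"
    unfolding elementary_expansion_def
  proof (intro conjI exI)
    show "subcomplex Y1 Z" using emb1Z by (simp add: subcomplex_iff_emb)
    show "e \<notin> cw_cells Y1 m" using A(2) A2(2) A(8) by (auto simp: cY1)
    show "E \<notin> cw_cells Y1 (Suc m)" using Az(2) embD(5)[OF emb12] by auto
    show "cw_cells Z = (cw_cells Y1)(m := insert e (cw_cells Y1 m), Suc m := insert E (cw_cells Y1 (Suc m)))"
      unfolding cZ cY1 by (rule ext) auto
    show "characteristic_map Z (Suc m) E \<Psi>" by (rule Az(4))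
    have "characteristic_map Z m e \<phi>"
      using emb_characteristic_map[OF embYZ A(8) A(4)] by (simp add: o_def)
    moreover have "(\<Psi> \<circ> upper_hemisphere_map m) y = \<phi> y" if "y \<in> disk_set m" for y
      using upper_hemisphere_map_props[OF that] \<Psi> by (simp add: \<Phi>_def)
    ultimately show "characteristic_map Z m e (\<Psi> \<circ> upper_hemisphere_map m)"
      using characteristic_map_cong[OF Az(6)] by (auto simp: cZ)
    show "\<Psi> ` lower_hemisphere m \<subseteq> skeleton Y1 m"
      using \<Phi>lo \<Psi> by (auto simp: lower_hemisphere_def)
  qed
  \<comment> \<open>The half-turn carries the upper hemisphere to the cap, so that \<open>e1\<close>
    becomes the free face, and the lower hemisphere to the part of the sphere above the cap.\<close>
  have ex2: "elementary_expansion m Y Z"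
    unfolding elementary_expansion_def
  proof (intro conjI exI)
    show "subcomplex Y Z" using embYZ by (simp add: subcomplex_iff_emb)
    show "e1 \<notin> cw_cells Y m" by (rule A2(2))
    show "E \<notin> cw_cells Y (Suc m)" using Az(2) embD(5)[OF A2(7)] by auto
    show "cw_cells Z = (cw_cells Y)(m := insert e1 (cw_cells Y m), Suc m := insert E (cw_cells Y (Suc m)))"
      unfolding cZ A(3) by (rule ext) auto
    show "characteristic_map Z (Suc m) E (\<Psi> \<circ> klein m)" by (rule characteristic_map_klein[OF Az(6,8,4)])
    have "characteristic_map Z m e1 \<phi>1"
      using emb_characteristic_map[OF Az(7) A2(8) A2(4)] by (simp add: o_def)
    moreover have "(\<Psi> \<circ> klein m \<circ> upper_hemisphere_map m) y = \<phi>1 y" if y: "y \<in> disk_set m" for y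
    proof -
      let ?u = "upper_hemisphere_map m y"
      note u = upper_hemisphere_map_props[OF y]
      have ud: "?u \<in> disk_set (Suc m)" using u(1) by (simp add: disk_set_split)
      have kd: "klein m ?u \<in> disk_boundary (Suc m)" by (rule kS[OF u(1)])
      then have kd': "klein m ?u \<in> disk_set (Suc m)" by (simp add: disk_set_split)
      have h: "klein m ?u m \<le> -3/5"
        using klein_height(1)[OF kd'] u(2) by (simp add: klein_klein[OF ud])
      \<comment> \<open>On the rim the definition of \<open>\<Phi>\<close> selects the homotopy,
        which has reached time 1 there.\<close>
      have "\<Phi> (klein m ?u) = \<phi>1 y"
      proof (cases "klein m ?u m = -3/5")
        case True
        then have "?u m = 0" using klein_klein[OF ud, THEN fun_cong, of m] by (simp add: klein_def[of m "klein m ?u"])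
        then have yb: "y \<in> disk_boundary m" using sphere_projection(2)[OF u(1)] u(3) by simp
        have sq: "sqrt (1 - (klein m ?u m)\<^sup>2) = 4/5"
          by (rule real_sqrt_unique) (simp_all add: True power2_eq_square)
        have "klein m ?u i / (4/5) = y i" if "i < m" for i
          using that \<open>?u m = 0\<close> by (simp add: klein_def upper_hemisphere_map_def)
        then have "strip m (klein m ?u) = (1, y)"
          unfolding strip_def sq using True y by (auto simp: fun_eq_iff disk_set_alt)
        then show ?thesis using True H1[OF yb] \<phi>1[OF yb] by (simp add: \<Phi>_def)
      next
        case False
        then show ?thesis using h u(3) by (simp add: \<Phi>_def klein_klein[OF ud])
      qed
      then show ?thesis using \<Psi>[OF kd] by simp
    qed
    ultimately show "characteristic_map Z m e1 (\<Psi> \<circ> klein m \<circ> upper_hemisphere_map m)"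
      using characteristic_map_cong[OF Az(6)] by (auto simp: cZ)
    show "(\<Psi> \<circ> klein m) ` lower_hemisphere m \<subseteq> skeleton Y m"
    proof clarsimp
      fix x assume "x \<in> lower_hemisphere m"
      then have x: "x \<in> disk_boundary (Suc m)" "x m \<le> 0" by (auto simp: lower_hemisphere_def)
      then have "klein m x m \<ge> -3/5" using klein_height(3)[of x m] by (simp add: disk_set_split)
      then show "\<Psi> (klein m x) \<in> skeleton Y m" using \<Phi>hi[OF kS[OF x(1)]] \<Psi>[OF kS[OF x(1)]] by simp
    qed
  qed
  have iY: "emb L Y i" "emb L Y1 i" "emb L Z i" "emb L Y' i"
    using emb_compose[OF i A(7)] emb_compose[OF i embX1] emb_compose[OF emb_compose[OF i A(7)] embYZ]
      emb_compose[OF i A'(7)] by simp_all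
  have dimX': "cw_dim_le X (n + 1)" using dim by (simp add: cw_dim_le_def)
  have m: "m \<le> n + 1" using dim by simp
  have c: "(Y, i) \<in> complexes_over (n + 1) L" "(Y1, i) \<in> complexes_over (n + 1) L" "(Z, i) \<in> complexes_over (n + 1) L"
    "(Y', i) \<in> complexes_over (n + 1) L"
    unfolding complexes_over_iff[OF L]
    using iY cell_attached_dim_le[OF a dimX' m] cell_attached_dim_le[OF a1 dimX' m] cell_attached_dim_le[OF a' dimX' m]
      cell_attached_dim_le[OF az] cell_attached_dim_le[OF a2 _ m] dim by auto
  have "((Y, i), (Z, i)) \<in> deformation (n + 1) L"
    using expansion_deformation(1)[OF c(1,3) ex2] dim by simp
  moreover have "((Z, i), (Y1, i)) \<in> deformation (n + 1) L"
    using expansion_deformation(2)[OF c(2,3) ex1] dim by simp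
  moreover have "((Y1, i), (Y', i)) \<in> deformation (n + 1) L"
  proof -
    obtain h where "cw_isomorphism Y1 Y' h" "\<And>x. x \<in> cw_points X \<Longrightarrow> h x = x"
      using cell_attached_unique[OF a1 a' emb_id[OF A(5)]] \<phi>1 by auto
    then show ?thesis
      using isomorphism_deformation[OF c(2,4)] embD(6)[OF i] by metis
  qed
  ultimately show ?thesis by (meson deformation_trans)
qed

section \<open>Homotopies of a space with one distinguished cell\<close>

text \<open>Continuity on the product of the interval with \<open>T\<close> is checked on its
  products with the two compact pieces. The lemma serves both for pushing radially inside a cell and
  for collapsing a cell from its free face.\<close>

lemma homotopy_out_of_two_pieces:
  fixes T :: "'a topology" and \<phi> :: "(nat \<Rightarrow> real) \<Rightarrow> 'a" and b :: "real \<times> (nat \<Rightarrow> real) \<Rightarrow> 'a"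
  assumes T: "Hausdorff_space T" "compact_space T" and X0: "closedin T X0"
    and \<phi>: "continuous_map (disk k) T \<phi>" and cover: "topspace T = X0 \<union> \<phi> ` disk_set k"
    and b: "continuous_map (prod_topology (top_of_set {0..1}) (disk k)) T b"
    and c1: "\<And>s x. s \<in> {0..1} \<Longrightarrow> x \<in> disk_set k \<Longrightarrow> \<phi> x \<in> X0 \<Longrightarrow> b (s, x) = \<phi> x"
    and c2: "\<And>s x y. s \<in> {0..1} \<Longrightarrow> x \<in> disk_set k \<Longrightarrow> y \<in> disk_set k \<Longrightarrow> \<phi> x = \<phi> y \<Longrightarrow> \<phi> x \<notin> X0 \<Longrightarrow>
       b (s, x) = b (s, y)"
  obtains H where "continuous_map (prod_topology (top_of_set {0..1}) T) T H"
    "\<And>s u. s \<in> {0..1} \<Longrightarrow> u \<in> X0 \<Longrightarrow> H (s, u) = u"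
    "\<And>s x. s \<in> {0..1} \<Longrightarrow> x \<in> disk_set k \<Longrightarrow> H (s, \<phi> x) = b (s, x)"
proof -
  let ?I = "top_of_set {0..1::real}"
  \<comment> \<open>The preimage under \<open>\<phi>\<close> is chosen arbitrarily; by
    \<open>c2\<close> the value does not depend on the choice.\<close>
  define H where "H z = (if snd z \<in> X0 then snd z else b (fst z, SOME x. x \<in> disk_set k \<and> \<phi> x = snd z))" for z
  have HX: "H (s, u) = u" if "u \<in> X0" for s u using that by (simp add: H_def)
  have H\<phi>: "H (s, \<phi> x) = b (s, x)" if s: "s \<in> {0..1}" and x: "x \<in> disk_set k" for s x
  proof (cases "\<phi> x \<in> X0")
    case True
    then show ?thesis using c1[OF s x] by (simp add: H_def)
  next
    case False
    have "(SOME y. y \<in> disk_set k \<and> \<phi> y = \<phi> x) \<in> disk_set k \<and> \<phi> (SOME y. y \<in> disk_set k \<and> \<phi> y = \<phi> x) = \<phi> x"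
      by (rule someI[of "\<lambda>y. y \<in> disk_set k \<and> \<phi> y = \<phi> x" x]) (use x in simp)
    then have "b (s, SOME y. y \<in> disk_set k \<and> \<phi> y = \<phi> x) = b (s, x)"
      using c2[OF s _ x] False by metis
    then show ?thesis using False by (simp add: H_def)
  qed
  have X0s: "X0 \<subseteq> topspace T" using X0 closedin_subset by blast
  have "compact_space (subtopology T X0)"
    using closedin_compact_space[OF T(2) X0] by (simp add: compact_space_subtopology)
  moreover have I: "compact_space ?I" by (simp add: compact_space_subtopology)
  ultimately have cX: "compact_space (prod_topology ?I (subtopology T X0))" and cD: "compact_space (prod_topology ?I (disk k))"
    by (simp_all add: compact_space_prod_topology)
  have "Hausdorff_space ?I" by (simp add: Hausdorff_space_subtopology)
  then have hT: "Hausdorff_space (prod_topology ?I T)"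
    using T(1) by (simp add: Hausdorff_space_prod_topology)
  have sX: "continuous_map (prod_topology ?I (subtopology T X0)) T snd"
    using continuous_map_snd[of ?I "subtopology T X0"] by (simp add: continuous_map_in_subtopology)
  have p: "continuous_map (prod_topology ?I (subtopology T X0)) (prod_topology ?I T) (\<lambda>z. (fst z, snd z))"
    unfolding continuous_map_paired using sX continuous_map_fst by blast
  have q: "continuous_map (prod_topology ?I (disk k)) (prod_topology ?I T) (\<lambda>z. (fst z, \<phi> (snd z)))"
    using continuous_map_compose[OF continuous_map_snd \<phi>, of ?I]
    by (simp add: continuous_map_paired continuous_map_fst o_def)
  have "continuous_map (prod_topology ?I T) T H"
  proof (rule continuous_map_out_of_two_pieces[OF hT cX cD p q])
    show "topspace (prod_topology ?I T) \<subseteq> (\<lambda>z. (fst z, snd z)) ` topspace (prod_topology ?I (subtopology T X0)) \<union>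
        (\<lambda>z. (fst z, \<phi> (snd z))) ` topspace (prod_topology ?I (disk k))"
      using X0s cover by (force simp: image_iff)
    show "continuous_map (prod_topology ?I (subtopology T X0)) T (\<lambda>z. H (fst z, snd z))"
      by (rule continuous_map_eq[OF sX]) (auto simp: HX)
    show "continuous_map (prod_topology ?I (disk k)) T (\<lambda>z. H (fst z, \<phi> (snd z)))"
      by (rule continuous_map_eq[OF b]) (auto simp: H\<phi>)
  qed
  then show thesis using that HX H\<phi> by blast
qed

lemma homotopic_with_invariant_set:
  assumes H: "continuous_map (prod_topology (top_of_set {0..1::real}) T) T H"
    and H0: "\<And>u. u \<in> topspace T \<Longrightarrow> H (0, u) = u" and W: "W \<subseteq> topspace T"
    and inv: "\<And>s u. s \<in> {0..1} \<Longrightarrow> u \<in> W \<Longrightarrow> H (s, u) \<in> W"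
  shows "homotopic_with (\<lambda>h. h \<in> W \<rightarrow> W) T T (\<lambda>u. H (1, u)) id"
proof -
  have "homotopic_with (\<lambda>h. h \<in> W \<rightarrow> W) T T id (\<lambda>u. H (1, u))"
  proof (subst homotopic_with)
    show "(h \<in> W \<rightarrow> W) = (k \<in> W \<rightarrow> W)" if "\<And>x. x \<in> topspace T \<Longrightarrow> h x = k x" for h k
      using that W by (auto simp: Pi_iff subset_iff)
    show "\<exists>h. continuous_map (prod_topology (subtopology euclideanreal {0..1}) T) T h \<and>
        (\<forall>x\<in>topspace T. h (0, x) = id x) \<and> (\<forall>x\<in>topspace T. h (1, x) = H (1, x)) \<and>
        (\<forall>t\<in>{0..1}. (\<lambda>x. h (t, x)) \<in> W \<rightarrow> W)"
      using H H0 inv by (intro exI[of _ H]) auto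
  qed
  then show ?thesis by (rule homotopic_with_symD)
qed

lemma continuous_map_slice:
  assumes "continuous_map (prod_topology (top_of_set {0..1}) T) T' H" "s \<in> {0..1::real}"
  shows "continuous_map T T' (\<lambda>u. H (s, u))"
proof -
  have "continuous_map T (prod_topology (top_of_set {0..1}) T) (\<lambda>u. (s, u))"
    using assms(2) by (simp add: continuous_map_paired)
  then show ?thesis using continuous_map_compose[OF _ assms(1)] by (simp add: o_def)
qed

text \<open>What remains of \<open>cell_attached\<close> when \<open>X0\<close> carries no cell
  structure; the disk with its sphere and the circle with a base point are instances.\<close>

definition cell_pair :: "'a topology \<Rightarrow> 'a set \<Rightarrow> nat \<Rightarrow> ((nat \<Rightarrow> real) \<Rightarrow> 'a) \<Rightarrow> bool" where
  "cell_pair T X0 m \<phi> \<longleftrightarrow> Hausdorff_space T \<and> compact_space T \<and> closedin T X0 \<and>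
     continuous_map (disk m) T \<phi> \<and> inj_on \<phi> (disk_interior m) \<and> \<phi> ` disk_interior m \<inter> X0 = {} \<and>
     \<phi> ` disk_boundary m \<subseteq> X0 \<and> topspace T = X0 \<union> \<phi> ` disk_set m"

lemma cell_pairD:
  assumes "cell_pair T X0 m \<phi>"
  shows "Hausdorff_space T" "compact_space T" "closedin T X0" "continuous_map (disk m) T \<phi>"
    "inj_on \<phi> (disk_interior m)" "\<phi> ` disk_interior m \<inter> X0 = {}" "\<phi> ` disk_boundary m \<subseteq> X0"
    "topspace T = X0 \<union> \<phi> ` disk_set m"
  using assms unfolding cell_pair_def by blast+

lemma cell_pair_fibre:
  assumes c: "cell_pair T X0 m \<phi>" and x: "x \<in> disk_set m"
  shows "\<phi> x \<in> X0 \<longleftrightarrow> x \<in> disk_boundary m"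
    "y \<in> disk_set m \<Longrightarrow> \<phi> x = \<phi> y \<Longrightarrow> \<phi> x \<notin> X0 \<Longrightarrow> x = y"
proof -
  have *: "\<phi> x \<in> X0 \<longleftrightarrow> x \<in> disk_boundary m" if "x \<in> disk_set m" for x
    using cell_pairD(6,7)[OF c] that unfolding disk_set_split by blast
  from * x show "\<phi> x \<in> X0 \<longleftrightarrow> x \<in> disk_boundary m" .
  show "x = y" if "y \<in> disk_set m" "\<phi> x = \<phi> y" "\<phi> x \<notin> X0"
  proof -
    have "x \<in> disk_interior m" "y \<in> disk_interior m"
      using *[OF x] *[OF that(1)] that x by (auto simp: disk_set_split)
    then show ?thesis using inj_onD[OF cell_pairD(5)[OF c]] that(2) by blast
  qed
qed

lemma cell_pair_attached:
  assumes a: "cell_attached X Y m e \<phi>"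
  shows "cell_pair (cw_space Y) (cw_points X) m \<phi>"
proof -
  note A = cell_attachedD[OF a]
  have "compactin (cw_space Y) (cw_points X)"
    using image_compactin[OF _ embD(3)[OF A(7)], of "topspace (cw_space X)"] finite_cw_compact[OF A(5)]
    by (simp add: compact_space_def cw_points_def)
  then have "closedin (cw_space Y) (cw_points X)"
    using compactin_imp_closedin finite_cw_Hausdorff[OF A(6)] by blast
  then show ?thesis
    unfolding cell_pair_def using A(10,11,13,14,15) finite_cw_Hausdorff[OF A(6)] finite_cw_compact[OF A(6)]
      cell_attached_points[OF a] by (auto simp: cw_points_def)
qed

lemma cell_pair_disk: "cell_pair (disk m) (disk_boundary m) m id"
  unfolding cell_pair_def using disk_interior_boundary_disjoint closedin_disk_boundary
  by (auto simp: disk_set_split)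

section \<open>The relative homology of a cell\<close>

text \<open>The collar of radii at least \<open>1/2\<close>. Its image together with
  \<open>X0\<close> is a neighbourhood of \<open>X0\<close> that can be pushed into
  \<open>X0\<close>.\<close>

definition outer_disk :: "nat \<Rightarrow> (nat \<Rightarrow> real) set" where
  "outer_disk m = {x \<in> disk_set m. 1/4 \<le> (\<Sum>i<m. (x i)\<^sup>2)}"

text \<open>At time 1 a point is divided by the larger of \<open>1/2\<close> and its norm: the
  collar goes to the sphere, and the ball of radius \<open>1/2\<close> is stretched over the whole
  disk.\<close>

definition radial :: "nat \<Rightarrow> real \<times> (nat \<Rightarrow> real) \<Rightarrow> (nat \<Rightarrow> real)" where
  "radial m z = (\<lambda>i. ((1 - fst z) + fst z / max (1/2) (sqrt (\<Sum>i<m. (snd z i)\<^sup>2))) * snd z i)"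

lemma radial_props:
  assumes s: "s \<in> {0..1}" and x: "x \<in> disk_set m"
  shows "radial m (s, x) \<in> disk_set m" "x \<in> outer_disk m \<Longrightarrow> radial m (s, x) \<in> outer_disk m"
    "x \<in> outer_disk m \<Longrightarrow> radial m (1, x) \<in> disk_boundary m"
    "x \<in> disk_boundary m \<Longrightarrow> radial m (s, x) = x" "radial m (0, x) = x"
proof -
  define r where "r = sqrt (\<Sum>i<m. (x i)\<^sup>2)"
  define M where "M = max (1/2) r"
  have Q: "(\<Sum>i<m. (x i)\<^sup>2) = r\<^sup>2" by (simp add: r_def sum_nonneg)
  have r: "0 \<le> r" "r \<le> 1" using x by (auto simp: r_def disk_set_alt sum_nonneg)
  have M: "M > 0" "r \<le> M" "M \<le> 1" using r by (auto simp: M_def)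
  have g: "radial m (s, x) = (\<lambda>i. ((1 - s) + s / M) * x i)" for s
    by (simp add: radial_def M_def r_def)
  have norm: "(\<Sum>i<m. (radial m (s, x) i)\<^sup>2) = ((1 - s) * r + s * (r / M))\<^sup>2" for s
  proof -
    have "(\<Sum>i<m. (radial m (s, x) i)\<^sup>2) = ((1 - s) + s / M)\<^sup>2 * (\<Sum>i<m. (x i)\<^sup>2)"
      by (simp add: g power_mult_distrib sum_distrib_left)
    also have "\<dots> = (((1 - s) + s / M) * r)\<^sup>2" by (simp add: Q power_mult_distrib)
    finally show ?thesis by (simp add: algebra_simps)
  qed
  have rM: "0 \<le> r / M" "r / M \<le> 1" using r M by auto
  have le1: "(1 - s) * r + s * (r / M) \<le> 1"
    using convex_bound_le[of r 1 "r / M" "1 - s" s] r rM s by simp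
  have ge0: "0 \<le> (1 - s) * r + s * (r / M)" using r(1) rM(1) s by (intro add_nonneg_nonneg mult_nonneg_nonneg) auto
  have z: "radial m (s, x) i = 0" if "i \<ge> m" for i s using x that by (simp add: g disk_set_alt)
  show d: "radial m (s, x) \<in> disk_set m"
    using le1 ge0 z norm[of s] power_le_one[OF ge0 le1, of 2] unfolding disk_set_alt by simp
  have outer: "r \<ge> 1/2 \<and> M = r" if "x \<in> outer_disk m"
  proof -
    have "(1/2)\<^sup>2 \<le> r\<^sup>2" using that Q by (simp add: outer_disk_def power2_eq_square)
    then have "1/2 \<le> r" using r(1) power2_le_imp_le by blast
    then show ?thesis by (simp add: M_def)
  qed
  show "radial m (s, x) \<in> outer_disk m" if "x \<in> outer_disk m"
  proof -
    have h: "r \<ge> 1/2" "M = r" using outer[OF that] by auto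
    then have "(1 - s) * r + s * (r / M) = (1 - s) * r + s" by simp
    moreover have "(1 - s) * r + s \<ge> 1/2"
      using convex_bound_le[of "- r" "- (1/2)" "-1" "1 - s" s] h s by simp
    ultimately have "(1/2)\<^sup>2 \<le> ((1 - s) * r + s * (r / M))\<^sup>2" by (intro power_mono) auto
    then have "1/4 \<le> (\<Sum>i<m. (radial m (s, x) i)\<^sup>2)" unfolding norm by (simp add: power2_eq_square)
    then show ?thesis using d by (simp add: outer_disk_def)
  qed
  show "radial m (1, x) \<in> disk_boundary m" if "x \<in> outer_disk m"
  proof -
    have "r \<noteq> 0" "M = r" using outer[OF that] by auto
    then have "(\<Sum>i<m. (radial m (1, x) i)\<^sup>2) = 1" unfolding norm by simp
    then show ?thesis using z by (simp add: disk_boundary_alt)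
  qed
  show "radial m (0, x) = x" by (simp add: g)
  show "radial m (s, x) = x" if "x \<in> disk_boundary m"
  proof -
    have "r = 1" using that by (simp add: disk_boundary_alt r_def)
    then show ?thesis by (simp add: g M_def)
  qed
qed

lemma continuous_map_radial:
  "continuous_map (prod_topology (top_of_set {0..1}) (disk m)) (disk m) (radial m)"
proof -
  have "continuous_on ({0..1} \<times> disk_set m) (radial m)"
  proof (rule continuous_on_coordinatewise_then_product)
    fix i
    have c: "continuous_on A (\<lambda>z::real \<times> (nat \<Rightarrow> real). snd z j)" for j A
      using continuous_on_compose2[OF continuous_on_coord[of UNIV j] continuous_on_snd[OF continuous_on_id]] by auto
    show "continuous_on ({0..1} \<times> disk_set m) (\<lambda>z. radial m z i)"
      unfolding radial_def by (intro continuous_intros c) auto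
  qed
  then show ?thesis
    using radial_props(1) by (auto simp: disk_eq)
qed

text \<open>The radial push moves the enlarged subspace into \<open>X0\<close> and is homotopic to
  the identity through maps that preserve either subspace, so it induces an inverse of the
  inclusion.\<close>

lemma radial_push_iso:
  assumes c: "cell_pair T X0 m \<phi>"
  shows "hom_induced p T X0 T (X0 \<union> \<phi> ` outer_disk m) id
    \<in> iso (relative_homology_group p T X0) (relative_homology_group p T (X0 \<union> \<phi> ` outer_disk m))"
proof -
  note C = cell_pairD[OF c]
  let ?N = "X0 \<union> \<phi> ` outer_disk m"
  have b: "continuous_map (prod_topology (top_of_set {0..1}) (disk m)) T (\<lambda>z. \<phi> (radial m z))"
    using continuous_map_compose[OF continuous_map_radial C(4)] by (simp add: o_def)
  have c1: "\<phi> (radial m (s, x)) = \<phi> x" if "s \<in> {0..1}" "x \<in> disk_set m" "\<phi> x \<in> X0" for s x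
    using radial_props(4)[OF that(1,2)] cell_pair_fibre(1)[OF c that(2)] that(3) by simp
  have c2: "\<phi> (radial m (s, x)) = \<phi> (radial m (s, y))"
    if "s \<in> {0..1}" "x \<in> disk_set m" "y \<in> disk_set m" "\<phi> x = \<phi> y" "\<phi> x \<notin> X0" for s x y
    using cell_pair_fibre(2)[OF c that(2-5)] by simp
  obtain H where H: "continuous_map (prod_topology (top_of_set {0..1}) T) T H"
    "\<And>s u. s \<in> {0..1} \<Longrightarrow> u \<in> X0 \<Longrightarrow> H (s, u) = u"
    "\<And>s x. s \<in> {0..1} \<Longrightarrow> x \<in> disk_set m \<Longrightarrow> H (s, \<phi> x) = \<phi> (radial m (s, x))"
    by (rule homotopy_out_of_two_pieces[OF C(1,2,3,4,8) b]) (use c1 c2 in \<open>blast+\<close>)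
  have X0: "X0 \<subseteq> topspace T" and outer: "outer_disk m \<subseteq> disk_set m"
    using C(8) by (auto simp: outer_disk_def)
  then have N: "?N \<subseteq> topspace T" using C(8) by blast
  have H0: "H (0, u) = u" if "u \<in> topspace T" for u
  proof -
    consider "u \<in> X0" | x where "x \<in> disk_set m" "u = \<phi> x" using \<open>u \<in> topspace T\<close> C(8) by blast
    then show ?thesis using H radial_props(5)[of 0] by cases auto
  qed
  have h1: "homotopic_with (\<lambda>h. h \<in> X0 \<rightarrow> X0) T T (\<lambda>u. H (1, u)) id"
    using homotopic_with_invariant_set[OF H(1) H0 X0] H(2) by simp
  have h2: "homotopic_with (\<lambda>h. h \<in> ?N \<rightarrow> ?N) T T (\<lambda>u. H (1, u)) id"
  proof (rule homotopic_with_invariant_set[OF H(1) H0 N])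
    fix s :: real and u assume s: "s \<in> {0..1}" and "u \<in> ?N"
    then consider "u \<in> X0" | x where "x \<in> outer_disk m" "u = \<phi> x" by blast
    then show "H (s, u) \<in> ?N"
    proof cases
      case 2
      then have "H (s, u) = \<phi> (radial m (s, x))" using H(3)[OF s] outer by blast
      then show ?thesis using radial_props(2)[OF s, of x m] 2 outer by blast
    qed (use H(2)[OF s] in auto)
  qed
  have into: "(\<lambda>u. H (1, u)) \<in> ?N \<rightarrow> X0"
  proof (rule Pi_I)
    fix u assume "u \<in> ?N"
    then consider "u \<in> X0" | x where "x \<in> outer_disk m" "u = \<phi> x" by blast
    then show "H (1, u) \<in> X0"
    proof cases
      case 2
      then have "H (1, u) = \<phi> (radial m (1, x))" using H(3)[of 1] outer by auto
      then show ?thesis using radial_props(3)[of 1 x m] 2 outer C(7) by auto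
    qed (use H(2)[of 1] in auto)
  qed
  have cont: "continuous_map T T (\<lambda>u. H (1, u))" using continuous_map_slice[OF H(1)] by simp
  have h1': "homotopic_with (\<lambda>h. h \<in> X0 \<rightarrow> X0) T T ((\<lambda>u. H (1, u)) \<circ> id) id" using h1 by simp
  have h2': "homotopic_with (\<lambda>h. h \<in> ?N \<rightarrow> ?N) T T (id \<circ> (\<lambda>u. H (1, u))) id" using h2 by (simp add: id_def o_def)
  show ?thesis
    by (rule homotopy_equivalence_relative_homology_group_isomorphism[OF continuous_map_id _ cont into h1' h2']) auto
qed

lemma cell_pair_homeomorphic_map:
  assumes c: "cell_pair T X0 m \<phi>"
  shows "homeomorphic_map (subtopology (disk m) (disk_set m - disk_boundary m)) (subtopology T (topspace T - X0)) \<phi>"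
proof -
  note C = cell_pairD[OF c]
  have diff: "disk_set m - disk_boundary m = disk_interior m"
    using disk_interior_boundary_disjoint by (auto simp: disk_set_split)
  have im: "\<phi> ` disk_interior m = topspace T - X0"
    using C(6,7,8) by (auto simp: disk_set_split)
  have cl: "closed_map (disk m) T \<phi>"
    using T1_Spaces.continuous_imp_closed_map[OF C(4)] C(1) by simp
  have "{x \<in> topspace (disk m). \<phi> x \<in> topspace T - X0} = disk_interior m"
    using im C(7) by (auto simp: disk_set_split)
  then have "closed_map (subtopology (disk m) (disk_interior m)) (subtopology T (topspace T - X0)) \<phi>"
    using cl closed_map_restriction by blast
  moreover have "continuous_map (subtopology (disk m) (disk_interior m)) (subtopology T (topspace T - X0)) \<phi>"
    using C(4) im by (auto simp: continuous_map_in_subtopology continuous_map_from_subtopology)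
  moreover have "disk_set m \<inter> disk_interior m = disk_interior m" by (auto simp: disk_set_split)
  ultimately show ?thesis
    unfolding diff using im C(5) by (intro bijective_closed_imp_homeomorphic_map) auto
qed

text \<open>Excision of \<open>X0\<close> is possible since the complement of the image of the ball
  of radius \<open>1/2\<close> is an open set between \<open>X0\<close> and the enlarged
  subspace.\<close>

lemma cell_pair_excision_iso:
  assumes c: "cell_pair T X0 m \<phi>"
  shows "hom_induced p (subtopology T (topspace T - X0)) ((X0 \<union> \<phi> ` outer_disk m) - X0) T (X0 \<union> \<phi> ` outer_disk m) id
    \<in> iso (relative_homology_group p (subtopology T (topspace T - X0)) ((X0 \<union> \<phi> ` outer_disk m) - X0))
          (relative_homology_group p T (X0 \<union> \<phi> ` outer_disk m))"
proof -
  note C = cell_pairD[OF c]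
  let ?N = "X0 \<union> \<phi> ` outer_disk m"
  let ?B = "{x \<in> disk_set m. (\<Sum>i<m. (x i)\<^sup>2) \<le> 1/4}"
  have "closed {x::nat\<Rightarrow>real. (\<Sum>i<m. (x i)\<^sup>2) \<le> 1/4}"
    by (intro closed_Collect_le continuous_intros)
  moreover have "?B = disk_set m \<inter> {x. (\<Sum>i<m. (x i)\<^sup>2) \<le> 1/4}" by auto
  ultimately have "closedin (disk m) ?B" by (simp add: disk_eq closedin_closed_Int)
  then have "compactin T (\<phi> ` ?B)"
    using closedin_compact_space[OF compact_space_disk] image_compactin C(4) by blast
  then have clB: "closedin T (\<phi> ` ?B)" using compactin_imp_closedin C(1) by blast
  let ?V = "topspace T - \<phi> ` ?B"
  have "openin T ?V" using clB by blast
  moreover have "?V \<subseteq> ?N"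
  proof
    fix u assume u: "u \<in> ?V"
    show "u \<in> ?N"
    proof (cases "u \<in> X0")
      case False
      then obtain x where x: "x \<in> disk_set m" "u = \<phi> x" using u C(8) by blast
      then have "x \<notin> ?B" using u by blast
      then have "x \<in> outer_disk m" using x(1) by (simp add: outer_disk_def)
      then show ?thesis using x(2) by blast
    qed simp
  qed
  moreover have "X0 \<subseteq> ?V"
  proof
    fix u assume u: "u \<in> X0"
    have "u \<noteq> \<phi> x" if "x \<in> ?B" for x
      using u cell_pair_fibre(1)[OF c, of x] that by (auto simp: disk_boundary_alt)
    then show "u \<in> ?V" using u C(8) by blast
  qed
  ultimately have "X0 \<subseteq> T interior_of ?N" by (meson interior_of_maximal order_trans)
  then have "T closure_of X0 \<subseteq> T interior_of ?N" using C(3) closure_of_closedin by metis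
  moreover have "?N \<subseteq> topspace T" using C(8) by (auto simp: outer_disk_def)
  ultimately show ?thesis
    using homology_excision_axiom[of T X0 ?N "topspace T" p] by simp
qed

lemma bij_betw_left_factor:
  assumes "bij_betw a A B" "bij_betw g A C" "\<And>x. x \<in> A \<Longrightarrow> g x = f (a x)"
  shows "bij_betw f B C"
proof -
  have "bij_betw (f \<circ> a) A C"
    using assms(2,3) bij_betw_cong[of A g "f \<circ> a" C] by simp
  then show ?thesis using assms(1) bij_betw_comp_iff by blast
qed

lemma bij_betw_right_factor:
  assumes b: "bij_betw b B C" and g: "bij_betw g A C" and gf: "\<And>x. x \<in> A \<Longrightarrow> g x = b (f x)" and f: "f ` A \<subseteq> B"
  shows "bij_betw f A B"
proof -
  have "bij_betw (b \<circ> f) A C"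
    using g gf bij_betw_cong[of A g "b \<circ> f" C] by simp
  then show ?thesis using b f bij_betw_comp_iff2 by blast
qed

text \<open>\<open>X0\<close> is enlarged by the collar and then excised; what is left is the open
  cell, homeomorphic to the open disk by \<open>\<phi>\<close>. The same two moves for the disk and
  its sphere form the other side of a ladder, whose squares commute because its rungs are all
  induced by \<open>\<phi>\<close>.\<close>

theorem relative_homology_cell_iso:
  assumes c: "cell_pair T X0 m \<phi>"
  shows "hom_induced p (disk m) (disk_boundary m) T X0 \<phi>
    \<in> iso (relative_homology_group p (disk m) (disk_boundary m)) (relative_homology_group p T X0)"
proof -
  note C = cell_pairD[OF c]
  let ?D = "disk m" and ?S = "disk_boundary m" and ?O = "outer_disk m" and ?N = "X0 \<union> \<phi> ` outer_disk m"
  have SO: "?S \<subseteq> ?O" by (auto simp: outer_disk_def disk_boundary_alt disk_set_alt)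
  then have SN: "?S \<union> id ` ?O = ?O" by auto
  have OD: "?O \<subseteq> disk_set m" by (auto simp: outer_disk_def)
  let ?D' = "subtopology ?D (disk_set m - ?S)" and ?T' = "subtopology T (topspace T - X0)"
  have a1: "hom_induced p ?D ?S ?D ?O id \<in> iso (relative_homology_group p ?D ?S) (relative_homology_group p ?D ?O)"
    using radial_push_iso[OF cell_pair_disk[of m], of p] unfolding SN .
  have a2: "hom_induced p ?D' (?O - ?S) ?D ?O id \<in> iso (relative_homology_group p ?D' (?O - ?S)) (relative_homology_group p ?D ?O)"
    using cell_pair_excision_iso[OF cell_pair_disk[of m], of p] unfolding SN topspace_disk .
  note b1 = radial_push_iso[OF c, of p] and b2 = cell_pair_excision_iso[OF c, of p]
  have im: "\<phi> ` (?O - ?S) = ?N - X0"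
    using cell_pair_fibre(1)[OF c] OD by blast
  have "?O - ?S \<subseteq> topspace ?D'" using OD by auto
  then have c1: "hom_induced p ?D' (?O - ?S) ?T' (?N - X0) \<phi>
      \<in> iso (relative_homology_group p ?D' (?O - ?S)) (relative_homology_group p ?T' (?N - X0))"
    using homeomorphic_map_relative_homology_iso[OF cell_pair_homeomorphic_map[OF c]] im by blast
  have contT': "continuous_map ?T' T id" and contD': "continuous_map ?D' ?D id"
    by (simp_all add: continuous_map_from_subtopology)
  have cont\<phi>': "continuous_map ?D' ?T' \<phi>"
    using homeomorphic_imp_continuous_map[OF cell_pair_homeomorphic_map[OF c]] .
  have sq2: "hom_induced p ?T' (?N - X0) T ?N id (hom_induced p ?D' (?O - ?S) ?T' (?N - X0) \<phi> x) =
      hom_induced p ?D ?O T ?N \<phi> (hom_induced p ?D' (?O - ?S) ?D ?O id x)" for x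
  proof -
    have "hom_induced p ?T' (?N - X0) T ?N id (hom_induced p ?D' (?O - ?S) ?T' (?N - X0) \<phi> x)
       = hom_induced p ?D' (?O - ?S) T ?N (id \<circ> \<phi>) x"
      by (rule hom_induced_compose'[OF cont\<phi>' _ contT']) (use im in auto)
    moreover have "hom_induced p ?D ?O T ?N \<phi> (hom_induced p ?D' (?O - ?S) ?D ?O id x)
       = hom_induced p ?D' (?O - ?S) T ?N (\<phi> \<circ> id) x"
      by (rule hom_induced_compose'[OF contD' _ C(4)]) auto
    ultimately show ?thesis by simp
  qed
  have sq1: "hom_induced p T X0 T ?N id (hom_induced p ?D ?S T X0 \<phi> x) =
      hom_induced p ?D ?O T ?N \<phi> (hom_induced p ?D ?S ?D ?O id x)" for x
  proof -
    have "hom_induced p T X0 T ?N id (hom_induced p ?D ?S T X0 \<phi> x) = hom_induced p ?D ?S T ?N (id \<circ> \<phi>) x"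
      by (rule hom_induced_compose'[OF C(4)]) (use C(7) in auto)
    moreover have "hom_induced p ?D ?O T ?N \<phi> (hom_induced p ?D ?S ?D ?O id x) = hom_induced p ?D ?S T ?N (\<phi> \<circ> id) x"
      by (rule hom_induced_compose'[OF _ _ C(4)]) (use SO in auto)
    ultimately show ?thesis by simp
  qed
  let ?R = "\<lambda>X S. carrier (relative_homology_group p X S)"
  have "bij_betw (hom_induced p ?T' (?N - X0) T ?N id \<circ> hom_induced p ?D' (?O - ?S) ?T' (?N - X0) \<phi>)
      (?R ?D' (?O - ?S)) (?R T ?N)"
    using c1 b2 by (intro bij_betw_trans) (auto simp: iso_def)
  moreover have "bij_betw (hom_induced p ?D' (?O - ?S) ?D ?O id) (?R ?D' (?O - ?S)) (?R ?D ?O)"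
    using a2 by (simp add: iso_def)
  \<comment> \<open>The excision square makes the rung between the collared pairs bijective; the
    square of enlargements then yields the claim.\<close>
  ultimately have f': "bij_betw (hom_induced p ?D ?O T ?N \<phi>) (?R ?D ?O) (?R T ?N)"
    using bij_betw_left_factor sq2 unfolding o_def by blast
  have "bij_betw (hom_induced p ?D ?O T ?N \<phi> \<circ> hom_induced p ?D ?S ?D ?O id) (?R ?D ?S) (?R T ?N)"
    using a1 f' by (intro bij_betw_trans) (auto simp: iso_def)
  moreover have hom: "hom_induced p ?D ?S T X0 \<phi> \<in> hom (relative_homology_group p ?D ?S) (relative_homology_group p T X0)"
    by (simp add: hom_induced_hom)
  moreover have "bij_betw (hom_induced p T X0 T ?N id) (?R T X0) (?R T ?N)"
    using b1 by (simp add: iso_def)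
  moreover have "hom_induced p ?D ?S T X0 \<phi> ` ?R ?D ?S \<subseteq> ?R T X0"
    by (simp add: hom_induced_carrier image_subset_iff)
  ultimately have "bij_betw (hom_induced p ?D ?S T X0 \<phi>) (?R ?D ?S) (?R T X0)"
    using bij_betw_right_factor[of "hom_induced p T X0 T ?N id" "?R T X0" "?R T ?N" _ "?R ?D ?S" "hom_induced p ?D ?S T X0 \<phi>"] sq1
    unfolding o_def by metis
  then show ?thesis using hom by (simp add: iso_def)
qed

section \<open>Invariance of relative homology under expansions\<close>

lemma new_cell_disjoint:
  assumes XY: "subcomplex X Y" and c: "c \<in> cw_cells Y k" "c \<notin> cw_cells X k"
  shows "c \<inter> cw_points X = {}"
proof (rule ccontr)
  have X: "finite_cw X" and Y: "finite_cw Y" using XY by (simp_all add: subcomplex_def)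
  assume "c \<inter> cw_points X \<noteq> {}"
  then obtain x where x: "x \<in> c" "x \<in> cw_points X" by blast
  then obtain l c' where c': "c' \<in> cw_cells X l" "x \<in> c'" using point_in_cell[OF X] by metis
  then have "c' \<in> cw_cells Y l" using XY by (auto simp: subcomplex_def)
  then have "k = l" "c = c'" using cell_unique[OF Y c(1) _ x(1) c'(2)] by auto
  then show False using c c' by simp
qed

lemma subcomplex_closedin:
  assumes "subcomplex X Y"
  shows "closedin (cw_space Y) (cw_points X)"
proof -
  have e: "emb X Y (\<lambda>x. x)" using assms by (simp add: subcomplex_iff_emb)
  have "compactin (cw_space Y) (cw_points X)"
    using image_compactin[OF _ embD(3)[OF e], of "topspace (cw_space X)"] finite_cw_compact[OF embD(1)[OF e]]
    by (simp add: compact_space_def cw_points_def)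
  then show ?thesis
    using compactin_imp_closedin finite_cw_Hausdorff[OF embD(2)[OF e]] by blast
qed

text \<open>Contracts each vertical chord of the ball linearly to its lower end point, which lies on
  the lower hemisphere and stays fixed.\<close>

definition push_down :: "nat \<Rightarrow> real \<times> (nat \<Rightarrow> real) \<Rightarrow> (nat \<Rightarrow> real)" where
  "push_down m z = (snd z)(m := (1 - fst z) * snd z m - fst z * sqrt (1 - (\<Sum>i<m. (snd z i)\<^sup>2)))"

lemma push_down_props:
  assumes s: "s \<in> {0..1}" and x: "x \<in> disk_set (Suc m)"
  shows "push_down m (s, x) \<in> disk_set (Suc m)" "push_down m (1, x) \<in> lower_hemisphere m"
    "x \<in> lower_hemisphere m \<Longrightarrow> push_down m (s, x) = x" "push_down m (0, x) = x"
proof -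
  define S where "S = (\<Sum>i<m. (x i)\<^sup>2)"
  define q where "q = sqrt (1 - S)"
  have "S + (x m)\<^sup>2 \<le> 1" using x by (simp add: disk_set_alt S_def)
  moreover have S0: "S \<ge> 0" by (simp add: S_def sum_nonneg)
  moreover have "(x m)\<^sup>2 \<ge> 0" by simp
  ultimately have S1: "S \<le> 1" and xm: "(x m)\<^sup>2 \<le> 1 - S" by linarith+
  have q2: "q\<^sup>2 = 1 - S" and q0: "q \<ge> 0" using S1 by (simp_all add: q_def)
  have aq: "\<bar>x m\<bar> \<le> q"
    using xm q0 unfolding q2[symmetric] by (simp add: abs_le_square_iff[symmetric])
  have p: "push_down m (s, x) = x(m := (1 - s) * x m - s * q)" for s
    by (simp add: push_down_def q_def S_def)
  have sum: "(\<Sum>i<m. (push_down m (s, x) i)\<^sup>2) = S" for s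
    unfolding S_def p by (intro sum.cong) auto
  have z: "push_down m (s, x) i = 0" if "i \<ge> Suc m" for i s
    using x that by (simp add: p disk_set_alt)
  have "(1 - s) * x m - s * q \<le> q" "- q \<le> (1 - s) * x m - s * q"
  proof -
    have "(1 - s) * x m \<le> (1 - s) * q" "(1 - s) * (- q) \<le> (1 - s) * x m"
      using aq s by (intro mult_left_mono; force simp: abs_le_iff)+
    moreover have "s * q \<ge> 0" using s q0 by simp
    ultimately show "(1 - s) * x m - s * q \<le> q" "- q \<le> (1 - s) * x m - s * q"
      using q0 by (auto simp: algebra_simps)
  qed
  then have "\<bar>(1 - s) * x m - s * q\<bar> \<le> \<bar>q\<bar>" using q0 by (simp add: abs_le_iff)
  then have "((1 - s) * x m - s * q)\<^sup>2 \<le> q\<^sup>2" by (simp only: abs_le_square_iff)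
  then have "(push_down m (s, x) m)\<^sup>2 \<le> 1 - S" by (simp add: p q2)
  then show "push_down m (s, x) \<in> disk_set (Suc m)"
    using z sum[of s] by (simp add: disk_set_alt)
  have "(push_down m (1, x) m)\<^sup>2 = 1 - S" "push_down m (1, x) m \<le> 0" using q2 q0 by (simp_all add: p)
  then show "push_down m (1, x) \<in> lower_hemisphere m"
    using z sum[of 1] by (simp add: lower_hemisphere_def disk_boundary_alt)
  show "push_down m (0, x) = x" by (simp add: p)
  show "push_down m (s, x) = x" if "x \<in> lower_hemisphere m"
  proof -
    have "(x m)\<^sup>2 = q\<^sup>2" "x m \<le> 0"
      using that by (simp_all add: lower_hemisphere_def disk_boundary_alt q2 S_def)
    then have "x m = - q" using q0 by (auto simp: power2_eq_iff)
    then have "(1 - s) * x m - s * q = x m" by (simp add: algebra_simps)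
    then show ?thesis by (simp add: p)
  qed
qed

lemma continuous_map_push_down:
  "continuous_map (prod_topology (top_of_set {0..1}) (disk (Suc m))) (disk (Suc m)) (push_down m)"
proof -
  have "continuous_on ({0..1} \<times> disk_set (Suc m)) (push_down m)"
  proof (rule continuous_on_coordinatewise_then_product)
    fix i
    have c: "continuous_on A (\<lambda>z::real \<times> (nat \<Rightarrow> real). snd z j)" for j A
      using continuous_on_compose2[OF continuous_on_coord[of UNIV j] continuous_on_snd[OF continuous_on_id]] by auto
    show "continuous_on ({0..1} \<times> disk_set (Suc m)) (\<lambda>z. push_down m z i)"
      unfolding push_down_def by (cases "i = m") (auto intro!: continuous_intros c)
  qed
  then show ?thesis
    using push_down_props(1) by (auto simp: disk_eq)
qed

text \<open>Points of the disk that \<open>\<phi>\<close> identifies lie on the lower hemisphere,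
  which goes into \<open>X\<close>; so \<open>push_down\<close> descends to \<open>Y\<close> and
  retracts it onto \<open>X\<close>, fixing \<open>X\<close> pointwise at all times. Hence it
  preserves every subset \<open>S\<close> of \<open>X\<close>, in particular the copy of
  \<open>L\<close>.\<close>

lemma expansion_retraction:
  assumes ex: "elementary_expansion m X Y"
  obtains r where "retraction_maps (cw_space Y) (cw_space X) r id" "\<And>x. x \<in> cw_points X \<Longrightarrow> r x = x"
    "\<And>S. S \<subseteq> cw_points X \<Longrightarrow> homotopic_with (\<lambda>h. h ` S \<subseteq> S) (cw_space Y) (cw_space Y) r id"
proof -
  obtain e e' \<phi> where XY: "subcomplex X Y" and e: "e \<notin> cw_cells X m" and e': "e' \<notin> cw_cells X (Suc m)"
    and cY: "cw_cells Y = (cw_cells X)(m := insert e (cw_cells X m), Suc m := insert e' (cw_cells X (Suc m)))"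
    and ch': "characteristic_map Y (Suc m) e' \<phi>" and ch: "characteristic_map Y m e (\<phi> \<circ> upper_hemisphere_map m)"
    and low: "\<phi> ` lower_hemisphere m \<subseteq> skeleton X m"
    using ex unfolding elementary_expansion_def by metis
  have eXY: "emb X Y (\<lambda>x. x)" using XY by (simp add: subcomplex_iff_emb)
  have X: "finite_cw X" and Y: "finite_cw Y" using embD[OF eXY] by blast+
  have sp: "cw_space X = subtopology (cw_space Y) (cw_points X)" using XY unfolding subcomplex_def by blast
  have eY: "e \<in> cw_cells Y m" and eY': "e' \<in> cw_cells Y (Suc m)" unfolding cY by auto
  have eX: "e \<inter> cw_points X = {}" and eX': "e' \<inter> cw_points X = {}"
    using new_cell_disjoint[OF XY eY e] new_cell_disjoint[OF XY eY' e'] .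
  have ee': "e \<inter> e' = {}" using cell_unique(1)[OF Y eY eY'] by fastforce
  have ime: "(\<phi> \<circ> upper_hemisphere_map m) ` disk_interior m = e"
    using characteristic_map_cell_image[OF Y eY ch] .
  have ime': "\<phi> ` disk_interior (Suc m) = e'"
    using characteristic_map_cell_image[OF Y eY' ch'] .
  have skX: "skeleton X m \<subseteq> cw_points X"
    unfolding skeleton_def using cell_subset_points[OF X] by blast
  have \<phi>c: "continuous_map (disk (Suc m)) (cw_space Y) \<phi>" using ch' by (simp add: characteristic_map_def)
  \<comment> \<open>The open ball goes to \<open>e'\<close>, the open upper hemisphere to
    \<open>e\<close> and the lower hemisphere into \<open>X\<close>; these three sets are
    disjoint.\<close>
  have cases3: "(x \<in> disk_interior (Suc m) \<and> \<phi> x \<in> e') \<or> (x \<in> lower_hemisphere m \<and> \<phi> x \<in> cw_points X) \<or>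
      (\<exists>y\<in>disk_interior m. x = upper_hemisphere_map m y \<and> \<phi> x \<in> e)" if x: "x \<in> disk_set (Suc m)" for x
  proof (cases "x \<in> disk_interior (Suc m)")
    case True
    then show ?thesis using ime' by blast
  next
    case False
    then have xb: "x \<in> disk_boundary (Suc m)" using x by (simp add: disk_set_split)
    show ?thesis
    proof (cases "x m \<le> 0")
      case True
      then have "x \<in> lower_hemisphere m" using xb by (simp add: lower_hemisphere_def)
      then show ?thesis using low skX by blast
    next
      case False
      have "(\<Sum>i<m. (x i)\<^sup>2) + (x m)\<^sup>2 = 1" using xb by (simp add: disk_boundary_alt)
      moreover have "(x m)\<^sup>2 > 0" using False by simp
      ultimately have S: "(\<Sum>i<m. (x i)\<^sup>2) < 1" "(x m)\<^sup>2 = 1 - (\<Sum>i<m. (x i)\<^sup>2)" by linarith+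
      have Sy: "(\<Sum>i<m. ((x(m := 0)) i)\<^sup>2) = (\<Sum>i<m. (x i)\<^sup>2)" by (intro sum.cong) auto
      have "(x(m := 0)) i = 0" if "i \<ge> m" for i using xb that by (cases "i = m") (auto simp: disk_boundary_alt)
      then have y: "x(m := 0) \<in> disk_interior m" using S(1) Sy by (simp add: disk_interior_alt)
      have "sqrt (1 - (\<Sum>i<m. (x i)\<^sup>2)) = x m" using S(2)[symmetric] False by simp
      then have "x = upper_hemisphere_map m (x(m := 0))"
        unfolding upper_hemisphere_map_def Sy by (simp add: fun_eq_iff)
      moreover have "\<phi> (upper_hemisphere_map m (x(m := 0))) \<in> e" using ime y by auto
      ultimately show ?thesis using y by auto
    qed
  qed
  have inX: "x \<in> lower_hemisphere m" if "x \<in> disk_set (Suc m)" "\<phi> x \<in> cw_points X" for x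
    using cases3[OF that(1)] that(2) eX eX' by blast
  have outX: "x = y" if x: "x \<in> disk_set (Suc m)" and y: "y \<in> disk_set (Suc m)" and eq: "\<phi> x = \<phi> y" and n: "\<phi> x \<notin> cw_points X" for x y
  proof -
    consider "x \<in> disk_interior (Suc m)" "y \<in> disk_interior (Suc m)"
      | x' y' where "x' \<in> disk_interior m" "y' \<in> disk_interior m" "x = upper_hemisphere_map m x'" "y = upper_hemisphere_map m y'"
      using cases3[OF x] cases3[OF y] eq n ee' by (metis disjoint_iff)
    then show ?thesis
    proof cases
      case 1
      then show ?thesis using inj_onD[OF characteristic_map_image(1)[OF ch']] eq by blast
    next
      case 2
      then have "x' = y'" using inj_onD[OF characteristic_map_image(1)[OF ch], of x' y'] eq by simp
      then show ?thesis using 2 by simp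
    qed
  qed
  have ptsY: "cw_points Y = cw_points X \<union> \<phi> ` disk_set (Suc m)"
  proof
    show "cw_points Y \<subseteq> cw_points X \<union> \<phi> ` disk_set (Suc m)"
    proof
      fix u assume u: "u \<in> cw_points Y"
      then obtain k c where c: "c \<in> cw_cells Y k" "u \<in> c" using point_in_cell[OF Y] by metis
      then consider "c \<in> cw_cells X k" | "c = e" | "c = e'" by (auto simp: cY split: if_splits)
      then show "u \<in> cw_points X \<union> \<phi> ` disk_set (Suc m)"
      proof cases
        case 1
        then show ?thesis using cell_subset_points[OF X] c by blast
      next
        case 2
        then obtain y where y: "y \<in> disk_interior m" "u = \<phi> (upper_hemisphere_map m y)" using ime c by auto
        then have "upper_hemisphere_map m y \<in> disk_set (Suc m)"
          using upper_hemisphere_map_props(1)[of y m] by (simp add: disk_set_split)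
        then show ?thesis using y by blast
      next
        case 3
        then show ?thesis using ime' c by (auto simp: disk_set_split)
      qed
    qed
    show "cw_points X \<union> \<phi> ` disk_set (Suc m) \<subseteq> cw_points Y"
      using embD(6)[OF eXY] characteristic_map_image(3)[OF ch'] by (auto simp: cw_points_def)
  qed
  have b: "continuous_map (prod_topology (top_of_set {0..1}) (disk (Suc m))) (cw_space Y) (\<lambda>z. \<phi> (push_down m z))"
    using continuous_map_compose[OF continuous_map_push_down \<phi>c] by (simp add: o_def)
  have cover: "topspace (cw_space Y) = cw_points X \<union> \<phi> ` disk_set (Suc m)" using ptsY by (simp add: cw_points_def)
  have c1: "\<phi> (push_down m (s, x)) = \<phi> x" if "s \<in> {0..1}" "x \<in> disk_set (Suc m)" "\<phi> x \<in> cw_points X" for s x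
    using push_down_props(3)[OF that(1,2) inX[OF that(2,3)]] by simp
  have c2: "\<phi> (push_down m (s, x)) = \<phi> (push_down m (s, y))"
    if "s \<in> {0..1}" "x \<in> disk_set (Suc m)" "y \<in> disk_set (Suc m)" "\<phi> x = \<phi> y" "\<phi> x \<notin> cw_points X" for s x y
    using outX[OF that(2-5)] by simp
  obtain H where H: "continuous_map (prod_topology (top_of_set {0..1}) (cw_space Y)) (cw_space Y) H"
    "\<And>s u. s \<in> {0..1} \<Longrightarrow> u \<in> cw_points X \<Longrightarrow> H (s, u) = u"
    "\<And>s x. s \<in> {0..1} \<Longrightarrow> x \<in> disk_set (Suc m) \<Longrightarrow> H (s, \<phi> x) = \<phi> (push_down m (s, x))"
    by (rule homotopy_out_of_two_pieces[OF finite_cw_Hausdorff[OF Y] finite_cw_compact[OF Y]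
          subcomplex_closedin[OF XY] \<phi>c cover b]) (use c1 c2 in \<open>blast+\<close>)
  have H0: "H (0, u) = u" if u: "u \<in> topspace (cw_space Y)" for u
  proof -
    consider "u \<in> cw_points X" | x where "x \<in> disk_set (Suc m)" "u = \<phi> x" using u cover by blast
    then show ?thesis using H push_down_props(4)[of 0] by cases auto
  qed
  have H1: "H (1, u) \<in> cw_points X" if u: "u \<in> topspace (cw_space Y)" for u
  proof -
    consider "u \<in> cw_points X" | x where "x \<in> disk_set (Suc m)" "u = \<phi> x" using u cover by blast
    then show ?thesis
    proof cases
      case 1
      then show ?thesis using H(2)[of 1 u] by simp
    next
      case 2
      then have "H (1, u) = \<phi> (push_down m (1, x))" using H(3)[of 1 x] by simp
      then show ?thesis using push_down_props(2)[of 1 x m] 2 low skX by auto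
    qed
  qed
  have "continuous_map (cw_space Y) (cw_space Y) (\<lambda>u. H (1, u))" using continuous_map_slice[OF H(1)] by simp
  then have "continuous_map (cw_space Y) (cw_space X) (\<lambda>u. H (1, u))"
    unfolding sp using H1 by (auto simp: continuous_map_in_subtopology)
  moreover have "continuous_map (cw_space X) (cw_space Y) id" using embD(3)[OF eXY] by (simp add: id_def)
  ultimately have "retraction_maps (cw_space Y) (cw_space X) (\<lambda>u. H (1, u)) id"
    using H(2)[of 1] by (simp add: retraction_maps_def cw_points_def)
  moreover have "homotopic_with (\<lambda>h. h ` S \<subseteq> S) (cw_space Y) (cw_space Y) (\<lambda>u. H (1, u)) id" if S: "S \<subseteq> cw_points X" for S
  proof -
    have SY: "S \<subseteq> topspace (cw_space Y)" using S cover by blast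
    have "homotopic_with (\<lambda>h. h \<in> S \<rightarrow> S) (cw_space Y) (cw_space Y) (\<lambda>u. H (1, u)) id"
      by (rule homotopic_with_invariant_set[OF H(1) H0 SY]) (use S H(2) in auto)
    then show ?thesis by (simp add: image_subset_iff_funcset)
  qed
  ultimately show thesis using that H(2)[of 1] by simp
qed

section \<open>The boundary class\<close>

definition generates :: "('g, 'x) monoid_scheme \<Rightarrow> 'g \<Rightarrow> bool" where
  "generates G g \<longleftrightarrow> g \<in> carrier G \<and> (\<forall>x\<in>carrier G. \<exists>k::int. x = g [^]\<^bsub>G\<^esub> k)"

definition infinite_order :: "('g, 'x) monoid_scheme \<Rightarrow> 'g \<Rightarrow> bool" where
  "infinite_order G g \<longleftrightarrow> (\<forall>k::int. g [^]\<^bsub>G\<^esub> k = \<one>\<^bsub>G\<^esub> \<longrightarrow> k = 0)"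

lemma generates_iso:
  assumes G: "group G" "group H" and f: "f \<in> iso G H" and g: "generates G g"
  shows "generates H (f g)"
proof -
  have h: "f \<in> hom G H" and im: "f ` carrier G = carrier H" using f by (simp_all add: iso_iff)
  have gc: "g \<in> carrier G" using g by (simp add: generates_def)
  have "\<exists>k::int. y = f g [^]\<^bsub>H\<^esub> k" if y: "y \<in> carrier H" for y
  proof -
    obtain x where x: "x \<in> carrier G" "y = f x" using y im by blast
    then obtain k :: int where "x = g [^]\<^bsub>G\<^esub> k" using g by (auto simp: generates_def)
    then have "y = f g [^]\<^bsub>H\<^esub> k" using x hom_int_pow[OF h gc G] by simp
    then show ?thesis by blast
  qed
  moreover have "f g \<in> carrier H" using im gc by blast
  ultimately show ?thesis by (simp add: generates_def)
qed

lemma infinite_order_iso: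
  assumes G: "group G" "group H" and f: "f \<in> iso G H" and gc: "g \<in> carrier G" and g: "infinite_order G g"
  shows "infinite_order H (f g)"
  unfolding infinite_order_def
proof (intro allI impI)
  fix k :: int assume k: "f g [^]\<^bsub>H\<^esub> k = \<one>\<^bsub>H\<^esub>"
  have h: "f \<in> hom G H" and inj: "inj_on f (carrier G)" using f by (simp_all add: iso_iff)
  have "f (g [^]\<^bsub>G\<^esub> k) = f \<one>\<^bsub>G\<^esub>"
    using k hom_int_pow[OF h gc G] hom_one[OF h G] by simp
  then have "g [^]\<^bsub>G\<^esub> k = \<one>\<^bsub>G\<^esub>"
    using inj_onD[OF inj] group.int_pow_closed[OF G(1) gc] group.is_monoid[OF G(1)] monoid.one_closed by metis
  then show "k = 0" using g by (simp add: infinite_order_def)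
qed

text \<open>Each generator is a power of the other, and infinite order forces the two exponents to
  multiply to 1.\<close>

lemma generators_of_infinite_cyclic:
  assumes G: "group G" and g: "generates G g" "infinite_order G g" and g': "generates G g'"
  obtains k :: int where "g' = g [^]\<^bsub>G\<^esub> k" "k = 1 \<or> k = -1"
proof -
  interpret group G by (rule G)
  have gc: "g \<in> carrier G" and gc': "g' \<in> carrier G" using g g' by (simp_all add: generates_def)
  obtain k :: int where k: "g' = g [^]\<^bsub>G\<^esub> k" using g(1) gc' unfolding generates_def by blast
  obtain l :: int where l: "g = g' [^]\<^bsub>G\<^esub> l" using g' gc unfolding generates_def by blast
  have "g = g [^]\<^bsub>G\<^esub> (k * l)" using l int_pow_pow[OF gc, of k l] by (simp add: k)
  then have "g [^]\<^bsub>G\<^esub> (k * l - 1) = \<one>\<^bsub>G\<^esub>"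
    using int_pow_diff[OF gc, of "k * l" 1] gc by (simp add: int_pow_1)
  then have "k * l - 1 = 0" using g(2) unfolding infinite_order_def by blast
  then have "k * l = 1" by simp
  then have "k = 1 \<or> k = -1" using zmult_eq_1_iff by blast
  then show thesis using that k by blast
qed

text \<open>The deformation invariant: the classes in the first homology of \<open>L\<close> that
  are bounded by a generator of the second homology of \<open>K\<close> relative to
  \<open>L\<close>. It is a predicate and not a function because a cyclic group may have several
  generators.\<close>

definition boundary_class :: "'a cw \<Rightarrow> 'a cw \<Rightarrow> ('a \<Rightarrow> 'a) \<Rightarrow> 'a chain set \<Rightarrow> bool" where
  "boundary_class L K i y \<longleftrightarrow>
     (\<exists>g. generates (relative_homology_group 2 (cw_space K) (i ` cw_points L)) g \<and>
        hom_boundary 2 (cw_space K) (i ` cw_points L) g =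
        hom_induced 1 (cw_space L) {} (subtopology (cw_space K) (i ` cw_points L)) {} i y)"

text \<open>Naturality of the boundary map: the image of the generator under \<open>F\<close> is the
  new witness.\<close>

lemma boundary_class_transport:
  assumes F: "continuous_map (cw_space K) (cw_space K') F" and Fi: "\<And>x. x \<in> cw_points L \<Longrightarrow> j x = F (i x)"
    and iso: "hom_induced 2 (cw_space K) (i ` cw_points L) (cw_space K') (j ` cw_points L) F \<in>
       iso (relative_homology_group 2 (cw_space K) (i ` cw_points L)) (relative_homology_group 2 (cw_space K') (j ` cw_points L))"
    and i: "emb L K i" and b: "boundary_class L K i y"
  shows "boundary_class L K' j y"
proof -
  let ?A = "i ` cw_points L" and ?B = "j ` cw_points L"
  obtain g where g: "generates (relative_homology_group 2 (cw_space K) ?A) g"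
    "hom_boundary 2 (cw_space K) ?A g = hom_induced 1 (cw_space L) {} (subtopology (cw_space K) ?A) {} i y"
    using b by (auto simp: boundary_class_def)
  let ?g = "hom_induced 2 (cw_space K) ?A (cw_space K') ?B F g"
  have FAB: "F \<in> ?A \<rightarrow> ?B" using Fi by auto
  have "generates (relative_homology_group 2 (cw_space K') ?B) ?g"
    using generates_iso[OF _ _ iso g(1)] by simp
  moreover have "hom_boundary 2 (cw_space K') ?B ?g = hom_induced 1 (cw_space L) {} (subtopology (cw_space K') ?B) {} j y"
  proof -
    have ci: "continuous_map (cw_space L) (subtopology (cw_space K) ?A) i"
      using embD(3)[OF i] by (auto simp: continuous_map_in_subtopology cw_points_def)
    have cF: "continuous_map (subtopology (cw_space K) ?A) (subtopology (cw_space K') ?B) F"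
      using F FAB by (auto simp: continuous_map_in_subtopology continuous_map_from_subtopology)
    have "hom_boundary 2 (cw_space K') ?B ?g =
        hom_induced 1 (subtopology (cw_space K) ?A) {} (subtopology (cw_space K') ?B) {} F (hom_boundary 2 (cw_space K) ?A g)"
      using fun_cong[OF naturality_hom_induced[OF F FAB, of 2], of g] by simp
    also have "\<dots> = hom_induced 1 (cw_space L) {} (subtopology (cw_space K') ?B) {} (F \<circ> i) y"
      unfolding g(2) by (rule hom_induced_compose'[OF ci _ cF]) auto
    also have "\<dots> = hom_induced 1 (cw_space L) {} (subtopology (cw_space K') ?B) {} j y"
      using hom_induced_eq[of "cw_space L" "F \<circ> i" j 1 "{}"] Fi by (simp add: cw_points_def)
    finally show ?thesis .
  qed
  ultimately show ?thesis by (auto simp: boundary_class_def)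
qed

text \<open>Every step induces an isomorphism relative to \<open>L\<close>: the inclusion for an
  expansion, the retraction for a collapse, the homeomorphism for an isomorphism. The retraction
  fixes the copy of \<open>L\<close>, so the identifications with \<open>L\<close> match.\<close>

lemma boundary_class_deformation:
  assumes L: "finite_cw L" and def: "((K, i), (K', j)) \<in> deformation d L" and b: "boundary_class L K i y"
  shows "boundary_class L K' j y"
proof -
  have iff: "\<And>K i. (K, i) \<in> complexes_over d L \<longleftrightarrow> cw_dim_le K d \<and> emb L K i"
    using complexes_over_iff[OF L] .
  have one_step: "boundary_class L B b y"
    if st: "((A, a), (B, b)) \<in> expansion_step d L \<union> (expansion_step d L)\<inverse> \<union> isomorphism_step d L"
      and y: "boundary_class L A a y" for A a B b
  proof -
    consider (e) "((A, a), (B, b)) \<in> expansion_step d L" | (c) "((B, b), (A, a)) \<in> expansion_step d L"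
      | (i) "((A, a), (B, b)) \<in> isomorphism_step d L"
      using st by blast
    then show ?thesis
    proof cases
      case e
      then obtain m where ex: "elementary_expansion m A B" and A: "emb L A a" and ba: "\<And>x. x \<in> cw_points L \<Longrightarrow> b x = a x"
        unfolding expansion_step_def using iff by blast
      obtain r where r: "retraction_maps (cw_space B) (cw_space A) r id" "\<And>x. x \<in> cw_points A \<Longrightarrow> r x = x"
        "\<And>S. S \<subseteq> cw_points A \<Longrightarrow> homotopic_with (\<lambda>h. h ` S \<subseteq> S) (cw_space B) (cw_space B) r id"
        using expansion_retraction[OF ex] by metis
      have im: "b ` cw_points L = a ` cw_points L" using ba by (intro image_cong refl)
      have S: "a ` cw_points L \<subseteq> cw_points A" using embD(6)[OF A] by blast
      have "hom_induced 2 (cw_space A) (a ` cw_points L) (cw_space B) (b ` cw_points L) id \<in>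
          iso (relative_homology_group 2 (cw_space A) (a ` cw_points L)) (relative_homology_group 2 (cw_space B) (b ` cw_points L))"
        unfolding im
        by (rule deformation_retract_relative_homology_group_isomorphism_id[OF r(1) _ _ r(3)[OF S]]) (use r(2) S in auto)
      moreover have "continuous_map (cw_space A) (cw_space B) id" using r(1) by (simp add: retraction_maps_def)
      ultimately show ?thesis using boundary_class_transport[OF _ _ _ A y] ba by simp
    next
      case c
      then obtain m where ex: "elementary_expansion m B A" and A: "emb L A a" and B: "emb L B b" and ab: "\<And>x. x \<in> cw_points L \<Longrightarrow> a x = b x"
        unfolding expansion_step_def using iff by blast
      obtain r where r: "retraction_maps (cw_space A) (cw_space B) r id" "\<And>x. x \<in> cw_points B \<Longrightarrow> r x = x"
        "\<And>S. S \<subseteq> cw_points B \<Longrightarrow> homotopic_with (\<lambda>h. h ` S \<subseteq> S) (cw_space A) (cw_space A) r id"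
        using expansion_retraction[OF ex] by metis
      have im: "b ` cw_points L = a ` cw_points L" using ab by (intro image_cong) auto
      have S: "a ` cw_points L \<subseteq> cw_points B"
        unfolding im[symmetric] using embD(6)[OF B] by blast
      have "hom_induced 2 (cw_space A) (a ` cw_points L) (cw_space B) (b ` cw_points L) r \<in>
          iso (relative_homology_group 2 (cw_space A) (a ` cw_points L)) (relative_homology_group 2 (cw_space B) (b ` cw_points L))"
        unfolding im
        by (rule deformation_retract_relative_homology_group_isomorphism[OF r(1) _ _ r(3)[OF S]]) (use r(2) S in auto)
      moreover have "continuous_map (cw_space A) (cw_space B) r" using r(1) by (simp add: retraction_maps_def)
      moreover have "b x = r (a x)" if "x \<in> cw_points L" for x
        using ab[OF that] r(2)[OF embD(6)[OF B that]] by simp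
      ultimately show ?thesis using boundary_class_transport[OF _ _ _ A y] by blast
    next
      case i
      then obtain h where h: "cw_isomorphism A B h" and A: "emb L A a" and bh: "\<And>x. x \<in> cw_points L \<Longrightarrow> b x = h (a x)"
        unfolding isomorphism_step_def using iff by blast
      have hm: "homeomorphic_map (cw_space A) (cw_space B) h" using h by (simp add: cw_isomorphism_def)
      have im: "h ` (a ` cw_points L) = b ` cw_points L" unfolding image_image using bh by (intro image_cong) auto
      have S: "a ` cw_points L \<subseteq> topspace (cw_space A)" using embD(6)[OF A] by (auto simp: cw_points_def)
      show ?thesis
        using boundary_class_transport[OF homeomorphic_imp_continuous_map[OF hm] bh
            homeomorphic_map_relative_homology_iso[OF hm S im] A y] .
    qed
  qed
  have "boundary_class L (fst X) (snd X) y" if "((K, i), X) \<in> deformation d L" for X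
    using that unfolding deformation_def
  proof (induction rule: rtrancl_induct)
    case base
    then show ?case using b by simp
  next
    case (step X Y)
    then show ?case using one_step[of "fst X" "snd X" "fst Y" "snd Y"] by simp
  qed
  from this[OF def] show ?thesis by simp
qed

section \<open>Homology of the disk and of the circle\<close>

lemma contractible_space_disk: "contractible_space (disk m)"
proof -
  have d: "(\<lambda>i. (1 - s) * x i) \<in> disk_set m" if "s \<in> {0..1}" "x \<in> disk_set m" for s x
  proof -
    have "(\<Sum>i<m. ((1 - s) * x i)\<^sup>2) = (1 - s)\<^sup>2 * (\<Sum>i<m. (x i)\<^sup>2)"
      by (simp add: power_mult_distrib sum_distrib_left)
    also have "\<dots> \<le> 1"
      using that by (intro mult_le_one) (auto simp: disk_set_alt sum_nonneg power_le_one)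
    finally show ?thesis using that by (simp add: disk_set_alt)
  qed
  have "continuous_on ({0..1} \<times> disk_set m) (\<lambda>z i. (1 - fst z) * snd z i)"
  proof (rule continuous_on_coordinatewise_then_product)
    fix i
    have c: "continuous_on A (\<lambda>z::real \<times> (nat \<Rightarrow> real). snd z j)" for j A
      using continuous_on_compose2[OF continuous_on_coord[of UNIV j] continuous_on_snd[OF continuous_on_id]] by auto
    show "continuous_on ({0..1} \<times> disk_set m) (\<lambda>z. (1 - fst z) * snd z i)"
      by (intro continuous_intros c)
  qed
  then have "continuous_map (prod_topology (top_of_set {0..1}) (disk m)) (disk m) (\<lambda>z i. (1 - fst z) * snd z i)"
    using d by (auto simp: disk_eq)
  then have "homotopic_with (\<lambda>x. True) (disk m) (disk m) id (\<lambda>x. \<lambda>i. 0)"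
    unfolding homotopic_with_def
    by (intro exI[of _ "\<lambda>z i. (1 - fst z) * snd z i"]) auto
  then show ?thesis unfolding contractible_space_def by blast
qed

lemma circle_nsphere: "top_of_set (disk_boundary 2) = nsphere 1"
proof -
  have "{x. \<forall>i\<ge>2. x i = 0} \<inter> {x. (\<Sum>i\<le>1. (x i)\<^sup>2) = 1} = disk_boundary 2"
    by (auto simp: disk_boundary_alt numeral_2_eq_2)
  then show ?thesis
    unfolding nsphere_def Euclidean_space_def
    by (simp add: subtopology_subtopology euclidean_product_topology numeral_2_eq_2)
qed

lemma disk_boundary_2_nonempty: "(\<lambda>i. if i = 0 then 1 else 0) \<in> disk_boundary 2"
  by (simp add: disk_boundary_alt numeral_2_eq_2)

text \<open>The disk is contractible, so its boundary map is an isomorphism onto the reduced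
  homology of the circle, which is infinite cyclic. The generators are chosen to correspond under
  it, since the computation for an attached cell starts from the relative one and ends with the
  class of the circle.\<close>

lemma circle_homology:
  obtains g where "generates (relative_homology_group 2 (disk 2) (disk_boundary 2)) g"
    "infinite_order (relative_homology_group 2 (disk 2) (disk_boundary 2)) g"
    "generates (homology_group 1 (top_of_set (disk_boundary 2))) (hom_boundary 2 (disk 2) (disk_boundary 2) g)"
    "infinite_order (homology_group 1 (top_of_set (disk_boundary 2))) (hom_boundary 2 (disk 2) (disk_boundary 2) g)"
proof -
  let ?G = "relative_homology_group 2 (disk 2) (disk_boundary 2)" and ?H = "homology_group 1 (top_of_set (disk_boundary 2))"
  have "disk_set 2 \<inter> disk_boundary 2 \<noteq> {}" using disk_boundary_2_nonempty by (auto simp: disk_set_split)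
  then have "hom_boundary 2 (disk 2) (disk_boundary 2) \<in> iso ?G (reduced_homology_group (2 - 1) (subtopology (disk 2) (disk_boundary 2)))"
    by (intro iso_relative_homology_of_contractible contractible_space_disk) simp
  then have bd: "hom_boundary 2 (disk 2) (disk_boundary 2) \<in> iso ?G ?H"
    by (simp add: sphere_eq un_reduced_homology_group)
  have "reduced_homology_group 1 (nsphere 1) \<cong> integer_group"
    using reduced_homology_group_nsphere(1)[of 1] by simp
  then have "?H \<cong> integer_group" by (simp add: circle_nsphere un_reduced_homology_group)
  then obtain f where f0: "f \<in> iso ?H integer_group" by (auto simp: is_iso_def)
  have f: "inv_into (carrier ?H) f \<in> iso integer_group ?H"
    using group.iso_set_sym[OF _ f0] by simp
  have bd': "inv_into (carrier ?G) (hom_boundary 2 (disk 2) (disk_boundary 2)) \<in> iso ?H ?G"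
    using group.iso_set_sym[OF _ bd] by simp
  have z: "generates integer_group 1" "infinite_order integer_group 1"
    by (auto simp: generates_def infinite_order_def)
  define h where "h = inv_into (carrier ?H) f 1"
  define g where "g = inv_into (carrier ?G) (hom_boundary 2 (disk 2) (disk_boundary 2)) h"
  have h: "generates ?H h" "infinite_order ?H h"
    unfolding h_def using generates_iso[OF _ _ f z(1)] infinite_order_iso[OF _ _ f _ z(2)] by simp_all
  then have hc: "h \<in> carrier ?H" by (simp add: generates_def)
  have g: "generates ?G g" "infinite_order ?G g"
    unfolding g_def using generates_iso[OF _ _ bd' h(1)] infinite_order_iso[OF _ _ bd' hc h(2)] by simp_all
  have "hom_boundary 2 (disk 2) (disk_boundary 2) ` carrier ?G = carrier ?H" using bd by (simp add: iso_iff)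
  then have "hom_boundary 2 (disk 2) (disk_boundary 2) g = h"
    unfolding g_def using hc by (intro f_inv_into_f) simp
  then show thesis using that g h by simp
qed

section \<open>The degree of the power map of the circle\<close>

declare One_nat_def [simp del]

abbreviation circle :: "point topology" where
  "circle \<equiv> top_of_set (disk_boundary 2)"

definition circ :: "real \<Rightarrow> point" where
  "circ t = (\<lambda>i. if i = 0 then cos t else if i = 1 then sin t else 0)"

definition to_complex :: "point \<Rightarrow> complex" where
  "to_complex x = Complex (x 0) (x 1)"

definition of_complex :: "complex \<Rightarrow> point" where
  "of_complex z = (\<lambda>i. if i = 0 then Re z else if i = 1 then Im z else 0)"

definition power_map :: "nat \<Rightarrow> point \<Rightarrow> point" where
  "power_map k x = of_complex (to_complex x ^ k)"

lemma disk_boundary_2: "x \<in> disk_boundary 2 \<longleftrightarrow> (\<forall>i\<ge>2. x i = 0) \<and> (x 0)\<^sup>2 + (x 1)\<^sup>2 = 1"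
  by (simp add: disk_boundary_alt numeral_2_eq_2 One_nat_def)

lemma disk_set_2: "x \<in> disk_set 2 \<longleftrightarrow> (\<forall>i\<ge>2. x i = 0) \<and> (x 0)\<^sup>2 + (x 1)\<^sup>2 \<le> 1"
  by (simp add: disk_set_alt numeral_2_eq_2 One_nat_def)

lemma circ_in_circle [simp]: "circ t \<in> disk_boundary 2"
  by (simp add: disk_boundary_2 circ_def)

lemma circ_of_complex: "circ t = of_complex (cis t)"
  by (auto simp: circ_def of_complex_def fun_eq_iff)

lemma to_of_complex [simp]: "to_complex (of_complex z) = z"
  by (simp add: to_complex_def of_complex_def)

lemma circle_point:
  assumes "x \<in> disk_boundary 2"
  obtains t where "0 \<le> t" "t < 2 * pi" "x = circ t"
proof -
  have e: "(x 0)\<^sup>2 + (x 1)\<^sup>2 = 1" "\<forall>i\<ge>2. x i = 0" using assms by (simp_all add: disk_boundary_2)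
  obtain t where t: "0 \<le> t" "t < 2 * pi" "x 0 = cos t" "x 1 = sin t"
    using sincos_total_2pi[OF e(1)] by metis
  have "x i = circ t i" for i
    using t e(2) by (cases "i \<ge> 2") (auto simp: circ_def not_le less_2_cases_iff)
  then show thesis using that t by blast
qed

lemma power_map_circ: "power_map k (circ t) = circ (real k * t)"
  by (simp add: power_map_def circ_of_complex Complex.DeMoivre)

lemma circ_periodic: "circ (t + 2 * pi * real k) = circ t"
proof -
  have "cos (t + 2 * pi * real k) = cos t" "sin (t + 2 * pi * real k) = sin t"
    using cos_int_2pin[of "int k"] sin_int_2pin[of "int k"] by (simp_all add: cos_add sin_add mult.commute)
  then show ?thesis by (auto simp: circ_def fun_eq_iff)
qed

lemma circ_eq_imp:
  assumes "circ s = circ t"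
  obtains n :: int where "s - t = 2 * pi * n"
proof -
  have "cos s = cos t" "sin s = sin t"
    using fun_cong[OF assms, of 0] fun_cong[OF assms, of 1] by (simp_all add: circ_def)
  then have "cos (s - t) = 1"
    using sin_cos_squared_add2[of t] by (simp add: cos_diff power2_eq_square)
  then show thesis using that by (auto simp: cos_one_2pi_int mult.commute)
qed

lemma continuous_on_of_complex: "continuous_on S f \<Longrightarrow> continuous_on S (\<lambda>x. of_complex (f x))"
proof (rule continuous_on_coordinatewise_then_product)
  fix i assume "continuous_on S f"
  then show "continuous_on S (\<lambda>x. of_complex (f x) i)"
    by (cases "i = 0"; cases "i = 1") (auto simp: of_complex_def intro!: continuous_intros)
qed

lemma continuous_on_to_complex:
  assumes "continuous_on S f"
  shows "continuous_on S (\<lambda>x. to_complex (f x))"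
proof -
  have "continuous_on S (\<lambda>x. f x i)" for i
    using continuous_on_compose2[OF continuous_on_coord[of UNIV i] assms] by simp
  then show ?thesis
    unfolding to_complex_def Complex_eq by (intro continuous_intros)
qed

lemma continuous_on_circ: "continuous_on S f \<Longrightarrow> continuous_on S (\<lambda>x. circ (f x))"
  unfolding circ_of_complex by (intro continuous_on_of_complex continuous_intros)

lemma continuous_map_power_map: "continuous_map circle circle (power_map k)"
proof -
  have "continuous_on (disk_boundary 2) (power_map k)"
    unfolding power_map_def by (intro continuous_on_of_complex continuous_intros continuous_on_to_complex)
  moreover have "power_map k x \<in> disk_boundary 2" if "x \<in> disk_boundary 2" for x
    using circle_point[OF that] power_map_circ circ_in_circle by metis
  ultimately show ?thesis by auto
qed

section \<open>The winding class of the circle\<close>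

definition arc :: "real \<Rightarrow> real \<Rightarrow> (nat \<Rightarrow> real) \<Rightarrow> point" where
  "arc a b = restrict (\<lambda>v. circ (2 * pi * (a * v 0 + b * v 1))) (standard_simplex 1)"

text \<open>In barycentric coordinates, with angles counted in full turns: the vertices lie at 0,
  \<open>k\<close> and \<open>k + 1\<close> turns, so the edges are loops of winding numbers
  \<open>1\<close>, \<open>k + 1\<close> and \<open>k\<close>.\<close>

definition triangle :: "nat \<Rightarrow> (nat \<Rightarrow> real) \<Rightarrow> point" where
  "triangle k = restrict (\<lambda>v. circ (2 * pi * (k * v 1 + (k + 1) * v 2))) (standard_simplex 2)"

lemma standard_simplex_1: "v \<in> standard_simplex 1 \<Longrightarrow> v 0 + v 1 = 1"
  by (simp add: standard_simplex_def One_nat_def)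

lemma standard_simplex_0': "v \<in> standard_simplex 0 \<Longrightarrow> v 0 = 1"
  by (simp add: standard_simplex_def)

lemma singular_face_of_restrict:
  assumes "j \<le> p" "p > 0"
  shows "singular_face p j (restrict f (standard_simplex p)) = restrict (\<lambda>v. f (simplical_face j v)) (standard_simplex (p - 1))"
  using assms by (simp add: singular_face_def[of p j f] o_def One_nat_def)

lemma chain_boundary_1: "chain_boundary 1 (frag_of f) = frag_of (singular_face 1 0 f) - frag_of (singular_face 1 1 f)"
proof -
  have "{..1::nat} = {0, 1}" by auto
  then show ?thesis by (simp add: chain_boundary_of)
qed

lemma singular_simplex_restrict:
  assumes "continuous_on (standard_simplex p) f" "f ` standard_simplex p \<subseteq> S"
  shows "singular_simplex p (top_of_set S) (restrict f (standard_simplex p))"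
proof -
  have "continuous_on (standard_simplex p) (restrict f (standard_simplex p))"
    using assms(1) by (simp cong: continuous_on_cong)
  then show ?thesis
    using assms(2) by (auto simp: singular_simplex_def euclidean_product_topology)
qed

lemma singular_simplex_arc: "singular_simplex 1 circle (arc a b)"
  unfolding arc_def
  by (intro singular_simplex_restrict continuous_on_circ continuous_intros) auto

lemma singular_simplex_triangle: "singular_simplex 2 circle (triangle k)"
  unfolding triangle_def
  by (intro singular_simplex_restrict continuous_on_circ continuous_intros) auto

lemma singular_face_triangle:
  "singular_face 2 0 (triangle k) = arc 0 1" "singular_face 2 1 (triangle k) = arc 0 (k + 1)"
  "singular_face 2 2 (triangle k) = arc 0 k"
proof -
  \<comment> \<open>The edge opposite vertex 0 starts at \<open>k\<close> full turns, which is the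
    base point again.\<close>
  have "circ (2 * pi * (real k * v 0 + (real k + 1) * v 1)) = circ (2 * pi * v 1)" if "v \<in> standard_simplex 1" for v
  proof -
    have v0: "v 0 = 1 - v 1" using standard_simplex_1[OF that] by simp
    have "2 * pi * (real k * v 0 + (real k + 1) * v 1) = 2 * pi * v 1 + 2 * pi * real k"
      unfolding v0 by (simp add: algebra_simps)
    then show ?thesis using circ_periodic by simp
  qed
  then have eq: "restrict (\<lambda>v. circ (2 * pi * (real k * v 0 + (real k + 1) * v 1))) (standard_simplex 1) = arc 0 1"
    unfolding arc_def by (intro restrict_ext) simp
  have f: "singular_face 2 j (triangle k) = restrict (\<lambda>v. circ (2 * pi * (real k * simplical_face j v 1 + (real k + 1) * simplical_face j v 2))) (standard_simplex 1)"
    if "j \<le> 2" for j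
    unfolding triangle_def using that by (subst singular_face_of_restrict) (simp_all add: algebra_simps One_nat_def)
  show "singular_face 2 0 (triangle k) = arc 0 1"
    using f[of 0] eq by (simp add: simplical_face_def One_nat_def)
  show "singular_face 2 1 (triangle k) = arc 0 (k + 1)" "singular_face 2 2 (triangle k) = arc 0 k"
    using f[of 1] f[of 2] by (simp_all add: simplical_face_def arc_def One_nat_def add.commute)
qed

lemma chain_boundary_triangle:
  "chain_boundary 2 (frag_of (triangle k)) = frag_of (arc 0 1) - frag_of (arc 0 (k + 1)) + frag_of (arc 0 k)"
proof -
  have "{..2::nat} = {0, 1, 2}" by auto
  then show ?thesis by (simp add: chain_boundary_of singular_face_triangle)
qed

lemma arc_cycle: "singular_relcycle 1 circle {} (frag_of (arc 0 (real k)))"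
proof -
  have f: "singular_face 1 j (arc 0 (real k)) = restrict (\<lambda>v. circ (2 * pi * (real k * simplical_face j v 1))) (standard_simplex 0)"
    if "j \<le> 1" for j
    unfolding arc_def using that by (subst singular_face_of_restrict) simp_all
  have "singular_face 1 0 (arc 0 (real k)) = singular_face 1 1 (arc 0 (real k))"
    unfolding f[OF zero_le_one] f[OF order_refl]
    using circ_periodic[of 0 k] by (intro restrict_ext) (simp add: simplical_face_def standard_simplex_0')
  then have "chain_boundary 1 (frag_of (arc 0 (real k))) = 0"
    by (simp add: chain_boundary_1)
  then show ?thesis
    using singular_simplex_arc by (simp add: singular_cycle singular_chain_of)
qed

text \<open>The group operation is the sum of cosets, and \<open>x = c + (x - c)\<close> writes
  every chain homologous to \<open>c + d\<close> as such a sum.\<close>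

lemma homologous_rel_set_add:
  "homologous_rel_set p X S c \<otimes>\<^bsub>relative_homology_group (int p) X S\<^esub> homologous_rel_set p X S d
    = homologous_rel_set p X S (c + d)"
proof -
  have "x \<in> (\<Union>r\<in>homologous_rel_set p X S c. \<Union>s\<in>homologous_rel_set p X S d. {r + s})"
    if "homologous_rel p X S (c + d) x" for x
  proof -
    have "homologous_rel p X S d (x - c)"
      using that by (simp add: homologous_rel_def algebra_simps)
    then show ?thesis by (intro UN_I[of c] UN_I[of "x - c"]) auto
  qed
  then show ?thesis
    unfolding mult_relative_homology_group by (auto intro: homologous_rel_add)
qed

definition arc_class :: "nat \<Rightarrow> point chain set" where
  "arc_class k = homologous_rel_set 1 circle {} (frag_of (arc 0 (real k)))"

lemma arc_class_carrier: "arc_class k \<in> carrier (homology_group 1 circle)"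
  using carrier_relative_homology_group[of 1 circle "{}"] arc_cycle[of k]
  unfolding arc_class_def of_nat_1 by blast

text \<open>The three loops are related by the boundary of \<open>triangle k\<close>.\<close>

lemma arc_class_Suc: "arc_class (Suc k) = arc_class k \<otimes>\<^bsub>homology_group 1 circle\<^esub> arc_class 1"
proof -
  have "singular_relboundary 1 circle {} (frag_of (arc 0 (real k)) + frag_of (arc 0 1) - frag_of (arc 0 (real k + 1)))"
    unfolding singular_boundary
  proof (intro exI conjI)
    show "singular_chain (Suc 1) circle (frag_of (triangle k))"
      using singular_simplex_triangle by (simp add: singular_chain_of numeral_2_eq_2)
    show "chain_boundary (Suc 1) (frag_of (triangle k)) =
        frag_of (arc 0 (real k)) + frag_of (arc 0 1) - frag_of (arc 0 (real k + 1))"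
      using chain_boundary_triangle[of k] by (simp add: numeral_2_eq_2 algebra_simps)
  qed
  then have "homologous_rel 1 circle {} (frag_of (arc 0 (real (Suc k)))) (frag_of (arc 0 (real k)) + frag_of (arc 0 (real 1)))"
    by (subst homologous_rel_sym) (simp add: homologous_rel_def add.commute)
  then have "arc_class (Suc k) = homologous_rel_set 1 circle {} (frag_of (arc 0 (real k)) + frag_of (arc 0 (real 1)))"
    unfolding arc_class_def homologous_rel_set_eq .
  then show ?thesis
    using homologous_rel_set_add[where p = 1 and X = circle and S = "{}" and c = "frag_of (arc 0 (real k))" and d = "frag_of (arc 0 (real 1))"]
    by (simp add: arc_class_def)
qed

lemma arc_class_power: "arc_class k = arc_class 1 [^]\<^bsub>homology_group 1 circle\<^esub> k"
proof (induction k)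
  case 0
  have G: "group (homology_group 1 circle)" by (rule group_relative_homology_group)
  \<comment> \<open>The relation for \<open>k = 0\<close> shows that the constant loop is
    neutral.\<close>
  have "arc_class 0 \<otimes>\<^bsub>homology_group 1 circle\<^esub> arc_class 1 = arc_class 1"
    using arc_class_Suc[of 0] unfolding One_nat_def by (rule sym)
  then have "arc_class 0 = \<one>\<^bsub>homology_group 1 circle\<^esub>"
    using group.r_cancel_one[OF G arc_class_carrier[of 1] arc_class_carrier[of 0]] by blast
  then show ?case
    unfolding monoid.nat_pow_0[OF group.is_monoid[OF G]] .
next
  case (Suc k)
  have G: "group (homology_group 1 circle)" by (rule group_relative_homology_group)
  show ?case
    unfolding monoid.nat_pow_Suc[OF group.is_monoid[OF G]] arc_class_Suc[of k] Suc.IH[symmetric] ..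
qed

text \<open>Already on simplices the power map carries the arc once around to the arc
  \<open>k\<close> times around.\<close>

lemma power_map_arc_class:
  "hom_induced 1 circle {} circle {} (power_map k) (arc_class 1) = arc_class 1 [^]\<^bsub>homology_group 1 circle\<^esub> k"
proof -
  have "simplex_map 1 (power_map k) (arc 0 (real 1)) = arc 0 (real k)"
    by (auto simp: simplex_map_def arc_def power_map_circ restrict_def fun_eq_iff algebra_simps)
  then have "hom_induced (int 1) circle {} circle {} (power_map k) (arc_class 1) = arc_class k"
    unfolding arc_class_def
    using hom_induced_chain_map[OF continuous_map_power_map[of k] _ arc_cycle[of 1], where T = "{}"] by simp
  then show ?thesis using arc_class_power[of k] by simp
qed

section \<open>Nontriviality of the winding class\<close>

definition loop :: "(nat \<Rightarrow> real) \<Rightarrow> point" where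
  "loop x = circ (pi * (x 0 + 1))"

lemma disk_1: "x \<in> disk_set 1 \<longleftrightarrow> (\<forall>i\<ge>1. x i = 0) \<and> \<bar>x 0\<bar> \<le> 1"
    "x \<in> disk_interior 1 \<longleftrightarrow> (\<forall>i\<ge>1. x i = 0) \<and> \<bar>x 0\<bar> < 1"
    "x \<in> disk_boundary 1 \<longleftrightarrow> (\<forall>i\<ge>1. x i = 0) \<and> (x 0 = 1 \<or> x 0 = -1)"
proof -
  have s: "(\<Sum>i<1. (x i)\<^sup>2) = (x 0)\<^sup>2" by (simp add: One_nat_def)
  show "x \<in> disk_set 1 \<longleftrightarrow> (\<forall>i\<ge>1. x i = 0) \<and> \<bar>x 0\<bar> \<le> 1"
    unfolding disk_set_alt mem_Collect_eq s abs_square_le_1 ..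
  show "x \<in> disk_interior 1 \<longleftrightarrow> (\<forall>i\<ge>1. x i = 0) \<and> \<bar>x 0\<bar> < 1"
    unfolding disk_interior_alt mem_Collect_eq s abs_square_less_1 ..
  show "x \<in> disk_boundary 1 \<longleftrightarrow> (\<forall>i\<ge>1. x i = 0) \<and> (x 0 = 1 \<or> x 0 = -1)"
    unfolding disk_boundary_alt mem_Collect_eq s power2_eq_1_iff ..
qed

lemma loop_range: "x \<in> disk_set 1 \<Longrightarrow> 0 \<le> pi * (x 0 + 1) \<and> pi * (x 0 + 1) \<le> 2 * pi"
  "x \<in> disk_interior 1 \<Longrightarrow> 0 < pi * (x 0 + 1) \<and> pi * (x 0 + 1) < 2 * pi"
proof -
  assume "x \<in> disk_set 1"
  then have "0 \<le> x 0 + 1" "x 0 + 1 \<le> 2" by (auto simp: disk_1 abs_le_iff)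
  then show "0 \<le> pi * (x 0 + 1) \<and> pi * (x 0 + 1) \<le> 2 * pi"
    using mult_left_mono[of "x 0 + 1" 2 pi] by simp
next
  assume "x \<in> disk_interior 1"
  then have "0 < x 0 + 1" "x 0 + 1 < 2" by (auto simp: disk_1 abs_less_iff)
  then show "0 < pi * (x 0 + 1) \<and> pi * (x 0 + 1) < 2 * pi"
    using mult_strict_left_mono[of "x 0 + 1" 2 pi] by simp
qed

lemma circ_inj:
  assumes "circ s = circ t" "\<bar>s - t\<bar> < 2 * pi"
  shows "s = t"
proof -
  obtain n :: int where n: "s - t = 2 * pi * n" using circ_eq_imp[OF assms(1)] by metis
  then have "\<bar>real_of_int n\<bar> * (2 * pi) < 1 * (2 * pi)" using assms(2) by (simp add: abs_mult mult.commute)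
  then have "\<bar>real_of_int n\<bar> < 1" using mult_less_cancel_right_pos[of "2 * pi"] by simp
  then have "n = 0" by linarith
  then show ?thesis using n by simp
qed

lemma loop_props:
  "continuous_map (disk 1) circle loop" "inj_on loop (disk_interior 1)" "loop ` disk_boundary 1 = {circ 0}"
  "loop ` disk_interior 1 = disk_boundary 2 - {circ 0}"
proof -
  have "continuous_on (disk_set 1) loop"
    unfolding loop_def by (intro continuous_on_circ continuous_intros)
  then show "continuous_map (disk 1) circle loop" by (auto simp: disk_eq loop_def)
  show "inj_on loop (disk_interior 1)"
  proof (rule inj_onI)
    fix x y assume x: "x \<in> disk_interior 1" and y: "y \<in> disk_interior 1" and eq: "loop x = loop y"
    have "\<bar>pi * (x 0 + 1) - pi * (y 0 + 1)\<bar> < 2 * pi" using loop_range(2)[OF x] loop_range(2)[OF y] by linarith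
    then have "pi * (x 0 + 1) = pi * (y 0 + 1)" using circ_inj eq unfolding loop_def by blast
    then have "x 0 = y 0" by simp
    moreover have "x i = y i" if "i \<noteq> 0" for i
    proof -
      have "i \<ge> 1" using that by simp
      then show ?thesis using x y unfolding disk_1 by metis
    qed
    ultimately show "x = y" by (metis ext)
  qed
  have "circ (2 * pi) = circ 0" using circ_periodic[of 0 1] by simp
  then have "loop x = circ 0" if "x \<in> disk_boundary 1" for x
    using that by (auto simp: disk_1 loop_def mult.commute)
  moreover have "(\<lambda>i. if i = 0 then 1 else 0) \<in> disk_boundary 1" by (simp add: disk_1)
  ultimately show "loop ` disk_boundary 1 = {circ 0}" by (metis (no_types, lifting) image_cong image_constant)
  show "loop ` disk_interior 1 = disk_boundary 2 - {circ 0}"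
  proof
    have "loop x \<noteq> circ 0" if x: "x \<in> disk_interior 1" for x
      using circ_inj[of "pi * (x 0 + 1)" 0] loop_range(2)[OF x] by (auto simp: loop_def)
    then show "loop ` disk_interior 1 \<subseteq> disk_boundary 2 - {circ 0}" by (auto simp: loop_def)
    show "disk_boundary 2 - {circ 0} \<subseteq> loop ` disk_interior 1"
    proof
      fix u assume u: "u \<in> disk_boundary 2 - {circ 0}"
      then obtain t where t: "0 \<le> t" "t < 2 * pi" "u = circ t" using circle_point by blast
      then have t0: "t > 0" using u by (cases "t = 0") auto
      let ?x = "\<lambda>i::nat. if i = 0 then t / pi - 1 else 0"
      have "t / pi < 2" "t / pi > 0" using t t0 by (simp_all add: divide_less_eq)
      then have "?x \<in> disk_interior 1" by (simp add: disk_1 abs_less_iff)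
      moreover have "loop ?x = u" by (simp add: loop_def t)
      ultimately show "u \<in> loop ` disk_interior 1" by (metis imageI)
    qed
  qed
qed

text \<open>\<open>loop\<close> is the characteristic map of the 1-cell, so
  \<open>relative_homology_cell_iso\<close> computes the homology of the circle relative to a
  point.\<close>

lemma cell_pair_circle: "cell_pair circle {circ 0} 1 loop"
  unfolding cell_pair_def
proof (intro conjI)
  show "Hausdorff_space circle" by (simp add: Hausdorff_space_subtopology)
  have "compact_space (subtopology (disk 2) (disk_boundary 2))"
    using closedin_compact_space[OF compact_space_disk closedin_disk_boundary] by (simp add: compact_space_subtopology)
  then show "compact_space circle" by (simp add: sphere_eq)
  show "closedin circle {circ 0}"
    using closedin_Hausdorff_singleton[of circle "circ 0"] by (simp add: Hausdorff_space_subtopology)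
  show "topspace circle = {circ 0} \<union> loop ` disk_set 1"
    using loop_props(3,4) by (auto simp: disk_set_split image_Un)
qed (use loop_props in auto)

text \<open>The affine 1-simplex from \<open>-1\<close> to \<open>1\<close> in the 1-disk;
  \<open>loop\<close> carries it to the arc that runs once around.\<close>

definition interval_simplex :: "(nat \<Rightarrow> real) \<Rightarrow> point" where
  "interval_simplex = restrict (\<lambda>v i. if i = 0 then v 1 - v 0 else 0) (standard_simplex 1)"

lemma interval_simplex_faces:
  "singular_face 1 j interval_simplex = restrict (\<lambda>v i. if i = 0 then (if j = 0 then 1 else -1) else 0) (standard_simplex 0)"
  if "j \<le> 1" for j
proof -
  have "singular_face 1 j interval_simplex = restrict (\<lambda>v i. if i = 0 then simplical_face j v 1 - simplical_face j v 0 else 0) (standard_simplex 0)"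
    unfolding interval_simplex_def using that by (subst singular_face_of_restrict) simp_all
  also have "\<dots> = restrict (\<lambda>v i. if i = 0 then (if j = 0 then 1 else -1) else 0) (standard_simplex 0)"
  proof (rule restrict_ext)
    fix v :: "nat \<Rightarrow> real" assume v: "v \<in> standard_simplex 0"
    have "simplical_face j v 1 - simplical_face j v 0 = (if j = 0 then 1 else -1)"
      using that standard_simplex_0'[OF v] by (simp add: simplical_face_def)
    then show "(\<lambda>i. if i = 0 then simplical_face j v 1 - simplical_face j v 0 else 0) =
        (\<lambda>i. if i = 0 then (if j = 0 then 1 else -1) else 0)"
      by (simp only:)
  qed
  finally show ?thesis .
qed

text \<open>A path in the two-point space is constant, since otherwise coordinate 0 would also take
  the value 0. Hence 1-chains there have boundary zero.\<close>

lemma sphere_0_simplex_faces: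
  assumes f: "singular_simplex 1 (top_of_set (disk_boundary 1)) f"
  shows "singular_face 1 0 f = singular_face 1 1 f"
proof -
  have c: "continuous_on (standard_simplex 1) f" and im: "f ` standard_simplex 1 \<subseteq> disk_boundary 1"
    using f by (auto simp: singular_simplex_def euclidean_product_topology)
  have "connected (standard_simplex 1)"
    using connectedin_standard_simplex[of 1] by (simp add: euclidean_product_topology)
  moreover have "continuous_on (standard_simplex 1) (\<lambda>v. f v 0)"
    using continuous_on_compose2[OF continuous_on_coord[of UNIV 0] c] by simp
  ultimately have con: "connected ((\<lambda>v. f v 0) ` standard_simplex 1)" using connected_continuous_image by blast
  have "f v 0 = f w 0" if v: "v \<in> standard_simplex 1" and w: "w \<in> standard_simplex 1" for v w
  proof (rule ccontr)
    assume ne: "f v 0 \<noteq> f w 0"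
    have "f v 0 = 1 \<or> f v 0 = -1" "f w 0 = 1 \<or> f w 0 = -1"
      using im v w by (auto simp: disk_1)
    then have "1 \<in> (\<lambda>v. f v 0) ` standard_simplex 1" "-1 \<in> (\<lambda>v. f v 0) ` standard_simplex 1"
      using ne v w by (metis (no_types, lifting) imageI)+
    then have "0 \<in> (\<lambda>v. f v 0) ` standard_simplex 1" using connectedD_interval[OF con, of "-1" 1 0] by simp
    then obtain u where "u \<in> standard_simplex 1" "f u 0 = 0" by auto
    then show False using im by (auto simp: disk_1)
  qed
  moreover have "f v i = 0" if "v \<in> standard_simplex 1" "i \<noteq> 0" for v i
    using im that by (auto simp: disk_1)
  ultimately have const: "f v = f w" if "v \<in> standard_simplex 1" "w \<in> standard_simplex 1" for v w
    using that by (metis ext)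
  have "simplical_face j v \<in> standard_simplex 1" if "v \<in> standard_simplex 0" "j \<le> 1" for v j
    using simplical_face_in_standard_simplex[of 1 j v] that by simp
  then show ?thesis
    unfolding singular_face_def by (intro restrict_ext) (auto intro!: const)
qed

text \<open>If it were trivial, then by \<open>relative_homology_cell_iso\<close> so would be the
  class of the interval relative to its end points. The boundary of the interval, the point
  \<open>1\<close> minus the point \<open>-1\<close>, would then bound in the two-point sphere,
  where every 1-chain has boundary zero.\<close>

lemma arc_class_nontrivial: "arc_class 1 \<noteq> \<one>\<^bsub>homology_group 1 circle\<^esub>"
proof
  assume triv: "arc_class 1 = \<one>\<^bsub>homology_group 1 circle\<^esub>"
  let ?D = "disk 1" and ?B = "disk_boundary 1"
  let ?l = "frag_of interval_simplex"
  have faces: "chain_boundary 1 ?l = frag_of (singular_face 1 0 interval_simplex) - frag_of (singular_face 1 1 interval_simplex)"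
    by (rule chain_boundary_1)
  have "continuous_on (standard_simplex 1) (\<lambda>v i. if (i::nat) = 0 then v 1 - v 0 else 0 :: real)"
  proof (rule continuous_on_coordinatewise_then_product)
    show "continuous_on (standard_simplex 1) (\<lambda>v. if i = 0 then v 1 - v 0 else 0 :: real)" for i :: nat
      by (cases "i = 0") (auto intro!: continuous_intros)
  qed
  then have sl: "singular_simplex 1 ?D interval_simplex"
    unfolding interval_simplex_def disk_eq
  proof (rule singular_simplex_restrict)
    have "\<bar>v 1 - v 0\<bar> \<le> 1" if "v \<in> standard_simplex 1" for v
    proof -
      have "0 \<le> v 0" "v 0 \<le> 1" "0 \<le> v 1" "v 1 \<le> 1" using that by (simp_all add: standard_simplex_def)
      then show ?thesis by (simp add: abs_le_iff)
    qed
    then show "(\<lambda>v i. if (i::nat) = 0 then v 1 - v 0 else 0) ` standard_simplex 1 \<subseteq> disk_set 1"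
      by (auto simp: disk_1)
  qed
  have "singular_simplex 0 (top_of_set ?B) (singular_face 1 j interval_simplex)" if "j \<le> 1" for j
    unfolding interval_simplex_faces[OF that]
    by (rule singular_simplex_restrict) (auto simp: disk_1 continuous_on_const)
  then have "singular_chain 0 (subtopology ?D ?B) (chain_boundary 1 ?l)"
    unfolding faces sphere_eq by (intro singular_chain_diff) (simp_all add: singular_chain_of)
  then have cyc: "singular_relcycle 1 ?D ?B ?l"
    using sl by (simp add: singular_relcycle singular_chain_of)
  let ?c = "homologous_rel_set 1 ?D ?B ?l"
  have cc: "?c \<in> carrier (relative_homology_group 1 ?D ?B)"
    using carrier_relative_homology_group[of 1 ?D ?B] cyc by auto
  have "simplex_map 1 loop interval_simplex = arc 0 (real 1)"
  proof -
    have "loop (\<lambda>i. if i = 0 then v 1 - v 0 else 0) = circ (2 * pi * v 1)" if "v \<in> standard_simplex 1" for v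
    proof -
      have e: "v 1 - v 0 + 1 = 2 * v 1" using standard_simplex_1[OF that] by simp
      have "loop (\<lambda>i. if i = 0 then v 1 - v 0 else 0) = circ (pi * (v 1 - v 0 + 1))" by (simp add: loop_def)
      then show ?thesis unfolding e by (simp add: mult.left_commute mult.assoc)
    qed
    then show ?thesis
      by (auto simp: simplex_map_def interval_simplex_def arc_def restrict_def fun_eq_iff)
  qed
  then have "hom_induced (int 1) ?D ?B circle {circ 0} loop ?c = homologous_rel_set 1 circle {circ 0} (frag_of (arc 0 (real 1)))"
    using hom_induced_chain_map[OF loop_props(1) _ cyc, of "{circ 0}"] loop_props(3) by (auto simp: Pi_iff)
  moreover have "hom_induced (int 1) circle {} circle {circ 0} id (arc_class 1) =
      homologous_rel_set 1 circle {circ 0} (frag_of (arc 0 (real 1)))"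
  proof -
    have "chain_map 1 id (frag_of (arc 0 (real 1))) = frag_of (arc 0 (real 1))"
      by (simp add: arc_def)
    then show ?thesis
      unfolding arc_class_def
      using hom_induced_chain_map[OF continuous_map_id _ arc_cycle[of 1], of "{circ 0}"] by simp
  qed
  moreover have "hom_induced 1 circle {} circle {circ 0} id (arc_class 1) = \<one>\<^bsub>relative_homology_group 1 circle {circ 0}\<^esub>"
    unfolding triv by (rule hom_one[OF hom_induced_hom]) simp_all
  ultimately have "hom_induced 1 ?D ?B circle {circ 0} loop ?c = \<one>\<^bsub>relative_homology_group 1 circle {circ 0}\<^esub>"
    by simp
  moreover have "hom_induced 1 ?D ?B circle {circ 0} loop \<one>\<^bsub>relative_homology_group 1 ?D ?B\<^esub> = \<one>\<^bsub>relative_homology_group 1 circle {circ 0}\<^esub>"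
    by (rule hom_one[OF hom_induced_hom]) simp_all
  moreover have "inj_on (hom_induced 1 ?D ?B circle {circ 0} loop) (carrier (relative_homology_group 1 ?D ?B))"
    using relative_homology_cell_iso[OF cell_pair_circle, of 1] by (simp add: iso_iff)
  moreover have "\<one>\<^bsub>relative_homology_group 1 ?D ?B\<^esub> \<in> carrier (relative_homology_group 1 ?D ?B)"
    by (simp add: group.is_monoid monoid.one_closed)
  ultimately have "?c = \<one>\<^bsub>relative_homology_group 1 ?D ?B\<^esub>"
    using cc by (metis inj_onD)
  then have "hom_boundary 1 ?D ?B ?c = \<one>\<^bsub>homology_group 0 (subtopology ?D ?B)\<^esub>"
    using hom_one[OF hom_boundary_hom[of 1 ?D ?B]] by simp
  moreover have "hom_boundary (int 1) ?D ?B ?c = homologous_rel_set 0 (subtopology ?D ?B) {} (chain_boundary 1 ?l)"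
    using hom_boundary_chain_boundary[OF cyc] by simp
  moreover have "\<one>\<^bsub>homology_group 0 (subtopology ?D ?B)\<^esub> = singular_relboundary_set 0 (subtopology ?D ?B) {}"
    using one_relative_homology_group[of 0] by simp
  ultimately have "singular_relboundary 0 (top_of_set ?B) {} (chain_boundary 1 ?l)"
    using homologous_rel_set_eq_relboundary[of 0 "top_of_set ?B" "{}"] by (simp add: sphere_eq)
  then obtain d where d: "singular_chain 1 (top_of_set ?B) d" "chain_boundary 1 d = chain_boundary 1 ?l"
    unfolding singular_boundary by (auto simp: One_nat_def)
  have "chain_boundary 1 d = 0"
  proof -
    have "{..1::nat} = {0, 1}" by auto
    moreover have "singular_face 1 0 f = singular_face 1 1 f" if "f \<in> Poly_Mapping.keys d" for f
      using d(1) that sphere_0_simplex_faces by (auto simp: singular_chain_def)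
    ultimately show ?thesis
      unfolding chain_boundary_def by (simp add: frag_extend_eq_0)
  qed
  then have "frag_of (singular_face 1 0 interval_simplex) = frag_of (singular_face 1 1 interval_simplex)"
    using d(2) faces by simp
  then have "singular_face 1 0 interval_simplex = singular_face 1 1 interval_simplex"
    by (metis frag_of_eq)
  \<comment> \<open>Evaluation at the only point of the standard 0-simplex: coordinate 0 of the two
    faces is \<open>1\<close> and \<open>-1\<close>.\<close>
  then have "singular_face 1 0 interval_simplex (\<lambda>j. if j = 0 then 1 else 0) 0 = singular_face 1 1 interval_simplex (\<lambda>j. if j = 0 then 1 else 0) 0"
    by simp
  then show False by (simp add: interval_simplex_faces standard_simplex_0)
qed

text \<open>The formula holds for the winding class, which is the power of \<open>u\<close> with
  some exponent \<open>c \<noteq> 0\<close>. If the image of \<open>u\<close> has exponent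
  \<open>m\<close>, comparison of exponents gives \<open>m * c = c * k\<close>, and \<open>c\<close>
  cancels.\<close>

lemma power_map_degree:
  assumes u: "generates (homology_group 1 circle) u" and inf: "infinite_order (homology_group 1 circle) u"
  shows "hom_induced 1 circle {} circle {} (power_map k) u = u [^]\<^bsub>homology_group 1 circle\<^esub> (int k)"
proof -
  let ?G = "homology_group 1 circle" and ?f = "hom_induced 1 circle {} circle {} (power_map k)"
  interpret G: group ?G by simp
  have hom: "?f \<in> hom ?G ?G" by (simp add: hom_induced_hom)
  have uc: "u \<in> carrier ?G" using u by (simp add: generates_def)
  obtain c :: int where c: "arc_class 1 = u [^]\<^bsub>?G\<^esub> c" using u arc_class_carrier[of 1] unfolding generates_def by blast
  have "?f u \<in> carrier ?G" by (rule hom_induced_carrier)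
  then obtain m :: int where m: "?f u = u [^]\<^bsub>?G\<^esub> m" using u unfolding generates_def by blast
  have c0: "c \<noteq> 0" using arc_class_nontrivial c by (metis int_pow_0)
  have "u [^]\<^bsub>?G\<^esub> (m * c) = ?f (arc_class 1)"
    unfolding c using hom_int_pow[OF hom uc G.is_group G.is_group] m G.int_pow_pow[OF uc] by simp
  also have "\<dots> = arc_class 1 [^]\<^bsub>?G\<^esub> (int k)" by (simp add: power_map_arc_class int_pow_int)
  also have "\<dots> = u [^]\<^bsub>?G\<^esub> (c * int k)" unfolding c using G.int_pow_pow[OF uc] by simp
  finally have "u [^]\<^bsub>?G\<^esub> (m * c - c * int k) = \<one>\<^bsub>?G\<^esub>"
    using G.int_pow_diff[OF uc] G.r_inv G.int_pow_closed[OF uc] by simp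
  then have "m * c - c * int k = 0" using inf unfolding infinite_order_def by blast
  then have "m = int k" using c0 by (simp add: mult.commute)
  then show ?thesis using m by simp
qed

section \<open>Null homotopies\<close>

lemma of_to_complex: "x \<in> disk_set 2 \<Longrightarrow> of_complex (to_complex x) = x"
  by (auto simp: of_complex_def to_complex_def disk_set_2 fun_eq_iff)

lemma of_complex_in_disk: "cmod z \<le> 1 \<Longrightarrow> of_complex z \<in> disk_set 2"
  using power_le_one[of "cmod z" 2] by (simp add: disk_set_2 of_complex_def cmod_power2)

lemma of_complex_in_circle: "cmod z = 1 \<Longrightarrow> of_complex z \<in> disk_boundary 2"
  using cmod_power2[of z] by (simp add: disk_boundary_2 of_complex_def)

lemma cmod_to_complex: "x \<in> disk_boundary 2 \<Longrightarrow> cmod (to_complex x) = 1"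
  by (simp add: disk_boundary_2 to_complex_def complex_norm)

lemma circ_0: "of_complex 1 = circ 0"
  by (simp add: circ_of_complex)

lemma power_map_circ_0: "power_map k (circ 0) = circ 0"
  by (simp add: power_map_circ)

lemma power_map_1: "x \<in> disk_boundary 2 \<Longrightarrow> power_map 1 x = x"
  using of_to_complex[of x] by (simp add: power_map_def disk_set_split)

lemma cmod_convex_1:
  assumes "cmod w \<le> 1" "s \<in> {0..1}"
  shows "cmod (of_real (1 - s) * w + of_real s) \<le> 1"
proof -
  have "cmod (of_real (1 - s) * w + of_real s) \<le> cmod (of_real (1 - s) * w) + cmod (of_real s :: complex)"
    by (rule norm_triangle_ineq)
  also have "\<dots> = (1 - s) * cmod w + s" using assms(2) by (simp only: norm_mult norm_of_real) simp
  also have "\<dots> \<le> (1 - s) * 1 + s" using assms by (intro add_right_mono mult_left_mono) auto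
  finally show ?thesis by simp
qed

lemma continuous_on_snd_coord: "continuous_on A (\<lambda>z::real \<times> point. snd z j)"
  using continuous_on_compose2[OF continuous_on_coord[of UNIV j] continuous_on_snd[OF continuous_on_id]] by auto

lemma continuous_on_to_complex_snd: "continuous_on A (\<lambda>z::real \<times> point. to_complex (snd z))"
  by (intro continuous_on_to_complex continuous_on_snd continuous_on_id)

text \<open>The disk is contracted to its boundary point 1 and not to its centre, so that in the
  applications every null homotopy ends at \<open>circ 0\<close>.\<close>

lemma continuous_map_contraction:
  assumes w: "continuous_on A w" "\<And>z. z \<in> A \<Longrightarrow> cmod (w z) \<le> 1" "\<And>z. z \<in> A \<Longrightarrow> fst z \<in> {0..1}"
    and \<phi>: "continuous_map (disk 2) T \<phi>"
  shows "continuous_map (top_of_set A) T (\<lambda>z. \<phi> (of_complex (of_real (1 - fst z) * w z + of_real (fst z))))"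
proof -
  have "continuous_on A (\<lambda>z. of_complex (of_real (1 - fst z) * w z + of_real (fst z)))"
    by (intro continuous_on_of_complex continuous_intros w)
  then have "continuous_map (top_of_set A) (disk 2) (\<lambda>z. of_complex (of_real (1 - fst z) * w z + of_real (fst z)))"
    using of_complex_in_disk[OF cmod_convex_1[OF w(2,3)]] by (auto simp: disk_eq)
  then show ?thesis using continuous_map_compose[OF _ \<phi>] by (simp add: o_def)
qed

lemma null_homotopy_1:
  assumes \<phi>: "continuous_map (disk 2) T \<phi>" and bd: "\<And>x. x \<in> disk_boundary 2 \<Longrightarrow> \<phi> x = x"
  shows "homotopic_with (\<lambda>_. True) circle T (\<lambda>x. x) (\<lambda>x. circ 0)"
proof (subst homotopic_with)
  let ?H = "\<lambda>z::real \<times> point. \<phi> (of_complex (of_real (1 - fst z) * to_complex (snd z) + of_real (fst z)))"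
  have "continuous_map (top_of_set ({0..1} \<times> disk_boundary 2)) T ?H"
    by (rule continuous_map_contraction[OF _ _ _ \<phi>])
      (auto simp: cmod_to_complex intro!: continuous_on_to_complex_snd continuous_intros)
  moreover have "?H (0, x) = x" if "x \<in> disk_boundary 2" for x
    using that bd of_to_complex[of x] by (simp add: disk_set_split)
  moreover have "?H (1, x) = circ 0" for x
    using bd[of "circ 0"] by (simp add: circ_0)
  ultimately show "\<exists>h. continuous_map (prod_topology (top_of_set {0..1::real}) circle) T h \<and>
      (\<forall>x\<in>topspace circle. h (0, x) = x) \<and> (\<forall>x\<in>topspace circle. h (1, x) = circ 0) \<and> (\<forall>t\<in>{0..1}. True)"
    by (intro exI[of _ ?H]) (simp add: prod_topology_subtopology_eu)
qed simp

text \<open>With \<open>\<theta> = arccos (Re z)\<close> the map \<open>z \<mapsto> z exp (9 i \<theta>)\<close> is \<open>z^10\<close> on the upper half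
  circle and \<open>z^(-8)\<close> on the lower one. The first is a fifth power of a loop, the second a square of a
  loop, so both extend over disks when fifth and second powers of the circle bound disks.\<close>

definition twist :: "point \<Rightarrow> point" where
  "twist x = of_complex (to_complex x * cis (9 * arccos (x 0)))"

lemma circle_coord_bounds: "x \<in> disk_boundary 2 \<Longrightarrow> -1 \<le> x 0 \<and> x 0 \<le> 1"
proof -
  assume "x \<in> disk_boundary 2"
  then have "(x 0)\<^sup>2 + (x 1)\<^sup>2 = 1" by (simp add: disk_boundary_2)
  moreover have "(x 1)\<^sup>2 \<ge> 0" by simp
  ultimately have "(x 0)\<^sup>2 \<le> 1" by linarith
  then show ?thesis by (simp add: abs_square_le_1 abs_le_iff minus_le_iff)
qed

text \<open>The exponent grows linearly from zero; \<open>arccos (x 0)\<close> is continuous on the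
  whole circle, unlike a choice of angle.\<close>

lemma homotopic_twist: "homotopic_with (\<lambda>_. True) circle circle (\<lambda>x. x) twist"
proof (subst homotopic_with)
  let ?H = "\<lambda>z::real \<times> point. of_complex (to_complex (snd z) * cis (9 * fst z * arccos (snd z 0)))"
  have "continuous_on ({0..1} \<times> disk_boundary 2) ?H"
    using circle_coord_bounds
    by (intro continuous_on_of_complex continuous_on_to_complex_snd continuous_on_mult continuous_on_cis
      continuous_on_const continuous_on_fst continuous_on_id continuous_on_arccos continuous_on_snd_coord) auto
  moreover have "?H z \<in> disk_boundary 2" if "z \<in> {0..1} \<times> disk_boundary 2" for z
    using that by (intro of_complex_in_circle) (auto simp: norm_mult cmod_to_complex)
  ultimately have "continuous_map (top_of_set ({0..1} \<times> disk_boundary 2)) circle ?H"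
    by auto
  moreover have "?H (0, x) = x" if "x \<in> disk_boundary 2" for x
    using that of_to_complex[of x] by (simp add: disk_set_split)
  ultimately show "\<exists>h. continuous_map (prod_topology (top_of_set {0..1::real}) circle) circle h \<and>
      (\<forall>x\<in>topspace circle. h (0, x) = x) \<and> (\<forall>x\<in>topspace circle. h (1, x) = twist x) \<and> (\<forall>t\<in>{0..1}. True)"
    by (intro exI[of _ ?H]) (simp add: twist_def prod_topology_subtopology_eu)
qed simp

lemma twist_upper:
  assumes x: "x \<in> disk_boundary 2" "0 \<le> x 1"
  shows "twist x = power_map 5 (of_complex ((to_complex x)\<^sup>2))"
proof -
  let ?t = "arccos (x 0)"
  have "(x 1)\<^sup>2 = 1 - (x 0)\<^sup>2" using x by (simp add: disk_boundary_2)
  then have "sqrt (1 - (x 0)\<^sup>2) = \<bar>x 1\<bar>" by (metis real_sqrt_abs)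
  then have "sin ?t = x 1" "cos ?t = x 0"
    using circle_coord_bounds[OF x(1)] x(2) by (simp_all add: sin_arccos)
  then have z: "to_complex x = cis ?t"
    by (simp add: to_complex_def complex_eq_iff)
  have "cis ?t * cis (9 * ?t) = ((cis ?t)\<^sup>2) ^ 5"
    by (simp add: cis_mult Complex.DeMoivre)
  then show ?thesis by (simp add: twist_def power_map_def z)
qed

text \<open>On the lower half the angle of \<open>x\<close> is \<open>- arccos (x 0)\<close>, so it
  is the conjugate of \<open>to_complex x\<close> that equals
  \<open>cis (arccos (x 0))\<close>.\<close>

lemma twist_lower:
  assumes x: "x \<in> disk_boundary 2" "x 1 \<le> 0"
  shows "twist x = power_map 2 (of_complex ((cnj (to_complex x)) ^ 4))"
proof -
  let ?t = "arccos (x 0)"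
  have "(x 1)\<^sup>2 = 1 - (x 0)\<^sup>2" using x by (simp add: disk_boundary_2)
  then have "sqrt (1 - (x 0)\<^sup>2) = \<bar>x 1\<bar>" by (metis real_sqrt_abs)
  then have "sin ?t = - x 1" "cos ?t = x 0"
    using circle_coord_bounds[OF x(1)] x(2) by (simp_all add: sin_arccos)
  then have z: "to_complex x = cis (- ?t)"
    by (simp add: to_complex_def complex_eq_iff)
  have "cis (- ?t) * cis (9 * ?t) = ((cis ?t) ^ 4)\<^sup>2"
    by (simp add: cis_mult Complex.DeMoivre)
  then show ?thesis by (simp add: twist_def power_map_def z cis_cnj)
qed

text \<open>The twist realises \<open>1 = 5 - 2 * 2\<close>: the upper half circle winds five times,
  as the fifth power of a simple loop, and the lower one minus four times, as the square of a double
  loop. The inner loops have the value 1 at both points where the halves meet, because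
  \<open>(9 + 1) / 5\<close> and \<open>(9 - 1) / 2\<close> are even, so their contractions agree
  there at all times; 9 is the least positive number with this property.\<close>

lemma null_homotopy_2:
  assumes \<psi>: "continuous_map (disk 2) T \<psi>" and \<psi>b: "\<And>x. x \<in> disk_boundary 2 \<Longrightarrow> \<psi> x = power_map 5 x"
    and \<phi>: "continuous_map (disk 2) T \<phi>" and \<phi>b: "\<And>x. x \<in> disk_boundary 2 \<Longrightarrow> \<phi> x = power_map 2 x"
    and inc: "continuous_map circle T (\<lambda>x. x)"
  shows "homotopic_with (\<lambda>_. True) circle T (\<lambda>x. x) (\<lambda>x. circ 0)"
proof -
  have "homotopic_with (\<lambda>_. True) circle T ((\<lambda>x. x) \<circ> (\<lambda>x. x)) ((\<lambda>x. x) \<circ> twist)"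
    by (rule homotopic_with_compose_continuous_map_left[OF homotopic_twist inc]) simp
  then have 1: "homotopic_with (\<lambda>_. True) circle T (\<lambda>x. x) twist" by (simp add: o_def)
  have "homotopic_with (\<lambda>_. True) circle T twist (\<lambda>x. circ 0)"
  proof (subst homotopic_with)
    let ?S = "{0..1::real} \<times> disk_boundary 2"
    let ?a = "\<lambda>z::real \<times> point. \<psi> (of_complex (of_real (1 - fst z) * (to_complex (snd z))\<^sup>2 + of_real (fst z)))"
    let ?b = "\<lambda>z::real \<times> point. \<phi> (of_complex (of_real (1 - fst z) * (cnj (to_complex (snd z))) ^ 4 + of_real (fst z)))"
    let ?H = "\<lambda>z. if 0 \<le> snd z 1 then ?a z else ?b z"
    have a: "continuous_map (top_of_set (?S \<inter> A)) T ?a" for A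
      by (rule continuous_map_contraction[OF _ _ _ \<psi>])
        (auto simp: cmod_to_complex norm_power intro!: continuous_on_to_complex_snd continuous_intros)
    have b: "continuous_map (top_of_set (?S \<inter> A)) T ?b" for A
      by (rule continuous_map_contraction[OF _ _ _ \<phi>])
        (auto simp: cmod_to_complex norm_power intro!: continuous_on_to_complex_snd continuous_intros)
    have c0: "\<psi> (of_complex 1) = circ 0" "\<phi> (of_complex 1) = circ 0"
      using \<psi>b[of "circ 0"] \<phi>b[of "circ 0"] by (simp_all add: circ_0 power_map_circ_0)
    have "continuous_map (top_of_set ?S) T ?H"
    proof (rule continuous_map_cases_le)
      show "continuous_map (subtopology (top_of_set ?S) {z \<in> topspace (top_of_set ?S). 0 \<le> snd z 1}) T ?a"
        "continuous_map (subtopology (top_of_set ?S) {z \<in> topspace (top_of_set ?S). snd z 1 \<le> 0}) T ?b"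
        using a b by (simp_all add: subtopology_subtopology)
      show "?a z = ?b z" if "z \<in> topspace (top_of_set ?S)" "0 = snd z 1" for z
      proof -
        have "snd z \<in> disk_boundary 2" "snd z 1 = 0" using that by auto
        then have "(snd z 0)\<^sup>2 = 1" by (simp add: disk_boundary_2)
        then have "snd z 0 = 1 \<or> snd z 0 = -1" by (simp add: power2_eq_1_iff)
        then have "to_complex (snd z) = 1 \<or> to_complex (snd z) = -1"
          using \<open>snd z 1 = 0\<close> by (auto simp: to_complex_def complex_eq_iff)
        then have "(to_complex (snd z))\<^sup>2 = 1" "(cnj (to_complex (snd z))) ^ 4 = 1" by auto
        then show ?thesis using c0 by simp
      qed
    qed (auto intro: continuous_on_snd_coord)
    moreover have "?H (0, x) = twist x" if x: "x \<in> disk_boundary 2" for x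
    proof (cases "0 \<le> x 1")
      case True
      have "of_complex ((to_complex x)\<^sup>2) \<in> disk_boundary 2"
        using x by (intro of_complex_in_circle) (simp add: norm_power cmod_to_complex)
      then show ?thesis using True twist_upper[OF x True] \<psi>b by simp
    next
      case False
      have "of_complex ((cnj (to_complex x)) ^ 4) \<in> disk_boundary 2"
        using x by (intro of_complex_in_circle) (simp add: norm_power cmod_to_complex)
      then show ?thesis using False twist_lower[OF x] \<phi>b by simp
    qed
    moreover have "?H (1, x) = circ 0" for x using c0 by simp
    ultimately show "\<exists>h. continuous_map (prod_topology (top_of_set {0..1::real}) circle) T h \<and>
        (\<forall>x\<in>topspace circle. h (0, x) = twist x) \<and> (\<forall>x\<in>topspace circle. h (1, x) = circ 0) \<and> (\<forall>t\<in>{0..1}. True)"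
      by (intro exI[of _ ?H]) (simp add: prod_topology_subtopology_eu)
  qed simp
  with 1 show ?thesis by (rule homotopic_with_trans)
qed

text \<open>Every power map factors through the inclusion of the circle, so all of them are
  homotopic to the same constant map.\<close>

lemma power_maps_homotopic:
  assumes "homotopic_with (\<lambda>_. True) circle T (\<lambda>x. x) (\<lambda>x. circ 0)"
  shows "homotopic_with (\<lambda>_. True) circle T (power_map v) (power_map w)"
proof -
  have "homotopic_with (\<lambda>_. True) circle T ((\<lambda>x. x) \<circ> power_map k) ((\<lambda>x. circ 0) \<circ> power_map k)" for k
    by (rule homotopic_with_compose_continuous_map_right[OF assms continuous_map_power_map]) simp
  then have "homotopic_with (\<lambda>_. True) circle T (power_map k) (\<lambda>x. circ 0)" for k by (simp add: o_def)
  then show ?thesis using homotopic_with_trans homotopic_with_symD by blast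
qed

section \<open>Complexes obtained from the circle\<close>

definition circle_complex :: "point cw" where
  "circle_complex = \<lparr>cw_space = circle,
     cw_cells = (\<lambda>m. if m = 0 then {{circ 0}} else if m = 1 then {disk_boundary 2 - {circ 0}} else {})\<rparr>"

lemma circle_complex_simps:
  "cw_space circle_complex = circle" "cw_points circle_complex = disk_boundary 2"
  "cw_cells circle_complex m = (if m = 0 then {{circ 0}} else if m = 1 then {disk_boundary 2 - {circ 0}} else {})"
  by (simp_all add: circle_complex_def cw_points_def)

lemma finite_circle_complex: "finite_cw circle_complex"
  unfolding finite_cw_def
proof (intro conjI allI ballI impI)
  show H: "Hausdorff_space (cw_space circle_complex)"
    by (simp add: circle_complex_simps Hausdorff_space_subtopology)
  have "{(m, e). e \<in> cw_cells circle_complex m} \<subseteq> {(0, {circ 0}), (1, disk_boundary 2 - {circ 0})}"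
    by (auto simp: circle_complex_simps split: if_splits)
  then show "finite {(m, e). e \<in> cw_cells circle_complex m}" by (rule finite_subset) simp
  have c: "e = {circ 0} \<and> m = 0 \<or> e = disk_boundary 2 - {circ 0} \<and> m = 1" if "e \<in> cw_cells circle_complex m" for e m
    using that by (auto simp: circle_complex_simps split: if_splits)
  have c0: "{circ 0} \<in> cw_cells circle_complex 0" and c1: "disk_boundary 2 - {circ 0} \<in> cw_cells circle_complex 1"
    by (simp_all add: circle_complex_simps)
  show "(\<Union>m. \<Union>(cw_cells circle_complex m)) = cw_points circle_complex"
  proof
    show "(\<Union>m. \<Union>(cw_cells circle_complex m)) \<subseteq> cw_points circle_complex"
      using c circ_in_circle[of 0] unfolding circle_complex_simps(2) by blast
    show "cw_points circle_complex \<subseteq> (\<Union>m. \<Union>(cw_cells circle_complex m))"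
      using c0 c1 unfolding circle_complex_simps(2) by blast
  qed
  show "e \<inter> e' = {}" if "e \<in> cw_cells circle_complex m \<and> e' \<in> cw_cells circle_complex m' \<and> (m, e) \<noteq> (m', e')" for m e m' e'
    using that c[of e m] c[of e' m'] by auto
  fix m e assume e: "e \<in> cw_cells circle_complex m"
  show "e \<subseteq> cw_points circle_complex" using c[OF e] by (auto simp: circle_complex_simps)
  show "\<exists>\<phi>. characteristic_map circle_complex m e \<phi>"
  proof (cases "m = 0")
    case True
    then have e0: "e = {circ 0}" using c[OF e] by simp
    have "disk_boundary 0 = {}" "disk_interior 0 = {\<lambda>i. 0}" by (auto simp: disk_boundary_alt disk_interior_alt)
    then have "characteristic_map circle_complex 0 e (\<lambda>x. circ 0)"
      unfolding e0 by (intro characteristic_mapI H) (auto simp: circle_complex_simps)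
    then show ?thesis using True by blast
  next
    case False
    then have m: "m = 1" "e = disk_boundary 2 - {circ 0}" using c[OF e] by auto
    have "characteristic_map circle_complex 1 e loop"
    proof (rule characteristic_mapI[OF H])
      have "(\<Union>k<1. \<Union>(cw_cells circle_complex k)) = {circ 0}" by (auto simp: circle_complex_simps)
      then show "loop ` disk_boundary 1 \<subseteq> (\<Union>k<1. \<Union>(cw_cells circle_complex k))" using loop_props(3) by simp
    qed (use loop_props m in \<open>auto simp: circle_complex_simps\<close>)
    then show ?thesis using m by blast
  qed
qed

lemma skeleton_mono:
  assumes "emb B C (\<lambda>x. x)" "k \<le> m"
  shows "skeleton B k \<subseteq> skeleton C m"
proof -
  have "cw_cells B l \<subseteq> cw_cells C l" for l using embD(5)[OF assms(1)] by auto
  then show ?thesis unfolding skeleton_def using assms(2) by (intro UN_mono Union_mono) auto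
qed

lemma cell_attached_disk_skeleton:
  assumes a: "cell_attached X Y m e \<phi>"
  shows "\<phi> ` disk_set m \<subseteq> skeleton Y m"
proof -
  note A = cell_attachedD[OF a]
  have "e \<subseteq> skeleton Y m" using A(8) unfolding skeleton_def by blast
  moreover have "(\<Union>k<m. \<Union>(cw_cells X k)) \<subseteq> skeleton X m" unfolding skeleton_def by (intro UN_mono) auto
  ultimately have "e \<union> \<phi> ` disk_boundary m \<subseteq> skeleton Y m"
    using order_trans[OF A(12)] skeleton_mono[OF A(7) order_refl] by (meson Un_least order_trans)
  then show ?thesis using A(11) by (simp add: disk_set_split image_Un)
qed

lemma circle_in_skeleton: "emb circle_complex X (\<lambda>x. x) \<Longrightarrow> disk_boundary 2 \<subseteq> skeleton X 1"
proof -
  assume "emb circle_complex X (\<lambda>x. x)"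
  moreover have "disk_boundary 2 \<subseteq> skeleton circle_complex 1"
  proof
    fix x assume x: "x \<in> disk_boundary 2"
    show "x \<in> skeleton circle_complex 1"
    proof (cases "x = circ 0")
      case True
      then show ?thesis unfolding skeleton_def by (intro UN_I[of 0]) (simp_all add: circle_complex_simps)
    next
      case False
      then show ?thesis using x unfolding skeleton_def by (intro UN_I[of 1]) (simp_all add: circle_complex_simps)
    qed
  qed
  ultimately show "disk_boundary 2 \<subseteq> skeleton X 1"
    using skeleton_mono[where B = circle_complex and C = X and k = 1 and m = 1] by blast
qed

lemma circle_inclusion_continuous: "emb circle_complex X (\<lambda>x. x) \<Longrightarrow> continuous_map circle (cw_space X) (\<lambda>x. x)"
  using embD(3)[of circle_complex X "\<lambda>x. x"] by (simp add: circle_complex_simps)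

lemma skeleton_less: "(\<Union>k<Suc m. \<Union>(cw_cells X k)) = skeleton X m"
  by (simp add: skeleton_def lessThan_Suc_atMost)

lemma attach_along_power_map:
  assumes C: "emb circle_complex X (\<lambda>x. x)" and room: "\<forall>x\<in>cw_points X. x 0 < r"
  obtains Y e \<phi> where "cell_attached X Y 2 e \<phi>" "\<And>x. x \<in> disk_boundary 2 \<Longrightarrow> \<phi> x = power_map w x"
    "\<forall>x\<in>cw_points Y. x 0 < r + 1"
proof -
  have f: "continuous_map (subtopology (disk 2) (disk_boundary 2)) (cw_space X) (power_map w)"
    unfolding sphere_eq
    using continuous_map_compose[OF continuous_map_power_map circle_inclusion_continuous[OF C]] by (simp add: o_def)
  have "power_map w ` disk_boundary 2 \<subseteq> disk_boundary 2"
    using continuous_map_image_subset_topspace[OF continuous_map_power_map] by simp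
  then have "power_map w ` disk_boundary 2 \<subseteq> skeleton X 1"
    using circle_in_skeleton[OF C] by blast
  then have fim: "power_map w ` disk_boundary 2 \<subseteq> (\<Union>k<2. \<Union>(cw_cells X k))"
    using skeleton_less[where X = X and m = 1] by (simp add: numeral_2_eq_2 One_nat_def)
  show thesis
    by (rule cell_attached_exists[where X = X and r = r and m = 2 and f = "power_map w", OF embD(2)[OF C] room f fim])
      (rule that)
qed

text \<open>The copy of \<open>K'\<close> in \<open>M\<close> consists of \<open>L\<close> and the
  new cell and meets \<open>K\<close> only in \<open>L\<close>. Thus a product with
  \<open>K'\<close> is formed by attaching the cell of \<open>K'\<close> once more, now to
  \<open>K\<close>.\<close>

lemma cell_attached_glues:
  assumes a: "cell_attached L K m e \<phi>" and a': "cell_attached L K' m e' \<phi>'" and a2: "cell_attached K M m e2 \<phi>2"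
    and bd: "\<And>x. x \<in> disk_boundary m \<Longrightarrow> \<phi>2 x = \<phi>' x"
  obtains f f' where "glues L K (\<lambda>x. x) K' (\<lambda>x. x) M (\<lambda>x. x) f f'"
proof -
  note A = cell_attachedD[OF a] and A' = cell_attachedD[OF a'] and A2 = cell_attachedD[OF a2]
  have LM: "emb L M (\<lambda>x. x)" using emb_compose[OF A(7) A2(7)] .
  obtain H where H: "continuous_map (cw_space K') (cw_space M) H" "\<And>x. x \<in> cw_points L \<Longrightarrow> H x = x"
    "\<And>x. x \<in> disk_set m \<Longrightarrow> H (\<phi>' x) = \<phi>2 x"
    using cell_attached_map[OF a' embD(3)[OF LM] A2(14) bd] by metis
  have H\<phi>: "H (\<phi>' x) = \<phi>2 x" if "x \<in> disk_interior m" for x using H(3) that by (simp add: disk_set_split)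
  have He: "H ` e' = e2"
    unfolding A'(11)[symmetric] A2(11)[symmetric] image_image using H\<phi> by (intro image_cong refl)
  have HL: "H ` cw_points L = cw_points L" using H(2) by (simp cong: image_cong)
  have LK: "cw_points L \<subseteq> cw_points K" using A(9) by blast
  have "H ` c \<in> cw_cells M k" if c: "c \<in> cw_cells K' k" for c k
  proof (cases "c \<in> cw_cells L k")
    case True
    then have "H ` c = c"
      using cell_subset_points[OF A(5) True] H(2) by force
    then show ?thesis using embD(5)[OF LM True] by simp
  next
    case False
    then have "k = m" "c = e'" using c by (auto simp: A'(3) split: if_splits)
    then show ?thesis using He A2(8) by simp
  qed
  moreover have "inj_on H (cw_points K')"
    unfolding A'(9)
  proof (rule inj_on_Un[THEN iffD2], intro conjI)
    show "inj_on H (cw_points L)" using H(2) by (simp add: inj_on_def)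
    show "inj_on H e'"
    proof (rule inj_onI)
      fix u v assume "u \<in> e'" "v \<in> e'" and eq: "H u = H v"
      then obtain x y where xy: "x \<in> disk_interior m" "y \<in> disk_interior m" "u = \<phi>' x" "v = \<phi>' y"
        using A'(11) by blast
      then have "\<phi>2 x = \<phi>2 y" using eq H\<phi> by simp
      then have "x = y" using inj_onD[OF A2(15)] xy by blast
      then show "u = v" using xy by simp
    qed
    have "H ` (cw_points L - e') \<subseteq> cw_points K" "H ` (e' - cw_points L) \<subseteq> e2"
      using HL He LK by blast+
    then show "H ` (cw_points L - e') \<inter> H ` (e' - cw_points L) = {}" using A2(10) by blast
  qed
  ultimately have "emb K' M H" using A'(6) A2(6) H(1) by (simp add: emb_def)
  moreover have "H ` cw_points K' = cw_points L \<union> e2" by (simp add: A'(9) image_Un HL He)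
  ultimately have "glues L K (\<lambda>x. x) K' (\<lambda>x. x) M (\<lambda>x. x) (\<lambda>x. x) H"
    using A2(7,9,10) H(2) LK by (auto simp: glues_def)
  then show thesis using that by blast
qed

text \<open>The null homotopy is required inside the 2-skeleton because the attaching sphere of the
  joining 3-cell has to lie there.\<close>

lemma attached_power_cells_deformation:
  fixes K :: "point cw"
  assumes L: "finite_cw L" and i: "emb L K i" and dim: "cw_dim_le K n" "2 \<le> n"
    and null: "homotopic_with (\<lambda>_. True) circle (subtopology (cw_space K) (skeleton K 2)) (\<lambda>x. x) (\<lambda>x. circ 0)"
    and a: "cell_attached K Y 2 e \<phi>" "\<And>x. x \<in> disk_boundary 2 \<Longrightarrow> \<phi> x = power_map v x"
    and a': "cell_attached K Y' 2 e' \<phi>'" "\<And>x. x \<in> disk_boundary 2 \<Longrightarrow> \<phi>' x = power_map w x"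
    and room: "\<forall>x\<in>cw_points Y. x 0 < r"
  shows "((Y, i), (Y', i)) \<in> deformation (n + 1) L"
proof -
  have "\<exists>h. continuous_map (prod_topology (top_of_set {0..1::real}) circle) (subtopology (cw_space K) (skeleton K 2)) h \<and>
      (\<forall>x. h (0, x) = power_map v x) \<and> (\<forall>x. h (1, x) = power_map w x) \<and> (\<forall>t\<in>{0..1::real}. True)"
    using power_maps_homotopic[OF null, of v w] unfolding homotopic_with_def .
  then obtain H where H: "continuous_map (prod_topology (top_of_set {0..1::real}) circle) (subtopology (cw_space K) (skeleton K 2)) H"
    "\<And>x. H (0, x) = power_map v x" "\<And>x. H (1, x) = power_map w x"
    by (elim exE conjE) metis
  have Hc: "continuous_map (prod_topology (top_of_set {0..1}) circle) (cw_space K) H"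
    using H(1) by (simp add: continuous_map_in_subtopology)
  have Hsk: "H (s, x) \<in> skeleton K 2" if "s \<in> {0..1::real}" "x \<in> disk_boundary 2" for s x
    using continuous_map_image_subset_topspace[OF H(1)] that by (auto simp: image_subset_iff)
  show ?thesis
    by (rule cell_attached_deformation[OF L i dim a(1) a'(1) room Hc Hsk]) (simp_all add: H a a')
qed

section \<open>The boundary classes of the two complexes\<close>

text \<open>Naturality of the boundary map along the characteristic map: the generator for the disk
  goes to \<open>h\<close>, and its boundary \<open>u\<close> goes to the image of \<open>u\<close>
  under the \<open>k\<close>-th power map, which \<open>power_map_degree\<close> evaluates.\<close>

lemma attached_boundary:
  assumes a: "cell_attached X Y 2 e \<phi>" and bd: "\<And>x. x \<in> disk_boundary 2 \<Longrightarrow> \<phi> x = power_map k x"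
    and C: "emb circle_complex X (\<lambda>x. x)"
    and g: "generates (relative_homology_group 2 (disk 2) (disk_boundary 2)) g"
      "infinite_order (relative_homology_group 2 (disk 2) (disk_boundary 2)) g"
      "generates (homology_group 1 circle) u" "infinite_order (homology_group 1 circle) u"
      "u = hom_boundary 2 (disk 2) (disk_boundary 2) g"
  obtains h where "generates (relative_homology_group 2 (cw_space Y) (cw_points X)) h"
    "infinite_order (relative_homology_group 2 (cw_space Y) (cw_points X)) h"
    "hom_boundary 2 (cw_space Y) (cw_points X) h =
      hom_induced 1 circle {} (cw_space X) {} id u [^]\<^bsub>homology_group 1 (cw_space X)\<^esub> (int k)"
proof -
  note A = cell_attachedD[OF a]
  let ?h = "hom_induced 2 (disk 2) (disk_boundary 2) (cw_space Y) (cw_points X) \<phi> g"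
  have iso: "hom_induced 2 (disk 2) (disk_boundary 2) (cw_space Y) (cw_points X) \<phi>
      \<in> iso (relative_homology_group 2 (disk 2) (disk_boundary 2)) (relative_homology_group 2 (cw_space Y) (cw_points X))"
    by (rule relative_homology_cell_iso[OF cell_pair_attached[OF a]])
  have gc: "g \<in> carrier (relative_homology_group 2 (disk 2) (disk_boundary 2))" using g(1) by (simp add: generates_def)
  have uc: "u \<in> carrier (homology_group 1 circle)" using g(3) by (simp add: generates_def)
  have 1: "generates (relative_homology_group 2 (cw_space Y) (cw_points X)) ?h"
    by (rule generates_iso[OF _ _ iso g(1)]) simp_all
  have 2: "infinite_order (relative_homology_group 2 (cw_space Y) (cw_points X)) ?h"
    by (rule infinite_order_iso[OF _ _ iso gc g(2)]) simp_all
  have inc: "continuous_map circle (cw_space X) id" using circle_inclusion_continuous[OF C] by (simp add: id_def)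
  have \<phi>bd: "\<phi> \<in> disk_boundary 2 \<rightarrow> cw_points X" using A(13) by blast
  have "hom_boundary 2 (cw_space Y) (cw_points X) ?h =
      hom_induced 1 (subtopology (disk 2) (disk_boundary 2)) {} (subtopology (cw_space Y) (cw_points X)) {} \<phi> u"
    unfolding g(5) using fun_cong[OF naturality_hom_induced[OF A(14) \<phi>bd, of 2], of g] by simp
  also have "\<dots> = hom_induced 1 circle {} (cw_space X) {} \<phi> u"
    unfolding sphere_eq A(16)[symmetric] ..
  also have "\<dots> = hom_induced 1 circle {} (cw_space X) {} (id \<circ> power_map k) u"
    using hom_induced_eq[of circle \<phi> "id \<circ> power_map k" 1 "{}"] bd by simp
  also have "\<dots> = hom_induced 1 circle {} (cw_space X) {} id (hom_induced 1 circle {} circle {} (power_map k) u)"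
    by (rule hom_induced_compose'[OF continuous_map_power_map _ inc, symmetric]) auto
  also have "\<dots> = hom_induced 1 circle {} (cw_space X) {} id (u [^]\<^bsub>homology_group 1 circle\<^esub> (int k))"
    by (simp only: power_map_degree[OF g(3,4)])
  also have "\<dots> = hom_induced 1 circle {} (cw_space X) {} id u [^]\<^bsub>homology_group 1 (cw_space X)\<^esub> (int k)"
    by (rule hom_int_pow[OF hom_induced_hom uc]) simp_all
  finally show thesis using that 1 2 by blast
qed

lemma exact_boundary:
  assumes "y \<in> carrier (homology_group 1 (subtopology T S))"
    and "hom_induced 1 (subtopology T S) {} T {} id y = \<one>\<^bsub>homology_group 1 T\<^esub>"
  obtains h where "h \<in> carrier (relative_homology_group 2 T S)" "y = hom_boundary 2 T S h"
proof -
  have "kernel (homology_group 1 (subtopology T S)) (homology_group 1 T) (hom_induced 1 (subtopology T S) {} T {} id)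
      = hom_boundary 2 T S ` carrier (relative_homology_group 2 T S)"
    using homology_exactness_axiom_2[of 2 T S] by simp
  moreover have "y \<in> kernel (homology_group 1 (subtopology T S)) (homology_group 1 T) (hom_induced 1 (subtopology T S) {} T {} id)"
    using assms by (simp add: kernel_def)
  ultimately show thesis using that by blast
qed

text \<open>If a multiple \<open>t s\<close> of the circle class vanishes in \<open>L\<close>,
  exactness makes \<open>t s\<close> in \<open>X\<close> the boundary of a multiple of the generator
  given by the 2-cell, that is, a multiple of \<open>5 s\<close>. The retraction of \<open>X\<close>
  onto the circle shows that \<open>s\<close> has infinite order in \<open>X\<close>, so
  \<open>t\<close> is that multiple of 5.\<close>

lemma circle_class_order:
  assumes a: "cell_attached X L 2 e \<psi>" and bd: "\<And>x. x \<in> disk_boundary 2 \<Longrightarrow> \<psi> x = power_map 5 x"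
    and C: "emb circle_complex X (\<lambda>x. x)"
    and r: "continuous_map (cw_space X) circle r" "\<And>x. x \<in> disk_boundary 2 \<Longrightarrow> r x = x"
    and g: "generates (relative_homology_group 2 (disk 2) (disk_boundary 2)) g"
      "infinite_order (relative_homology_group 2 (disk 2) (disk_boundary 2)) g"
      "generates (homology_group 1 circle) u" "infinite_order (homology_group 1 circle) u"
      "u = hom_boundary 2 (disk 2) (disk_boundary 2) g"
    and t: "hom_induced 1 circle {} (cw_space L) {} id u [^]\<^bsub>homology_group 1 (cw_space L)\<^esub> t = \<one>\<^bsub>homology_group 1 (cw_space L)\<^esub>"
  shows "(5::int) dvd t"
proof -
  note A = cell_attachedD[OF a]
  let ?GX = "homology_group 1 (cw_space X)" and ?GL = "homology_group 1 (cw_space L)" and ?G = "homology_group 1 circle"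
  let ?R = "relative_homology_group 2 (cw_space L) (cw_points X)"
  interpret GX: group ?GX by simp
  interpret G: group ?G by simp
  interpret R: group ?R by simp
  have uc: "u \<in> carrier ?G" using g(3) by (simp add: generates_def)
  define s where "s = hom_induced 1 circle {} (cw_space X) {} id u"
  have sc: "s \<in> carrier ?GX" unfolding s_def by (rule hom_induced_carrier)
  have incX: "continuous_map circle (cw_space X) id" using circle_inclusion_continuous[OF C] by (simp add: id_def)
  have incL: "continuous_map (cw_space X) (cw_space L) id" using embD(3)[OF A(7)] by (simp add: id_def)
  have hXL: "hom_induced 1 (cw_space X) {} (cw_space L) {} id \<in> hom ?GX ?GL" by (rule hom_induced_hom)
  have "hom_induced 1 (cw_space X) {} (cw_space L) {} id s = hom_induced 1 circle {} (cw_space L) {} (id \<circ> id) u"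
    unfolding s_def by (rule hom_induced_compose'[OF incX _ incL]) auto
  then have "hom_induced 1 (cw_space X) {} (cw_space L) {} id (s [^]\<^bsub>?GX\<^esub> t) = \<one>\<^bsub>?GL\<^esub>"
    using hom_int_pow[OF hXL sc] t by simp
  moreover have "s [^]\<^bsub>?GX\<^esub> t \<in> carrier ?GX" using sc by simp
  ultimately obtain h where h: "h \<in> carrier ?R" "s [^]\<^bsub>?GX\<^esub> t = hom_boundary 2 (cw_space L) (cw_points X) h"
    using exact_boundary[of "s [^]\<^bsub>?GX\<^esub> t" "cw_space L" "cw_points X"] unfolding A(16)[symmetric] by metis
  obtain h0 where h0: "generates ?R h0" "hom_boundary 2 (cw_space L) (cw_points X) h0 = s [^]\<^bsub>?GX\<^esub> (int 5)"
    using attached_boundary[OF a bd C g] unfolding s_def by metis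
  have h0c: "h0 \<in> carrier ?R" using h0(1) by (simp add: generates_def)
  obtain k :: int where k: "h = h0 [^]\<^bsub>?R\<^esub> k" using h0(1) h(1) unfolding generates_def by blast
  have hb: "hom_boundary 2 (cw_space L) (cw_points X) \<in> hom ?R ?GX"
    using hom_boundary_hom[of 2 "cw_space L" "cw_points X"] unfolding A(16)[symmetric] by simp
  have "s [^]\<^bsub>?GX\<^esub> t = (s [^]\<^bsub>?GX\<^esub> (int 5)) [^]\<^bsub>?GX\<^esub> k"
    unfolding h(2) k h0(2)[symmetric] by (rule hom_int_pow[OF hb h0c]) simp_all
  also have "\<dots> = s [^]\<^bsub>?GX\<^esub> (5 * k)" using GX.int_pow_pow[OF sc, of 5 k] by simp
  finally have st: "s [^]\<^bsub>?GX\<^esub> t = s [^]\<^bsub>?GX\<^esub> (5 * k)" .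
  let ?r = "hom_induced 1 (cw_space X) {} circle {} r"
  have hr: "?r \<in> hom ?GX ?G" by (rule hom_induced_hom)
  have "?r s = hom_induced 1 circle {} circle {} (r \<circ> id) u"
    unfolding s_def by (rule hom_induced_compose'[OF incX _ r(1)]) auto
  also have "\<dots> = hom_induced 1 circle {} circle {} id u"
    using hom_induced_eq[of circle "r \<circ> id" id 1 "{}"] r(2) by simp
  also have "\<dots> = u" by (rule hom_induced_id[OF uc])
  finally have rs: "?r s = u" .
  have "u [^]\<^bsub>?G\<^esub> t = u [^]\<^bsub>?G\<^esub> (5 * k)"
    using arg_cong[OF st, of ?r] hom_int_pow[OF hr sc] rs by simp
  then have "u [^]\<^bsub>?G\<^esub> (t - 5 * k) = \<one>\<^bsub>?G\<^esub>"
    using G.int_pow_diff[OF uc, of t "5 * k"] G.int_pow_closed[OF uc] G.r_inv by metis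
  then have "t - 5 * k = 0" using g(4) unfolding infinite_order_def by blast
  then show ?thesis by simp
qed

text \<open>The circle class \<open>s\<close> is a boundary class of \<open>K1\<close>, so a
  deformation would make it one of \<open>K2\<close>. There the generators have boundaries
  \<open>2 s\<close> and \<open>-2 s\<close>, so 5 would divide \<open>2 - 1\<close> or
  \<open>-2 - 1\<close>.\<close>

lemma power_complexes_not_deformation_equivalent:
  assumes a: "cell_attached X L 2 e \<psi>" "\<And>x. x \<in> disk_boundary 2 \<Longrightarrow> \<psi> x = power_map 5 x"
    and C: "emb circle_complex X (\<lambda>x. x)"
    and r: "continuous_map (cw_space X) circle r" "\<And>x. x \<in> disk_boundary 2 \<Longrightarrow> r x = x"
    and a1: "cell_attached L K1 2 e1 \<phi>1" "\<And>x. x \<in> disk_boundary 2 \<Longrightarrow> \<phi>1 x = power_map 1 x"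
    and a2: "cell_attached L K2 2 e2 \<phi>2" "\<And>x. x \<in> disk_boundary 2 \<Longrightarrow> \<phi>2 x = power_map 2 x"
  shows "((K1, \<lambda>x. x), (K2, \<lambda>x. x)) \<notin> deformation d L"
proof
  assume def: "((K1, \<lambda>x. x), (K2, \<lambda>x. x)) \<in> deformation d L"
  note A1 = cell_attachedD[OF a1(1)] and A2 = cell_attachedD[OF a2(1)]
  have CL: "emb circle_complex L (\<lambda>x. x)" using emb_compose[OF C cell_attachedD(7)[OF a(1)]] .
  let ?G = "homology_group 1 circle" and ?GL = "homology_group 1 (cw_space L)"
  let ?R = "relative_homology_group 2 (cw_space K2) (cw_points L)"
  interpret GL: group ?GL by simp
  interpret R: group ?R by simp
  obtain g u where g: "generates (relative_homology_group 2 (disk 2) (disk_boundary 2)) g"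
      "infinite_order (relative_homology_group 2 (disk 2) (disk_boundary 2)) g"
      "generates ?G u" "infinite_order ?G u" "u = hom_boundary 2 (disk 2) (disk_boundary 2) g"
    using circle_homology by metis
  define s where "s = hom_induced 1 circle {} (cw_space L) {} id u"
  have sc: "s \<in> carrier ?GL" unfolding s_def by (rule hom_induced_carrier)
  have ids: "hom_induced 1 (cw_space L) {} (cw_space L) {} (\<lambda>x. x) s = s"
    using hom_induced_id[OF sc] by (simp add: id_def)
  obtain h1 where h1: "generates (relative_homology_group 2 (cw_space K1) (cw_points L)) h1"
    "hom_boundary 2 (cw_space K1) (cw_points L) h1 = s [^]\<^bsub>?GL\<^esub> (int 1)"
    using attached_boundary[OF a1 CL g] unfolding s_def by metis
  have "boundary_class L K1 (\<lambda>x. x) s"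
    unfolding boundary_class_def image_ident A1(16)[symmetric] ids using h1 GL.int_pow_1[OF sc] by auto
  then have "boundary_class L K2 (\<lambda>x. x) s"
    by (rule boundary_class_deformation[OF A1(5) def])
  then obtain g' where g': "generates ?R g'" "hom_boundary 2 (cw_space K2) (cw_points L) g' = s"
    unfolding boundary_class_def image_ident A2(16)[symmetric] ids by blast
  obtain h2 where h2: "generates ?R h2" "infinite_order ?R h2"
    "hom_boundary 2 (cw_space K2) (cw_points L) h2 = s [^]\<^bsub>?GL\<^esub> (int 2)"
    using attached_boundary[OF a2 CL g] unfolding s_def by metis
  obtain k :: int where k: "g' = h2 [^]\<^bsub>?R\<^esub> k" "k = 1 \<or> k = -1"
    using generators_of_infinite_cyclic[OF R.is_group h2(1,2) g'(1)] by metis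
  have h2c: "h2 \<in> carrier ?R" using h2(1) by (simp add: generates_def)
  have hb: "hom_boundary 2 (cw_space K2) (cw_points L) \<in> hom ?R ?GL"
    using hom_boundary_hom[of 2 "cw_space K2" "cw_points L"] unfolding A2(16)[symmetric] by simp
  have "hom_boundary 2 (cw_space K2) (cw_points L) g' = (s [^]\<^bsub>?GL\<^esub> (int 2)) [^]\<^bsub>?GL\<^esub> k"
    unfolding k(1) h2(3)[symmetric] by (rule hom_int_pow[OF hb h2c]) simp_all
  then have "s = s [^]\<^bsub>?GL\<^esub> (2 * k)" using g'(2) GL.int_pow_pow[OF sc, of 2 k] by simp
  then have "s [^]\<^bsub>?GL\<^esub> (2 * k) = s [^]\<^bsub>?GL\<^esub> (1::int)" using GL.int_pow_1[OF sc] by simp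
  then have ord: "s [^]\<^bsub>?GL\<^esub> (2 * k - 1) = \<one>\<^bsub>?GL\<^esub>"
    using GL.int_pow_diff[OF sc, of "2 * k" 1] GL.int_pow_closed[OF sc] GL.r_inv by metis
  have "5 dvd 2 * k - 1"
    by (rule circle_class_order[OF a C r g ord[unfolded s_def]])
  then show False using k(2) by auto
qed

theorem theorem6p2:
  fixes n :: nat
  assumes "n \<ge> 3"
  shows "\<exists>(L :: point cw) (x :: point bounded_cw set \<Rightarrow>\<^sub>0 'k::comm_ring_1).
           finite_cw L \<and> cw_dim_eq L (n - 1) \<and>
           x \<in> kKL n L \<and> x \<noteq> 0 \<and> kKL_mult n L x x = 0"
proof -
  define N where "N = n - 1"
  have N: "2 \<le> N" "N \<le> n" using assms by (auto simp: N_def)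
  let ?i = "\<lambda>x::point. x"
  have C0: "finite_cw circle_complex" by (rule finite_circle_complex)
  \<comment> \<open>Coordinates on the circle are at most 1, so all levels from 2 on are
    free.\<close>
  have room0: "\<forall>x\<in>cw_points circle_complex. x 0 < 2"
    using circle_coord_bounds by (fastforce simp: circle_complex_simps)
  have "continuous_map (subtopology (disk N) (disk_boundary N)) (cw_space circle_complex) (\<lambda>x. circ 0)"
    by (simp add: circle_complex_simps)
  moreover have "(\<lambda>x. circ 0) ` disk_boundary N \<subseteq> (\<Union>k<N. \<Union>(cw_cells circle_complex k))"
  proof -
    have "circ 0 \<in> \<Union>(cw_cells circle_complex 0)" by (simp add: circle_complex_simps)
    then have "circ 0 \<in> (\<Union>k<N. \<Union>(cw_cells circle_complex k))" using N by (intro UN_I[of 0]) auto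
    then show ?thesis by blast
  qed
  ultimately obtain X e0 \<phi>0 where X: "cell_attached circle_complex X N e0 \<phi>0" "\<And>x. x \<in> disk_boundary N \<Longrightarrow> \<phi>0 x = circ 0"
    "\<forall>x\<in>cw_points X. x 0 < 2 + 1"
    by (rule cell_attached_exists[where X = circle_complex and r = 2 and m = N and f = "\<lambda>x. circ 0", OF C0 room0]) blast
  have CX: "emb circle_complex X ?i" using cell_attachedD(7)[OF X(1)] .
  \<comment> \<open>The \<open>N\<close>-cell is attached by a constant map, so the identity of the
    circle extends over it as a constant; this is the retraction \<open>r\<close>.\<close>
  have "continuous_map (cw_space circle_complex) circle ?i" by (simp add: circle_complex_simps)
  then obtain r where r: "continuous_map (cw_space X) circle r" "\<And>x. x \<in> cw_points circle_complex \<Longrightarrow> r x = x"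
    using cell_attached_map[OF X(1), of circle ?i "\<lambda>x. circ 0"] X(2) by (metis circ_in_circle continuous_map_const topspace_euclidean_subtopology)
  have r': "r x = x" if "x \<in> disk_boundary 2" for x using r(2) that by (simp add: circle_complex_simps)
  obtain L e \<psi> where L: "cell_attached X L 2 e \<psi>" "\<And>x. x \<in> disk_boundary 2 \<Longrightarrow> \<psi> x = power_map 5 x"
    "\<forall>x\<in>cw_points L. x 0 < 2 + 1 + 1"
    using attach_along_power_map[OF CX X(3), of 5] by metis
  note AL = cell_attachedD[OF L(1)]
  have CL: "emb circle_complex L ?i" using emb_compose[OF CX AL(7)] .
  have Lf: "finite_cw L" by (rule AL(6))
  obtain K1 e1 \<phi>1 where K1: "cell_attached L K1 2 e1 \<phi>1" "\<And>x. x \<in> disk_boundary 2 \<Longrightarrow> \<phi>1 x = power_map 1 x"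
    "\<forall>x\<in>cw_points K1. x 0 < 2 + 1 + 1 + 1"
    using attach_along_power_map[OF CL L(3), of 1] by metis
  obtain K2 e2 \<phi>2 where K2: "cell_attached L K2 2 e2 \<phi>2" "\<And>x. x \<in> disk_boundary 2 \<Longrightarrow> \<phi>2 x = power_map 2 x"
    "\<forall>x\<in>cw_points K2. x 0 < 2 + 1 + 1 + 1"
    using attach_along_power_map[OF CL L(3), of 2] by metis
  note A1 = cell_attachedD[OF K1(1)] and A2 = cell_attachedD[OF K2(1)]
  have CK1: "emb circle_complex K1 ?i" and CK2: "emb circle_complex K2 ?i"
    using emb_compose[OF CL A1(7)] emb_compose[OF CL A2(7)] .
  obtain M11 e11 \<phi>11 where M11: "cell_attached K1 M11 2 e11 \<phi>11" "\<And>x. x \<in> disk_boundary 2 \<Longrightarrow> \<phi>11 x = power_map 1 x"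
    "\<forall>x\<in>cw_points M11. x 0 < 2 + 1 + 1 + 1 + 1"
    using attach_along_power_map[OF CK1 K1(3), of 1] by metis
  obtain M12 e12 \<phi>12 where M12: "cell_attached K1 M12 2 e12 \<phi>12" "\<And>x. x \<in> disk_boundary 2 \<Longrightarrow> \<phi>12 x = power_map 2 x"
    using attach_along_power_map[OF CK1 K1(3), of 2] by metis
  obtain M21 e21 \<phi>21 where M21: "cell_attached K2 M21 2 e21 \<phi>21" "\<And>x. x \<in> disk_boundary 2 \<Longrightarrow> \<phi>21 x = power_map 1 x"
    "\<forall>x\<in>cw_points M21. x 0 < 2 + 1 + 1 + 1 + 1"
    using attach_along_power_map[OF CK2 K2(3), of 1] by metis
  obtain M22 e22 \<phi>22 where M22: "cell_attached K2 M22 2 e22 \<phi>22" "\<And>x. x \<in> disk_boundary 2 \<Longrightarrow> \<phi>22 x = power_map 2 x"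
    using attach_along_power_map[OF CK2 K2(3), of 2] by metis
  have dimC: "cw_dim_le circle_complex N" using N by (simp add: cw_dim_le_def circle_complex_simps)
  have dimL: "cw_dim_le L N"
    using cell_attached_dim_le[OF L(1) cell_attached_dim_le[OF X(1) dimC order_refl] N(1)] .
  have "e0 \<in> cw_cells L N" using cell_attachedD(8)[OF X(1)] embD(5)[OF AL(7)] by force
  then have dimLeq: "cw_dim_eq L (n - 1)" using dimL by (auto simp: cw_dim_eq_def N_def)
  have n2: "2 \<le> n" using assms by simp
  have dimLn: "cw_dim_le L n" using dimL N(2) by (auto simp: cw_dim_le_def)
  have dimK: "cw_dim_le K1 n" "cw_dim_le K2 n"
    using cell_attached_dim_le[OF K1(1) dimLn n2] cell_attached_dim_le[OF K2(1) dimLn n2] .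
  have K: "(K1, ?i) \<in> complexes_over n L" "(K2, ?i) \<in> complexes_over n L"
    using dimK A1(7) A2(7) by (simp_all add: complexes_over_iff[OF Lf])
  have M: "(M11, ?i) \<in> complexes_over n L" "(M12, ?i) \<in> complexes_over n L"
      "(M21, ?i) \<in> complexes_over n L" "(M22, ?i) \<in> complexes_over n L"
    using cell_attached_dim_le[OF M11(1) dimK(1) n2] cell_attached_dim_le[OF M12(1) dimK(1) n2]
      cell_attached_dim_le[OF M21(1) dimK(2) n2] cell_attached_dim_le[OF M22(1) dimK(2) n2]
      emb_compose[OF A1(7) cell_attachedD(7)[OF M11(1)]] emb_compose[OF A1(7) cell_attachedD(7)[OF M12(1)]]
      emb_compose[OF A2(7) cell_attachedD(7)[OF M21(1)]] emb_compose[OF A2(7) cell_attachedD(7)[OF M22(1)]]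
    by (simp_all add: complexes_over_iff[OF Lf])
  let ?T1 = "subtopology (cw_space K1) (skeleton K1 2)" and ?T2 = "subtopology (cw_space K2) (skeleton K2 2)"
  \<comment> \<open>In \<open>K1\<close> the new cell, attached by the identity of the circle, is
    itself a disk that fills the circle.\<close>
  have "continuous_map (disk 2) ?T1 \<phi>1"
    using A1(14) cell_attached_disk_skeleton[OF K1(1)] by (auto simp: continuous_map_in_subtopology)
  then have null1: "homotopic_with (\<lambda>_. True) circle ?T1 (\<lambda>x. x) (\<lambda>x. circ 0)"
    using null_homotopy_1 K1(2) power_map_1 by simp
  \<comment> \<open>In \<open>K2\<close> squares are filled by the new cell and fifth powers by the
    2-cell \<open>e\<close> of \<open>L\<close>.\<close>
  have "continuous_map (disk 2) (cw_space K2) \<psi>"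
    using continuous_map_compose[OF AL(14) embD(3)[OF A2(7)]] by (simp add: o_def)
  then have "continuous_map (disk 2) ?T2 \<psi>"
    using cell_attached_disk_skeleton[OF L(1)] skeleton_mono[OF A2(7) order_refl, of 2]
    by (auto simp: continuous_map_in_subtopology)
  moreover have "continuous_map (disk 2) ?T2 \<phi>2"
    using A2(14) cell_attached_disk_skeleton[OF K2(1)] by (auto simp: continuous_map_in_subtopology)
  moreover have "continuous_map circle ?T2 (\<lambda>x. x)"
    using circle_inclusion_continuous[OF CK2] circle_in_skeleton[OF CK2] skeleton_mono[OF emb_id[OF A2(6)], of 1 2]
    by (auto simp: continuous_map_in_subtopology)
  ultimately have null2: "homotopic_with (\<lambda>_. True) circle ?T2 (\<lambda>x. x) (\<lambda>x. circ 0)"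
    using null_homotopy_2 L(2) K2(2) by blast
  let ?R = "deformation_rel n L"
  have eq: "equiv (complexes_over n L) ?R" by (rule equiv_deformation_rel)
  define a where "a = ?R `` {(K1, ?i)}"
  define b where "b = ?R `` {(K2, ?i)}"
  \<comment> \<open>Within each pair only the attaching map of the last cell differs, over
    \<open>K1\<close> and over \<open>K2\<close> respectively.\<close>
  have "((M11, ?i), (M12, ?i)) \<in> ?R" "((M21, ?i), (M22, ?i)) \<in> ?R"
    using attached_power_cells_deformation[OF Lf A1(7) dimK(1) n2 null1 M11(1,2) M12 M11(3)]
      attached_power_cells_deformation[OF Lf A2(7) dimK(2) n2 null2 M21(1,2) M22 M21(3)] M
    by (simp_all add: deformation_rel_def)
  then have cls: "?R `` {(M11, ?i)} = ?R `` {(M12, ?i)}" "?R `` {(M21, ?i)} = ?R `` {(M22, ?i)}"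
    using equiv_class_eq[OF eq] by blast+
  have prods: "KL_mult n L a a = ?R `` {(M11, ?i)}" "KL_mult n L a b = ?R `` {(M12, ?i)}"
    "KL_mult n L b a = ?R `` {(M21, ?i)}" "KL_mult n L b b = ?R `` {(M22, ?i)}"
  proof -
    obtain f f' where "glues L K1 ?i K1 ?i M11 ?i f f'"
      using cell_attached_glues[OF K1(1) K1(1) M11(1)] M11(2) K1(2) by metis
    then show "KL_mult n L a a = ?R `` {(M11, ?i)}" unfolding a_def by (rule KL_mult_eq_class[OF Lf K(1) K(1)])
    obtain f f' where "glues L K1 ?i K2 ?i M12 ?i f f'"
      using cell_attached_glues[OF K1(1) K2(1) M12(1)] M12(2) K2(2) by metis
    then show "KL_mult n L a b = ?R `` {(M12, ?i)}" unfolding a_def b_def by (rule KL_mult_eq_class[OF Lf K(1) K(2)])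
    obtain f f' where "glues L K2 ?i K1 ?i M21 ?i f f'"
      using cell_attached_glues[OF K2(1) K1(1) M21(1)] M21(2) K1(2) by metis
    then show "KL_mult n L b a = ?R `` {(M21, ?i)}" unfolding a_def b_def by (rule KL_mult_eq_class[OF Lf K(2) K(1)])
    obtain f f' where "glues L K2 ?i K2 ?i M22 ?i f f'"
      using cell_attached_glues[OF K2(1) K2(1) M22(1)] M22(2) K2(2) by metis
    then show "KL_mult n L b b = ?R `` {(M22, ?i)}" unfolding b_def by (rule KL_mult_eq_class[OF Lf K(2) K(2)])
  qed
  define c where "c = ?R `` {(M11, ?i)}"
  \<comment> \<open>The deformations give \<open>a a = a b\<close> and \<open>b a = b b\<close>;
    commutativity closes the chain.\<close>
  have c: "KL_mult n L a a = c" "KL_mult n L a b = c" "KL_mult n L b a = c" "KL_mult n L b b = c"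
    using prods cls KL_mult_commute[of n L a b] by (simp_all add: c_def)
  have ab: "a \<noteq> b"
  proof
    assume "a = b"
    then have "((K1, ?i), (K2, ?i)) \<in> ?R"
      using eq_equiv_class[OF _ eq K(2)] unfolding a_def b_def by blast
    then have "((K1, ?i), (K2, ?i)) \<in> deformation (n + 1) L" by (simp add: deformation_rel_def)
    then show False
      using power_complexes_not_deformation_equivalent[OF L(1,2) CX r(1) r' K1(1,2) K2(1,2)] by blast
  qed
  define x :: "point bounded_cw set \<Rightarrow>\<^sub>0 'k" where "x = Poly_Mapping.single a 1 - Poly_Mapping.single b 1"
  have xa: "Poly_Mapping.lookup x a = 1" and xb: "Poly_Mapping.lookup x b = -1"
    using ab by (simp_all add: x_def lookup_minus lookup_single)
  have x0: "Poly_Mapping.lookup x y = 0" if "y \<noteq> a" "y \<noteq> b" for y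
    using that by (simp add: x_def lookup_minus lookup_single)
  have keys: "Poly_Mapping.keys x = {a, b}"
    using xa xb x0 by (auto simp: in_keys_iff)
  have "a \<in> KL n L" "b \<in> KL n L"
    using K by (simp_all add: KL_def a_def b_def quotientI)
  then have "x \<in> kKL n L" by (simp add: kKL_def keys)
  \<comment> \<open>In \<open>comm_ring_1\<close> the elements 0 and 1 differ, so the coefficient of
    \<open>a\<close> is nonzero.\<close>
  moreover have "x \<noteq> 0" using xa by auto
  \<comment> \<open>All four products are \<open>c\<close>, with coefficients \<open>1\<close>,
    \<open>-1\<close>, \<open>-1\<close> and \<open>1\<close>.\<close>
  moreover have "kKL_mult n L x x = 0"
    using ab by (simp add: kKL_mult_def keys xa xb c single_add[symmetric])
  ultimately show ?thesis using Lf dimLeq by blast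
qed

end
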